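(* Assume the uMv-hinted uMv conjecture. Then for every constant $\varepsilon>0$, any dynamic algorithm with polynomial pre-processing time that maintains the product of five $n\times n$ (boolean) matrices under element updates and element queries requires worst-case time $\Omega\big(\min_{\tau_1,\tau_2}(n^{\tau_1+\tau_2}+n^{\omega(1,\tau_1,\tau_2)-\tau_2}+n^{\omega(1,1,\tau_1)-\tau_1})\,n^{-\varepsilon}\big)$ for updates or queries. With current bounds on $\omega$ this gives a lower bound of $\Omega(n^{1.407})$.
   Context: All computations are over the boolean semi-ring. For a matrix $N$ and vectors $I=(i_1,\dots,i_p)\in[n]^p$, $J=(j_1,\dots,j_q)\in[n]^q$, $N_{I,J}$ denotes the $p\times q$ matrix with $(N_{I,J})_{s,r}=N_{i_s,j_r}$. The uMv-hinted uMv problem, for $t_1=n^{\tau_1}$, $t_2=n^{\tau_2}$ with $0<\tau_1,\tau_2<1$, has four phases: (1) input $U\in\{0,1\}^{n\times t_1}$, $N\in\{0,1\}^{n\times n}$, $V\in\{0,1\}^{t_2\times n}$; (2) input $I\in[n]^{t_1}$; (3) input $J\in[n]^{t_2}$; (4) input indices $i,j\in[n]$ and output $(UN_{I,J}V)_{i,j}$. The uMv-hinted uMv conjecture: for every $\varepsilon>0$, any algorithm solving this problem with polynomial pre-processing time in phase 1 requires $\Omega(n^{\omega(1,\tau_1,1)-\varepsilon})$ time in phase 2, or $\Omega(n^{\omega(\tau_2,\tau_1,1)-\varepsilon})$ time in phase 3, or $\Omega(n^{\tau_1+\tau_2-\varepsilon})$ time in phase 4. $\omega(a,b,c)$ is the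 exponent of the cost of multiplying an $n^a\times n^b$ matrix by an $n^b\times n^c$ matrix (symmetric in its arguments).
   Formalization: The 1.407 is read as a rounded value: with the listed Le Gall–Urrutia bounds (k ≤ 1) the exponent e rounds to 1.407 (it is just below it), and the lower bound is n^(e−ε), assuming these bounds on ω are its true values, since upper bounds on ω alone give no lower bound. *)

theory Defs
  imports "Jordan_Normal_Form.Matrix" "HOL-Library.Landau_Symbols"
begin

section \<open>Boolean matrices\<close>

text \<open>
  Indices are 0-based throughout: an index set of size \<open>n\<close> is \<open>{..<n}\<close>.
  HOL's type \<open>bool\<close> carries no semiring instance, so the product over the boolean semiring
  (disjunction as addition, conjunction as multiplication) is written out.
\<close>

definition bmult :: "bool mat \<Rightarrow> bool mat \<Rightarrow> bool mat"  (infixl \<open>\<odot>\<close> 70) where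
  "A \<odot> B = mat (dim_row A) (dim_col B) (\<lambda>(i, j). \<exists>k<dim_col A. A $$ (i, k) \<and> B $$ (k, j))"

text \<open>Repetitions in the index vectors are allowed, hence lists rather than sets.\<close>

definition submat :: "'a mat \<Rightarrow> nat list \<Rightarrow> nat list \<Rightarrow> 'a mat" where
  "submat N I J = mat (length I) (length J) (\<lambda>(s, r). N $$ (I ! s, J ! r))"

definition entries :: "'a mat \<Rightarrow> 'a list" where
  "entries A = concat (mat_to_list A)"

definition bits :: "bool mat \<Rightarrow> nat list" where
  "bits A = map of_bool (entries A)"

text \<open>The dimension \<open>n\<^sup>\<tau>\<close>, rounded down to an integer.\<close>

definition npow :: "nat \<Rightarrow> real \<Rightarrow> nat" where
  "npow n \<tau> = nat \<lfloor>real n powr \<tau>\<rfloor>"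


section \<open>The exponent of rectangular matrix multiplication\<close>

text \<open>
  The cost of matrix multiplication is the number of arithmetic operations in the usual algebraic
  sense: the length of a shortest straight-line program over the complex numbers. A program starts
  with the list of inputs; every instruction appends one value, and operands refer to positions of
  this list.
\<close>

datatype arith_instr =
    AConst complex
  | AAdd nat nat
  | ASub nat nat
  | AMul nat nat

definition lookup0 :: "complex list \<Rightarrow> nat \<Rightarrow> complex" where
  "lookup0 xs k = (if k < length xs then xs ! k else 0)"

fun arith_val :: "complex list \<Rightarrow> arith_instr \<Rightarrow> complex" where
  "arith_val xs (AConst z) = z"
| "arith_val xs (AAdd k l) = lookup0 xs k + lookup0 xs l"
| "arith_val xs (ASub k l) = lookup0 xs k - lookup0 xs l"
| "arith_val xs (AMul k l) = lookup0 xs k * lookup0 xs l"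

fun arith_run :: "arith_instr list \<Rightarrow> complex list \<Rightarrow> complex list" where
  "arith_run [] xs = xs"
| "arith_run (c # cs) xs = arith_run cs (xs @ [arith_val xs c])"

text \<open>The positions \<open>pos i j\<close> of the output entries do not depend on the input matrices.\<close>

definition computes_product :: "arith_instr list \<Rightarrow> nat \<Rightarrow> nat \<Rightarrow> nat \<Rightarrow> bool" where
  "computes_product cs p q r \<longleftrightarrow>
     (\<exists>pos. \<forall>A \<in> carrier_mat p q. \<forall>B \<in> carrier_mat q r. \<forall>i<p. \<forall>j<r.
        lookup0 (arith_run cs (entries A @ entries B)) (pos i j) = (A * B) $$ (i, j))"

definition mm_cost :: "nat \<Rightarrow> nat \<Rightarrow> nat \<Rightarrow> nat" where
  "mm_cost p q r = (LEAST l. \<exists>cs. computes_product cs p q r \<and> length cs = l)"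

definition omega :: "real \<Rightarrow> real \<Rightarrow> real \<Rightarrow> real" where
  "omega a b c =
     Inf {\<beta>. (\<lambda>n. real (mm_cost (npow n a) (npow n b) (npow n c))) \<in> O(\<lambda>n. real n powr \<beta>)}"


section \<open>Word RAM programs\<close>

text \<open>
  Algorithms are programs for a deterministic word RAM with words of \<open>O(log n)\<close> bits. The machine
  has registers (only finitely many occur in a program), a random access memory, both initially
  zero, and random access to the read-only input of the current phase or operation. Every elementary
  step has unit cost. \<open>IfNZ\<close> and \<open>WhileNZ\<close> branch on a register being nonzero.
\<close>

datatype binop =
  Plus | Minus | Times | Div | Mod | BitAnd | BitOr | BitXor | ShiftL | ShiftR | Less | Equal

fun binop_val :: "binop \<Rightarrow> nat \<Rightarrow> nat \<Rightarrow> nat" where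
  "binop_val Plus a b = a + b"
| "binop_val Minus a b = a - b"
| "binop_val Times a b = a * b"
| "binop_val Div a b = a div b"
| "binop_val Mod a b = a mod b"
| "binop_val BitAnd a b = semiring_bit_operations_class.and a b"
| "binop_val BitOr a b = semiring_bit_operations_class.or a b"
| "binop_val BitXor a b = semiring_bit_operations_class.xor a b"
| "binop_val ShiftL a b = push_bit b a"
| "binop_val ShiftR a b = drop_bit b a"
| "binop_val Less a b = of_bool (a < b)"
| "binop_val Equal a b = of_bool (a = b)"

datatype prog =
    Skip
  | SetConst nat nat
  | Arith nat binop nat nat
  | Input nat nat
  | Load nat nat
  | Store nat nat
  | Seq prog prog
  | IfNZ nat prog prog
  | WhileNZ nat prog

type_synonym ram_state = "(nat \<Rightarrow> nat) \<times> (nat \<Rightarrow> nat)"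

definition init_state :: ram_state where
  "init_state = (\<lambda>_. 0, \<lambda>_. 0)"

text \<open>
  \<open>exec W inp p s t s'\<close>: with input \<open>inp\<close>, program \<open>p\<close> started in state \<open>s\<close> halts in state \<open>s'\<close>
  after \<open>t\<close> steps, and all words that are produced are smaller than \<open>W\<close>. Producing a larger word,
  or reading beyond the end of the input, leaves the machine stuck, so such a run does not count
  as a successful one.
\<close>

inductive exec :: "nat \<Rightarrow> nat list \<Rightarrow> prog \<Rightarrow> ram_state \<Rightarrow> nat \<Rightarrow> ram_state \<Rightarrow> bool"
  for W :: nat and inp :: "nat list" where
  Skip: "exec W inp Skip s 1 s"
| SetConst: "v < W \<Longrightarrow> exec W inp (SetConst x v) (R, M) 1 (R(x := v), M)"
| Arith: "v = binop_val f (R y) (R z) \<Longrightarrow> v < W \<Longrightarrow> exec W inp (Arith x f y z) (R, M) 1 (R(x := v), M)"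
| Input: "R y < length inp \<Longrightarrow> v = inp ! R y \<Longrightarrow> v < W \<Longrightarrow> exec W inp (Input x y) (R, M) 1 (R(x := v), M)"
| Load: "exec W inp (Load x y) (R, M) 1 (R(x := M (R y)), M)"
| Store: "exec W inp (Store x y) (R, M) 1 (R, M(R x := R y))"
| Seq: "exec W inp p s t s' \<Longrightarrow> exec W inp q s' t' s'' \<Longrightarrow> exec W inp (Seq p q) s (t + t') s''"
| IfTrue: "fst s x \<noteq> 0 \<Longrightarrow> exec W inp p s t s' \<Longrightarrow> exec W inp (IfNZ x p q) s (Suc t) s'"
| IfFalse: "fst s x = 0 \<Longrightarrow> exec W inp q s t s' \<Longrightarrow> exec W inp (IfNZ x p q) s (Suc t) s'"
| WhileTrue: "fst s x \<noteq> 0 \<Longrightarrow> exec W inp p s t s' \<Longrightarrow> exec W inp (WhileNZ x p) s' t' s''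
    \<Longrightarrow> exec W inp (WhileNZ x p) s (Suc (t + t')) s''"
| WhileFalse: "fst s x = 0 \<Longrightarrow> exec W inp (WhileNZ x p) s 1 s"

text \<open>Words below \<open>(n + 2)\<^sup>c\<close> are words of \<open>O(log n)\<close> bits; each algorithm fixes its own constant \<open>c\<close>.\<close>

definition word_bound :: "nat \<Rightarrow> nat \<Rightarrow> nat" where
  "word_bound c n = (n + 2) ^ c"

definition halts_within ::
    "nat \<Rightarrow> nat \<Rightarrow> nat list \<Rightarrow> prog \<Rightarrow> ram_state \<Rightarrow> nat \<Rightarrow> (ram_state \<Rightarrow> bool) \<Rightarrow> bool" where
  "halts_within c n inp p s T Q \<longleftrightarrow>
     (\<exists>t s'. exec (word_bound c n) inp p s t s' \<and> t \<le> T \<and> Q s')"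

text \<open>The answer is delivered in register 0.\<close>

definition answer :: "ram_state \<Rightarrow> nat" where
  "answer s = fst s 0"

definition polynomially_bounded :: "(nat \<Rightarrow> nat) \<Rightarrow> bool" where
  "polynomially_bounded T \<longleftrightarrow> (\<exists>k. (\<lambda>n. real (T n)) \<in> O(\<lambda>n. real n ^ k))"


section \<open>The uMv-hinted uMv problem and conjecture\<close>

definition index_vectors :: "nat \<Rightarrow> nat \<Rightarrow> nat list set" where
  "index_vectors n t = {I. length I = t \<and> set I \<subseteq> {..<n}}"

text \<open>
  \<open>p1\<close>, \<dots>, \<open>p4\<close> are the programs run in the four phases, each continuing from the state in
  which the previous one halted; \<open>T1 n\<close>, \<dots>, \<open>T4 n\<close> bound their worst-case running times.
\<close>

definition solves_hinted_uMv ::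
    "real \<Rightarrow> real \<Rightarrow> nat \<Rightarrow> prog \<Rightarrow> prog \<Rightarrow> prog \<Rightarrow> prog \<Rightarrow>
     (nat \<Rightarrow> nat) \<Rightarrow> (nat \<Rightarrow> nat) \<Rightarrow> (nat \<Rightarrow> nat) \<Rightarrow> (nat \<Rightarrow> nat) \<Rightarrow> bool" where
  "solves_hinted_uMv \<tau>1 \<tau>2 c p1 p2 p3 p4 T1 T2 T3 T4 \<longleftrightarrow>
     (\<forall>n>0. let t1 = npow n \<tau>1; t2 = npow n \<tau>2 in
        \<forall>U \<in> carrier_mat n t1. \<forall>N \<in> carrier_mat n n. \<forall>V \<in> carrier_mat t2 n.
          halts_within c n ([n, t1, t2] @ bits U @ bits N @ bits V) p1 init_state (T1 n) (\<lambda>s1.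
            \<forall>I \<in> index_vectors n t1. halts_within c n I p2 s1 (T2 n) (\<lambda>s2.
              \<forall>J \<in> index_vectors n t2. halts_within c n J p3 s2 (T3 n) (\<lambda>s3.
                \<forall>i<n. \<forall>j<n. halts_within c n [i, j] p4 s3 (T4 n) (\<lambda>s4.
                  answer s4 = of_bool ((U \<odot> submat N I J \<odot> V) $$ (i, j)))))))"

text \<open>
  The disjunction is taken for each large \<open>n\<close> separately: an algorithm may shift its work between
  the phases depending on \<open>n\<close>, so that no single one of its phases is slow for all large \<open>n\<close>.
\<close>

definition hinted_uMv_conjecture :: bool where
  "hinted_uMv_conjecture \<longleftrightarrow>
     (\<forall>\<tau>1 \<in> {0<..<1}. \<forall>\<tau>2 \<in> {0<..<1}. \<forall>\<epsilon>>0. \<forall>c p1 p2 p3 p4 T1 T2 T3 T4.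
        solves_hinted_uMv \<tau>1 \<tau>2 c p1 p2 p3 p4 T1 T2 T3 T4 \<and> polynomially_bounded T1 \<longrightarrow>
        (\<exists>C>0. \<forall>\<^sub>F n in at_top.
            real (T2 n) \<ge> C * real n powr (omega 1 \<tau>1 1 - \<epsilon>)
          \<or> real (T3 n) \<ge> C * real n powr (omega \<tau>2 \<tau>1 1 - \<epsilon>)
          \<or> real (T4 n) \<ge> C * real n powr (\<tau>1 + \<tau>2 - \<epsilon>)))"


section \<open>Dynamic product of five matrices\<close>

definition five_matrices :: "nat \<Rightarrow> bool mat list set" where
  "five_matrices n = {As. length As = 5 \<and> set As \<subseteq> carrier_mat n n}"

definition product5 :: "bool mat list \<Rightarrow> bool mat" where
  "product5 As = As ! 0 \<odot> As ! 1 \<odot> As ! 2 \<odot> As ! 3 \<odot> As ! 4"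

definition set_entry :: "bool mat list \<Rightarrow> nat \<Rightarrow> nat \<Rightarrow> nat \<Rightarrow> bool \<Rightarrow> bool mat list" where
  "set_entry As k i j b = As[k := update_mat (As ! k) (i, j) b]"

text \<open>
  \<open>reachable c n pI pU pQ As s\<close>: after initialisation (\<open>pI\<close>) and some sequence of updates (\<open>pU\<close>)
  and queries (\<open>pQ\<close>), the current matrices are \<open>As\<close> and the machine is in state \<open>s\<close>.
\<close>

inductive reachable ::
    "nat \<Rightarrow> nat \<Rightarrow> prog \<Rightarrow> prog \<Rightarrow> prog \<Rightarrow> bool mat list \<Rightarrow> ram_state \<Rightarrow> bool"
  for c n :: nat and pI pU pQ :: prog where
  init: "As \<in> five_matrices n \<Longrightarrow>
     exec (word_bound c n) ([n] @ concat (map bits As)) pI init_state t s \<Longrightarrow>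
     reachable c n pI pU pQ As s"
| update: "reachable c n pI pU pQ As s \<Longrightarrow> k < 5 \<Longrightarrow> i < n \<Longrightarrow> j < n \<Longrightarrow>
     exec (word_bound c n) [k, i, j, of_bool b] pU s t s' \<Longrightarrow>
     reachable c n pI pU pQ (set_entry As k i j b) s'"
| query: "reachable c n pI pU pQ As s \<Longrightarrow> i < n \<Longrightarrow> j < n \<Longrightarrow>
     exec (word_bound c n) [i, j] pQ s t s' \<Longrightarrow>
     reachable c n pI pU pQ As s'"

text \<open>
  \<open>TI\<close>, \<open>TU\<close>, \<open>TQ\<close> bound the worst-case times of pre-processing, of each update and of each query.
\<close>

definition dynamic_product5 ::
    "nat \<Rightarrow> prog \<Rightarrow> prog \<Rightarrow> prog \<Rightarrow> (nat \<Rightarrow> nat) \<Rightarrow> (nat \<Rightarrow> nat) \<Rightarrow> (nat \<Rightarrow> nat) \<Rightarrow> bool" where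
  "dynamic_product5 c pI pU pQ TI TU TQ \<longleftrightarrow>
     (\<forall>n>0.
        (\<forall>As \<in> five_matrices n.
           halts_within c n ([n] @ concat (map bits As)) pI init_state (TI n) (\<lambda>_. True)) \<and>
        (\<forall>As s. reachable c n pI pU pQ As s \<longrightarrow>
           (\<forall>k<5. \<forall>i<n. \<forall>j<n. \<forall>b.
              halts_within c n [k, i, j, of_bool b] pU s (TU n) (\<lambda>_. True)) \<and>
           (\<forall>i<n. \<forall>j<n.
              halts_within c n [i, j] pQ s (TQ n)
                (\<lambda>s'. answer s' = of_bool (product5 As $$ (i, j))))))"


section \<open>Numerical bounds on the exponent\<close>

text \<open>
  Upper bounds on \<open>omega 1 1 k\<close> for \<open>k \<le> 1\<close> due to Le Gall and Urrutia (SODA 2018), as pairs of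
  \<open>k\<close> and the bound. These rows yield the exponent 1.407; their rows for \<open>k > 1\<close> are not used.
\<close>

definition omega_table :: "(real \<times> real) list" where
  "omega_table =
    [(0.31389, 2), (0.32, 2.000064), (0.33, 2.000448), (0.34, 2.001118), (0.35, 2.001957),
     (0.40, 2.010314), (0.45, 2.024801), (0.50, 2.044183), (0.5286, 2.057085), (0.55, 2.067488),
     (0.60, 2.093981), (0.65, 2.123097), (0.70, 2.154399), (0.75, 2.187543), (0.80, 2.222256),
     (0.85, 2.258317), (0.90, 2.295544), (0.95, 2.333789), (1, 2.372927)]"

text \<open>
  The table is extended to all triples by the standard rules for the exponent: symmetry,
  monotonicity, and splitting into blocks, i.e. subadditivity and homogeneity (so in particular
  convex interpolation between rows of the table).
\<close>

inductive derivable_bound :: "real \<Rightarrow> real \<Rightarrow> real \<Rightarrow> real \<Rightarrow> bool" where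
  table: "(k, \<beta>) \<in> set omega_table \<Longrightarrow> derivable_bound 1 1 k \<beta>"
| line: "derivable_bound 1 0 0 1"
| rotate: "derivable_bound a b c \<beta> \<Longrightarrow> derivable_bound b c a \<beta>"
| swap: "derivable_bound a b c \<beta> \<Longrightarrow> derivable_bound b a c \<beta>"
| mono: "derivable_bound a b c \<beta> \<Longrightarrow> 0 \<le> a' \<Longrightarrow> a' \<le> a \<Longrightarrow> derivable_bound a' b c \<beta>"
| scale: "derivable_bound a b c \<beta> \<Longrightarrow> 0 \<le> r \<Longrightarrow> derivable_bound (r * a) (r * b) (r * c) (r * \<beta>)"
| split: "derivable_bound a b c \<beta> \<Longrightarrow> derivable_bound a' b' c' \<beta>' \<Longrightarrow>
     derivable_bound (a + a') (b + b') (c + c') (\<beta> + \<beta>')"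

definition current_omega :: "real \<Rightarrow> real \<Rightarrow> real \<Rightarrow> real" where
  "current_omega a b c = Inf {\<beta>. derivable_bound a b c \<beta>}"

text \<open>
  The exponent of the minimum over \<open>\<tau>1\<close>, \<open>\<tau>2\<close> of
  \<open>n\<^bsup>\<tau>1 + \<tau>2\<^esup> + n\<^bsup>w(1,\<tau>1,\<tau>2) - \<tau>2\<^esup> + n\<^bsup>w(1,1,\<tau>1) - \<tau>1\<^esup>\<close>.
\<close>

definition balanced_exponent :: "(real \<Rightarrow> real \<Rightarrow> real \<Rightarrow> real) \<Rightarrow> real" where
  "balanced_exponent w =
     (INF (\<tau>1, \<tau>2) \<in> {0<..<1} \<times> {0<..<1}.
        max (\<tau>1 + \<tau>2) (max (w 1 \<tau>1 \<tau>2 - \<tau>2) (w 1 1 \<tau>1 - \<tau>1)))"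

end

theory Submission
  imports Defs
begin

text \<open>
  Given a dynamic data structure for the product of five matrices, the hinted problem is solved by
  maintaining \<open>U S N R V\<close>, where \<open>S\<close> and \<open>R\<close> are selection matrices, initially zero: phase 2 makes
  \<open>S N\<close> select the rows \<open>I\<close> by \<open>n\<^bsup>\<tau>1\<^esup>\<close> updates, phase 3 makes \<open>N R\<close> select the columns \<open>J\<close> by
  \<open>n\<^bsup>\<tau>2\<^esup>\<close> updates, and phase 4 is a single query. For each pair \<open>\<tau>1, \<tau>2\<close> the conjecture thus bounds
  the time per operation by the minimum of the three terms. This minimum meets the maximum of the
  three terms at a point where they are all equal. Such a point exists because the exponent
  \<open>\<omega>(1, a, b)\<close> is symmetric in \<open>a, b\<close>, monotone and nonexpansive; the symmetry comes from transposition and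
  from Baur and Strassen's theorem on computing gradients. The value 1.407 is
  certified by linear programming duality.
\<close>

section \<open>The numerical value of the balanced exponent\<close>

text \<open>The conjecture only says that one of the phases is slow, so a fixed pair of exponents
  yields the smallest of three terms, whereas the claim has their sum, minimised over all pairs.
  Bounding the infimum by its value at a single pair is therefore enough, provided that the three
  terms nearly agree there. The balanced pair may lie on the boundary of the unit square, where the
  conjecture says nothing; it is pushed inside at the expense of a part of \<epsilon>.

  The cost counts arbitrary straight-line programs, in which nothing relates the inner dimension to
  the outer ones. Differentiating a program for a trilinear form is what exchanges them, at the
  price of a constant factor.

  The programs of the data structure expect inputs of their own, while each phase has its own
  read-only input. They are therefore not run as they are but simulated, with their inputs laid out
  in memory; this costs a constant factor in time and a constant in the exponent of the word bound.

  The rules that extend the table are linear or monotone, so a linear lower bound valid on the table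
  survives all of them. This makes the infimum over all derivations accessible from below; an
  explicit derivation settles the other side.\<close>

lemma derivable_bound_ge_linear:
  assumes "derivable_bound a b c \<beta>"
    and xyz: "0 \<le> x" "x \<le> 1" "0 \<le> y" "y \<le> 1" "0 \<le> z" "z \<le> 1"
    and table: "\<And>k \<gamma>. (k, \<gamma>) \<in> set omega_table \<Longrightarrow>
      x + y + z * k \<le> \<gamma> \<and> x + y * k + z \<le> \<gamma> \<and> x * k + y + z \<le> \<gamma>"
  shows "x * a + y * b + z * c \<le> \<beta>"
proof -
  \<comment> \<open>Weak duality: the weights give a linear functional that lies below every
    generating bound, and each rule preserves this. Since \<open>rotate\<close> and
    \<open>swap\<close> permute the triple, the induction carries all six orders of the weights at
    once.\<close>
  have "0 \<le> a \<and> 0 \<le> b \<and> 0 \<le> c \<and>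
      x * a + y * b + z * c \<le> \<beta> \<and> x * b + y * c + z * a \<le> \<beta> \<and> x * c + y * a + z * b \<le> \<beta> \<and>
      x * b + y * a + z * c \<le> \<beta> \<and> x * a + y * c + z * b \<le> \<beta> \<and> x * c + y * b + z * a \<le> \<beta>"
    using assms(1)
  proof induction
    case (table k \<beta>)
    moreover have "0 \<le> k" using table by (auto simp: omega_table_def)
    ultimately show ?case using assms(8)[OF table] by (auto simp: algebra_simps)
  next
    case line
    then show ?case using xyz by simp
  next
    case (rotate a b c \<beta>)
    then show ?case by auto
  next
    case (swap a b c \<beta>)
    then show ?case by auto
  next
    case (mono a b c \<beta> a')
    then have "x * a' \<le> x * a" "y * a' \<le> y * a" "z * a' \<le> z * a"
      using xyz by (auto intro: mult_left_mono)
    with mono show ?case by auto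
  next
    case (scale a b c \<beta> r)
    have "u * (r * a') + v * (r * b') + w * (r * c') \<le> r * \<beta>" if "u * a' + v * b' + w * c' \<le> \<beta>"
      for u v w a' b' c' using mult_left_mono[OF that, of r] scale by (simp add: algebra_simps)
    with scale show ?case by simp
  next
    case (split a b c \<beta> a' b' c' \<beta>')
    then show ?case by (simp add: algebra_simps)
  qed
  then show ?thesis by blast
qed

lemma derivable_bound_nonneg: "derivable_bound a b c \<beta> \<Longrightarrow> 0 \<le> \<beta>"
  using derivable_bound_ge_linear[of a b c \<beta> 0 0 0] by (force simp: omega_table_def)

text \<open>Keeps the \<open>Inf\<close> in \<open>current_omega\<close> from ranging over an empty
  set.\<close>

lemma derivable_bound_exists:
  assumes "0 \<le> a" "a \<le> 1" "0 \<le> b" "b \<le> 1"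
  shows "\<exists>\<beta>. derivable_bound 1 a b \<beta>"
proof -
  have "derivable_bound 1 1 1 2.372927" by (rule derivable_bound.table) (simp add: omega_table_def)
  then have "derivable_bound a 1 1 2.372927" using assms by (auto intro: derivable_bound.mono)
  then have "derivable_bound 1 1 a 2.372927" by (auto intro: derivable_bound.rotate)
  then have "derivable_bound b 1 a 2.372927" using assms by (auto intro: derivable_bound.mono)
  then show ?thesis using derivable_bound.rotate by blast
qed

lemma current_omega_le: "derivable_bound a b c \<beta> \<Longrightarrow> current_omega a b c \<le> \<beta>"
  unfolding current_omega_def
  by (rule cInf_lower) (auto intro!: bdd_belowI[of _ 0] derivable_bound_nonneg)

lemma current_omega_ge_linear:
  assumes "0 \<le> a" "a \<le> 1" "0 \<le> b" "b \<le> 1"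
    and "0 \<le> x" "x \<le> 1" "0 \<le> y" "y \<le> 1" "0 \<le> z" "z \<le> 1"
    and "\<And>k \<gamma>. (k, \<gamma>) \<in> set omega_table \<Longrightarrow>
      x + y + z * k \<le> \<gamma> \<and> x + y * k + z \<le> \<gamma> \<and> x * k + y + z \<le> \<gamma>"
  shows "x + y * a + z * b \<le> current_omega 1 a b"
  unfolding current_omega_def
proof (rule cInf_greatest)
  show "{\<beta>. derivable_bound 1 a b \<beta>} \<noteq> {}" using derivable_bound_exists[OF assms(1-4)] by auto
  fix \<beta> assume "\<beta> \<in> {\<beta>. derivable_bound 1 a b \<beta>}"
  then show "x + y * a + z * b \<le> \<beta>" using derivable_bound_ge_linear[of 1 a b \<beta> x y z] assms by simp
qed

lemma balanced_exponent_le: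
  assumes "\<tau>1 \<in> {0<..<1}" "\<tau>2 \<in> {0<..<1}"
  shows "balanced_exponent w \<le> max (\<tau>1 + \<tau>2) (max (w 1 \<tau>1 \<tau>2 - \<tau>2) (w 1 1 \<tau>1 - \<tau>1))"
proof -
  have "bdd_below ((\<lambda>(\<tau>1, \<tau>2). max (\<tau>1 + \<tau>2) (max (w 1 \<tau>1 \<tau>2 - \<tau>2) (w 1 1 \<tau>1 - \<tau>1)))
      ` ({0<..<1} \<times> {0<..<1}))"
    by (rule bdd_belowI[of _ 0]) (auto simp: le_max_iff_disj)
  from cINF_lower[OF this, of "(\<tau>1, \<tau>2)"] assms show ?thesis
    by (simp add: balanced_exponent_def)
qed

text \<open>The weights below are an optimal dual solution, rounded, of the linear program that minimises
  the maximum over the derivable bounds; the upper bound rests on a primal one.\<close>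

lemma balanced_exponent_current_omega_ge: "1.4066 \<le> balanced_exponent current_omega"
  unfolding balanced_exponent_def
proof (rule cINF_greatest, goal_cases)
  case 1
  then show ?case by (auto intro!: exI[of _ "1/2"])
next
  case (2 \<tau>)
  obtain a b where ab: "\<tau> = (a, b)" "0 < a" "a < 1" "0 < b" "b < 1" using 2 by (cases \<tau>) auto
  have "1 + 0.7445 * a + 0.5823 * b \<le> current_omega 1 a b"
    using ab by (intro current_omega_ge_linear) (auto simp: omega_table_def)
  moreover have "0.8809 + 0.7445 * 1 + 0.7445 * a \<le> current_omega 1 1 a"
    using ab by (intro current_omega_ge_linear) (auto simp: omega_table_def)
  \<comment> \<open>The multipliers sum to 1. In the combined bound the coefficients of
    \<open>a\<close> and \<open>b\<close> cancel up to about \<open>0.00002\<close> and the constant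
    is about \<open>1.4068\<close>, so the gap down to \<open>1.4066\<close> absorbs the
    rounding.\<close>
  moreover have "1.4066 \<le> 0.07 * f + 0.1676 * g + 0.7624 * h \<Longrightarrow> 1.4066 \<le> max f (max g h)" for f g h :: real
    by (auto simp: max_def)
  ultimately show ?case using ab by (simp add: max_def; fastforce)
qed

lemma balanced_exponent_current_omega_le: "balanced_exponent current_omega < 1.4075"
proof -
  have row: "derivable_bound 1 1 0.6 2.093981" "derivable_bound 1 1 0.65 2.123097"
      "derivable_bound 1 1 0.85 2.258317" "derivable_bound 1 1 0.9 2.295544"
    by (rule derivable_bound.table; simp add: omega_table_def)+
  \<comment> \<open>The multipliers of two neighbouring rows sum to \<open>0.8557\<close>, which is
    \<tau>1, and their third components combine to \<open>0.551255\<close>, which is \<tau>2;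
    \<open>line\<close> fills the first dimension up to 1. At this pair all three terms are about
    \<open>1.4069\<close>.\<close>
  have "derivable_bound (0.099 * 1 + 0.7567 * 1 + 0.1443 * 1) (0.099 * 1 + 0.7567 * 1 + 0.1443 * 0)
      (0.099 * 0.6 + 0.7567 * 0.65 + 0.1443 * 0) (0.099 * 2.093981 + 0.7567 * 2.123097 + 0.1443 * 1)"
    by (intro derivable_bound.split derivable_bound.scale row derivable_bound.line) auto
  from current_omega_le[OF this] have "current_omega 1 0.8557 0.551255 \<le> 1.9582" by simp
  moreover have "derivable_bound (0.886 * 1 + 0.114 * 1) (0.886 * 1 + 0.114 * 1)
      (0.886 * 0.85 + 0.114 * 0.9) (0.886 * 2.258317 + 0.114 * 2.295544)"
    by (intro derivable_bound.split derivable_bound.scale row) auto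
  from current_omega_le[OF this] have "current_omega 1 1 0.8557 \<le> 2.2626" by simp
  ultimately show ?thesis
    using balanced_exponent_le[of "0.8557" "0.551255" current_omega] by simp
qed

lemma round_balanced_exponent_current_omega: "round (1000 * balanced_exponent current_omega) = 1407"
  using balanced_exponent_current_omega_ge balanced_exponent_current_omega_le
  by (intro round_unique') (auto simp: abs_if)


section \<open>Straight-line programs\<close>

lemma concat_nth_uniform:
  assumes "\<And>xs. xs \<in> set xss \<Longrightarrow> length xs = c" "i < length xss" "j < c"
  shows "concat xss ! (i * c + j) = xss ! i ! j"
  using assms
proof (induction xss arbitrary: i)
  case (Cons xs xss)
  then show ?case by (cases i) (auto simp: nth_append add.assoc)
qed simp

lemma length_concat_uniform:
  "(\<And>xs. xs \<in> set xss \<Longrightarrow> length xs = c) \<Longrightarrow> length (concat xss) = length xss * c"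
  by (induction xss) auto

lemma length_entries: "A \<in> carrier_mat p q \<Longrightarrow> length (entries A) = p * q"
  unfolding entries_def by (subst length_concat_uniform[of _ q]) (auto simp: mat_to_list_def)

lemma nth_entries: "A \<in> carrier_mat p q \<Longrightarrow> i < p \<Longrightarrow> j < q \<Longrightarrow> entries A ! (i * q + j) = A $$ (i, j)"
  unfolding entries_def by (subst concat_nth_uniform) (auto simp: mat_to_list_def)

text \<open>
  Working with sets of functions instead of lists of positions avoids all renumbering when
  programs are composed or inputs are substituted.
\<close>

definition slp_step :: "('e \<Rightarrow> complex) set \<Rightarrow> ('e \<Rightarrow> complex) \<Rightarrow> bool" where
  "slp_step X h \<longleftrightarrow> (\<exists>z. h = (\<lambda>_. z)) \<or> (\<exists>f\<in>X. \<exists>g\<in>X.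
     h = (\<lambda>e. f e + g e) \<or> h = (\<lambda>e. f e - g e) \<or> h = (\<lambda>e. f e * g e))"

text \<open>\<open>base\<close> leaves \<open>l\<close> free, so \<open>l\<close> is an upper bound
  and not an exact count, and outputs that are already available cost nothing.\<close>

inductive slp :: "('e \<Rightarrow> complex) set \<Rightarrow> nat \<Rightarrow> ('e \<Rightarrow> complex) set \<Rightarrow> bool" where
  base: "Y \<subseteq> X \<Longrightarrow> slp X l Y"
| step: "slp_step X h \<Longrightarrow> slp (insert h X) l Y \<Longrightarrow> slp X (Suc l) Y"

lemma slp_step_mono: "slp_step X h \<Longrightarrow> X \<subseteq> X' \<Longrightarrow> slp_step X' h"
  unfolding slp_step_def by blast

lemma slp_step_const: "slp_step X (\<lambda>_. z)"
  and slp_step_add: "f \<in> X \<Longrightarrow> g \<in> X \<Longrightarrow> slp_step X (\<lambda>e. f e + g e)"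
  and slp_step_diff: "f \<in> X \<Longrightarrow> g \<in> X \<Longrightarrow> slp_step X (\<lambda>e. f e - g e)"
  and slp_step_mult: "f \<in> X \<Longrightarrow> g \<in> X \<Longrightarrow> slp_step X (\<lambda>e. f e * g e)"
  unfolding slp_step_def by blast+

lemma slp_mono: "slp X l Y \<Longrightarrow> X \<subseteq> X' \<Longrightarrow> Y' \<subseteq> Y \<Longrightarrow> l \<le> l' \<Longrightarrow> slp X' l' Y'"
proof (induction arbitrary: X' l' rule: slp.induct)
  case (base Y X l)
  then show ?case by (intro slp.base) blast
next
  case (step X h l Y)
  then obtain l'' where "l' = Suc l''" "l \<le> l''" by (cases l') auto
  moreover from this have "slp (insert h X') l'' Y'" using step.prems by (intro step.IH) auto
  ultimately show ?case using slp.step[OF slp_step_mono[OF step.hyps(1) step.prems(1)]] by simp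
qed

lemma slp_keep: "slp X l Y \<Longrightarrow> slp X l (X \<union> Y)"
proof (induction rule: slp.induct)
  case (base Y X l)
  then show ?case by (intro slp.base) blast
next
  case (step X h l Y)
  from step.IH have "slp (insert h X) l (X \<union> Y)" by (rule slp_mono) auto
  with step.hyps(1) show ?case by (rule slp.step)
qed

lemma slp_trans: "slp X l Y \<Longrightarrow> slp (X \<union> Y) l' Z \<Longrightarrow> slp X (l + l') Z"
proof (induction rule: slp.induct)
  case (base Y X l)
  then have "X \<union> Y = X" by blast
  with base have "slp X l' Z" by simp
  then show ?case by (rule slp_mono) auto
next
  case (step X h l Y)
  from step.prems have "slp (insert h X \<union> Y) l' Z" by (rule slp_mono) auto
  from slp.step[OF step.hyps(1) step.IH[OF this]] show ?case by simp
qed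

lemma slp_Un:
  assumes "slp X l Y" "slp X l' Y'"
  shows "slp X (l + l') (Y \<union> Y')"
proof (rule slp_trans[OF assms(1)])
  have "slp (X \<union> Y) l' Y'" using assms(2) by (rule slp_mono) auto
  then show "slp (X \<union> Y) l' (Y \<union> Y')" by (rule slp_mono[OF slp_keep]) auto
qed

lemma slp_UN:
  assumes "finite I" "\<And>i. i \<in> I \<Longrightarrow> slp X l (Y i)"
  shows "slp X (card I * l) (\<Union>i\<in>I. Y i)"
  using assms
proof (induction I rule: finite_induct)
  case empty
  then show ?case by (auto intro: slp.base)
next
  case (insert i I)
  then have "slp X (l + card I * l) (Y i \<union> (\<Union>i\<in>I. Y i))" by (intro slp_Un) auto
  with insert show ?case by simp
qed

lemma slp_step_comp: "slp_step X h \<Longrightarrow> slp_step ((\<lambda>f. f \<circ> \<phi>) ` X) (h \<circ> \<phi>)"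
  unfolding slp_step_def by (elim disjE exE bexE) (simp_all add: comp_def, blast+)

text \<open>Precomposition with \<open>\<phi>\<close> commutes with pointwise arithmetic, so a
  substitution into the inputs costs no instruction. Padding, transposition and block splitting of
  matrices are instances.\<close>

lemma slp_comp: "slp X l Y \<Longrightarrow> slp ((\<lambda>f. f \<circ> \<phi>) ` X) l ((\<lambda>f. f \<circ> \<phi>) ` Y)"
proof (induction rule: slp.induct)
  case (base Y X l)
  then show ?case by (intro slp.base) auto
next
  case (step X h l Y)
  from step.IH have "slp (insert (h \<circ> \<phi>) ((\<lambda>f. f \<circ> \<phi>) ` X)) l ((\<lambda>f. f \<circ> \<phi>) ` Y)"
    by (simp only: image_insert)
  with slp_step_comp[OF step.hyps(1)] show ?case by (rule slp.step)
qed

lemma slp_subst: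
  assumes "slp X l Y" "\<And>f. f \<in> X \<Longrightarrow> f \<circ> \<phi> \<in> X'" "\<And>g. g \<in> Y' \<Longrightarrow> \<exists>f\<in>Y. g = f \<circ> \<phi>"
  shows "slp X' l Y'"
  by (rule slp_mono[OF slp_comp[OF assms(1), of \<phi>]]) (use assms(2,3) in auto)

lemma slp_sum:
  assumes "(\<lambda>_. 0) \<in> X" "\<And>k. k < n \<Longrightarrow> slp X l {f k}"
  shows "slp X (n * Suc l) {\<lambda>e. \<Sum>k<n. f k e}"
  using assms(2)
proof (induction n)
  case 0
  then show ?case using assms(1) by (auto intro: slp.base)
next
  case (Suc n)
  then have "slp X (n * Suc l + l) ({\<lambda>e. \<Sum>k<n. f k e} \<union> {f n})" by (intro slp_Un) auto
  moreover have "slp (X \<union> ({\<lambda>e. \<Sum>k<n. f k e} \<union> {f n})) 1 {\<lambda>e. \<Sum>k<Suc n. f k e}"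
    unfolding One_nat_def sum.lessThan_Suc
    by (rule slp.step[OF slp_step_add[of "\<lambda>e. \<Sum>k<n. f k e" _ "f n"]]) (auto intro: slp.base)
  ultimately have "slp X (n * Suc l + l + 1) {\<lambda>e. \<Sum>k<Suc n. f k e}" by (rule slp_trans)
  then show ?case by (simp add: add_ac)
qed

lemma slp_mult: "f \<in> X \<Longrightarrow> g \<in> X \<Longrightarrow> slp X 1 {\<lambda>e. f e * g e}"
  unfolding One_nat_def by (rule slp.step[OF slp_step_mult[of f _ g]]) (auto intro: slp.base)

text \<open>Each instruction makes at most one new function available. This is the only source of
  lower bounds on the cost.\<close>

lemma slp_card: "slp X l Y \<Longrightarrow> finite (Y - X) \<and> card (Y - X) \<le> l"
proof (induction rule: slp.induct)
  case (base Y X l)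
  then have "Y - X = {}" by blast
  then show ?case by (simp only:) simp
next
  case (step X h l Y)
  have sub: "Y - X \<subseteq> insert h (Y - insert h X)" by blast
  with step have fin: "finite (Y - X)" by (meson finite_insert finite_subset)
  have "card (Y - X) \<le> card (insert h (Y - insert h X))" using step sub by (intro card_mono) auto
  also have "\<dots> \<le> Suc (card (Y - insert h X))" using step by (intro card_insert_le_m1) (auto simp: card_insert_if)
  finally show ?case using step fin by simp
qed

section \<open>Correspondence with instruction lists\<close>

fun sym_run :: "arith_instr list \<Rightarrow> ('e \<Rightarrow> complex) list \<Rightarrow> ('e \<Rightarrow> complex) list" where
  "sym_run [] fs = fs"
| "sym_run (c # cs) fs = sym_run cs (fs @ [\<lambda>e. arith_val (map (\<lambda>f. f e) fs) c])"

lemma arith_run_sym_run: "arith_run cs (map (\<lambda>f. f e) fs) = map (\<lambda>f. f e) (sym_run cs fs)"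
proof (induction cs arbitrary: fs)
  case (Cons c cs)
  from Cons[of "fs @ [\<lambda>e. arith_val (map (\<lambda>f. f e) fs) c]"] show ?case by simp
qed simp

lemma lookup0_map: "(\<lambda>e. lookup0 (map (\<lambda>f. f e) fs) k) = (if k < length fs then fs ! k else (\<lambda>_. 0))"
  by (auto simp: lookup0_def)

text \<open>The zero function has to be available because \<open>lookup0\<close> reads 0 beyond the
  end of the list.\<close>

lemma slp_step_arith_val:
  "slp_step (insert (\<lambda>_. 0) (set fs)) (\<lambda>e. arith_val (map (\<lambda>f. f e) fs) c)"
proof -
  have mem: "(\<lambda>e. lookup0 (map (\<lambda>f. f e) fs) k) \<in> insert (\<lambda>_. 0) (set fs)" for k
    by (simp add: lookup0_map)
  show ?thesis
    by (cases c; simp only: arith_val.simps;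
        rule slp_step_const slp_step_add[OF mem mem] slp_step_diff[OF mem mem] slp_step_mult[OF mem mem])
qed

lemma slp_sym_run: "slp (insert (\<lambda>_. 0) (set fs)) (length cs) (set (sym_run cs fs))"
proof (induction cs arbitrary: fs)
  case Nil
  then show ?case by (auto intro: slp.base)
next
  case (Cons c cs)
  let ?h = "\<lambda>e. arith_val (map (\<lambda>f. f e) fs) c"
  have "slp (insert ?h (insert (\<lambda>_. 0) (set fs))) (length cs) (set (sym_run (c # cs) fs))"
    using Cons[of "fs @ [?h]"] by (simp add: insert_commute)
  from slp.step[OF slp_step_arith_val this] show ?case by simp
qed

text \<open>Containment of \<open>X\<close> in the list is enough for the induction: operands are
  located at any position that holds them, so duplicates do no harm.\<close>

lemma slp_imp_sym_run:
  "slp X l Y \<Longrightarrow> X \<subseteq> set fs \<Longrightarrow> \<exists>cs. length cs \<le> l \<and> Y \<subseteq> set (sym_run cs fs)"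
proof (induction arbitrary: fs rule: slp.induct)
  case (base Y X l)
  then show ?case by (intro exI[of _ "[]"]) auto
next
  case (step X h l Y)
  have idx: "\<exists>k. \<forall>e. lookup0 (map (\<lambda>f. f e) fs) k = g e" if "g \<in> X" for g
  proof -
    have "g \<in> set fs" using step.prems that by (rule subsetD)
    then obtain k where "k < length fs" "fs ! k = g" unfolding in_set_conv_nth by blast
    then have "\<forall>e. lookup0 (map (\<lambda>f. f e) fs) k = g e" by (simp add: lookup0_def)
    then show ?thesis ..
  qed
  have "\<exists>c. \<forall>e. arith_val (map (\<lambda>f. f e) fs) c = h e"
    using step.hyps(1) unfolding slp_step_def
  proof (elim disjE exE bexE)
    fix z assume "h = (\<lambda>_. z)"
    then show ?thesis by (intro exI[of _ "AConst z"]) simp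
  next
    fix f g assume fg: "f \<in> X" "g \<in> X" and h: "h = (\<lambda>e. f e + g e)"
    from idx[OF fg(1)] idx[OF fg(2)] obtain k l where
      "\<forall>e. lookup0 (map (\<lambda>f. f e) fs) k = f e" "\<forall>e. lookup0 (map (\<lambda>f. f e) fs) l = g e" by blast
    then show ?thesis unfolding h by (intro exI[of _ "AAdd k l"]) simp
  next
    fix f g assume fg: "f \<in> X" "g \<in> X" and h: "h = (\<lambda>e. f e - g e)"
    from idx[OF fg(1)] idx[OF fg(2)] obtain k l where
      "\<forall>e. lookup0 (map (\<lambda>f. f e) fs) k = f e" "\<forall>e. lookup0 (map (\<lambda>f. f e) fs) l = g e" by blast
    then show ?thesis unfolding h by (intro exI[of _ "ASub k l"]) simp
  next
    fix f g assume fg: "f \<in> X" "g \<in> X" and h: "h = (\<lambda>e. f e * g e)"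
    from idx[OF fg(1)] idx[OF fg(2)] obtain k l where
      "\<forall>e. lookup0 (map (\<lambda>f. f e) fs) k = f e" "\<forall>e. lookup0 (map (\<lambda>f. f e) fs) l = g e" by blast
    then show ?thesis unfolding h by (intro exI[of _ "AMul k l"]) simp
  qed
  then obtain c where c: "\<forall>e. arith_val (map (\<lambda>f. f e) fs) c = h e" by blast
  have "insert h X \<subseteq> set (fs @ [h])" using step.prems by auto
  from step.IH[OF this] obtain cs where "length cs \<le> l" "Y \<subseteq> set (sym_run cs (fs @ [h]))" by blast
  moreover have "sym_run (c # cs) fs = sym_run cs (fs @ [h])" using c by simp
  ultimately show ?case by (intro exI[of _ "c # cs"]) simp
qed


section \<open>Cost of matrix products\<close>

type_synonym mat_env = "(nat \<Rightarrow> nat \<Rightarrow> complex) \<times> (nat \<Rightarrow> nat \<Rightarrow> complex)"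

definition mm_entry :: "nat \<Rightarrow> nat \<Rightarrow> nat \<Rightarrow> mat_env \<Rightarrow> complex" where
  "mm_entry q i j = (\<lambda>e. \<Sum>k<q. fst e i k * snd e k j)"

text \<open>Environments have entries at all positions, so products of different formats share one
  type. The zero function comes for free here; a real program spends one constant on it, whence the
  \<open>Suc\<close> in \<open>mm_cost_le\<close>.\<close>

definition mm_in :: "nat \<Rightarrow> nat \<Rightarrow> nat \<Rightarrow> (mat_env \<Rightarrow> complex) set" where
  "mm_in p q r = insert (\<lambda>_. 0)
     ((\<lambda>(i, k). \<lambda>e. fst e i k) ` ({..<p} \<times> {..<q}) \<union> (\<lambda>(k, j). \<lambda>e. snd e k j) ` ({..<q} \<times> {..<r}))"

definition mm_slp :: "nat \<Rightarrow> nat \<Rightarrow> nat \<Rightarrow> nat \<Rightarrow> bool" where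
  "mm_slp p q r l \<longleftrightarrow> slp (mm_in p q r) l ((\<lambda>(i, j). mm_entry q i j) ` ({..<p} \<times> {..<r}))"

lemma mm_in_cases:
  assumes "f \<in> mm_in p q r"
  obtains "f = (\<lambda>_. 0)" | i k where "i < p" "k < q" "f = (\<lambda>e. fst e i k)"
    | k j where "k < q" "j < r" "f = (\<lambda>e. snd e k j)"
  using assms unfolding mm_in_def by auto

lemma mm_in_intros:
  "(\<lambda>_. 0) \<in> mm_in p q r"
  "i < p \<Longrightarrow> k < q \<Longrightarrow> (\<lambda>e. fst e i k) \<in> mm_in p q r"
  "k < q \<Longrightarrow> j < r \<Longrightarrow> (\<lambda>e. snd e k j) \<in> mm_in p q r"
  unfolding mm_in_def by auto

text \<open>Ensures that the \<open>LEAST\<close> in \<open>mm_cost\<close> is attained and that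
  some exponent is admissible in \<open>omega\<close>.\<close>

lemma mm_slp_naive: "mm_slp p q r (p * r * (q * 2))"
proof -
  have "slp (mm_in p q r) (q * 2) {mm_entry q i j}" if "i < p" "j < r" for i j
  proof -
    have "slp (mm_in p q r) (q * Suc 1) {\<lambda>e. \<Sum>k<q. fst e i k * snd e k j}"
      using that by (intro slp_sum slp_mult mm_in_intros)
    then show ?thesis by (simp add: mm_entry_def mult_2_right)
  qed
  then have "slp (mm_in p q r) (card ({..<p} \<times> {..<r}) * (q * 2))
      (\<Union>(i, j)\<in>{..<p} \<times> {..<r}. {mm_entry q i j})"
    by (intro slp_UN) auto
  then show ?thesis unfolding mm_slp_def by (rule slp_mono) auto
qed

definition input_funs :: "nat \<Rightarrow> nat \<Rightarrow> nat \<Rightarrow> (mat_env \<Rightarrow> complex) list" where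
  "input_funs p q r =
     concat (map (\<lambda>i. map (\<lambda>k. \<lambda>e. fst e i k) [0..<q]) [0..<p]) @
     concat (map (\<lambda>k. map (\<lambda>j. \<lambda>e. snd e k j) [0..<r]) [0..<q])"

lemma insert_set_input_funs: "insert (\<lambda>_. 0) (set (input_funs p q r)) = mm_in p q r"
proof -
  have "(\<lambda>(i, j). g i j) ` (A \<times> B) = (\<Union>i\<in>A. g i ` B)" for g :: "nat \<Rightarrow> nat \<Rightarrow> mat_env \<Rightarrow> complex" and A B
    by auto
  then show ?thesis by (simp add: input_funs_def mm_in_def atLeast0LessThan)
qed

lemma map_input_funs:
  "map (\<lambda>f. f e) (input_funs p q r) =
     entries (mat p q (\<lambda>(i, k). fst e i k)) @ entries (mat q r (\<lambda>(k, j). snd e k j))"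
  by (simp add: input_funs_def entries_def mat_to_list_def map_concat comp_def cong: map_cong)
    (intro arg_cong2[where f = append] arg_cong[where f = concat] map_cong refl; simp)

lemma mult_mat_entry:
  "i < p \<Longrightarrow> j < r \<Longrightarrow> (mat p q (\<lambda>(i, k). fst e i k) * mat q r (\<lambda>(k, j). snd e k j)) $$ (i, j) = mm_entry q i j e"
  by (simp add: mm_entry_def scalar_prod_def lessThan_atLeast0)

text \<open>Every pair of matrices is cut out of some environment, so correctness on all inputs
  becomes an equality of functions on environments.\<close>

lemma computes_product_iff:
  "computes_product cs p q r \<longleftrightarrow> (\<exists>pos. \<forall>i<p. \<forall>j<r.
     (\<lambda>e. lookup0 (map (\<lambda>f. f e) (sym_run cs (input_funs p q r))) (pos i j)) = mm_entry q i j)"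
  (is "_ \<longleftrightarrow> (\<exists>pos. ?P pos)")
proof
  assume "computes_product cs p q r"
  then obtain pos where pos: "\<forall>A \<in> carrier_mat p q. \<forall>B \<in> carrier_mat q r. \<forall>i<p. \<forall>j<r.
        lookup0 (arith_run cs (entries A @ entries B)) (pos i j) = (A * B) $$ (i, j)"
    unfolding computes_product_def by blast
  have "?P pos"
  proof (intro allI impI ext)
    fix i j e assume ij: "i < p" "j < r"
    have "lookup0 (arith_run cs (map (\<lambda>f. f e) (input_funs p q r))) (pos i j) = mm_entry q i j e"
      unfolding map_input_funs using pos ij mult_mat_entry[OF ij, of q e] by simp
    then show "lookup0 (map (\<lambda>f. f e) (sym_run cs (input_funs p q r))) (pos i j) = mm_entry q i j e"
      unfolding arith_run_sym_run .
  qed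
  then show "\<exists>pos. ?P pos" by blast
next
  assume "\<exists>pos. ?P pos"
  then obtain pos where pos: "?P pos" by blast
  show "computes_product cs p q r" unfolding computes_product_def
  proof (intro exI[of _ pos] ballI allI impI)
    fix A B :: "complex mat" and i j assume AB: "A \<in> carrier_mat p q" "B \<in> carrier_mat q r" and ij: "i < p" "j < r"
    let ?e = "((\<lambda>i k. A $$ (i, k)), (\<lambda>k j. B $$ (k, j)))"
    have A: "mat p q (\<lambda>(i, k). fst ?e i k) = A" and B: "mat q r (\<lambda>(k, j). snd ?e k j) = B"
      using AB by auto
    have "lookup0 (map (\<lambda>f. f ?e) (sym_run cs (input_funs p q r))) (pos i j) = mm_entry q i j ?e"
      using pos ij by (auto dest: fun_cong)
    then show "lookup0 (arith_run cs (entries A @ entries B)) (pos i j) = (A * B) $$ (i, j)"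
      unfolding arith_run_sym_run[symmetric] map_input_funs A B
      using mult_mat_entry[OF ij, of q ?e] unfolding A B by simp
  qed
qed

lemma computes_product_imp_mm_slp:
  assumes "computes_product cs p q r"
  shows "mm_slp p q r (length cs)"
proof -
  obtain pos where pos: "\<And>i j. i < p \<Longrightarrow> j < r \<Longrightarrow>
     (\<lambda>e. lookup0 (map (\<lambda>f. f e) (sym_run cs (input_funs p q r))) (pos i j)) = mm_entry q i j"
    using assms unfolding computes_product_iff by blast
  let ?Y = "set (sym_run cs (input_funs p q r))"
  have "slp (mm_in p q r) (length cs) (insert (\<lambda>_. 0) ?Y)"
    using slp_keep[OF slp_sym_run[of "input_funs p q r" cs]] unfolding insert_set_input_funs
    by (rule slp_mono) (auto simp: mm_in_intros)
  moreover have "mm_entry q i j \<in> insert (\<lambda>_. 0) ?Y" if "i < p" "j < r" for i j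
    unfolding pos[OF that, symmetric] lookup0_map by simp
  then have "(\<lambda>(i, j). mm_entry q i j) ` ({..<p} \<times> {..<r}) \<subseteq> insert (\<lambda>_. 0) ?Y" by auto
  ultimately show ?thesis unfolding mm_slp_def by (rule slp_mono[OF _ subset_refl _ order_refl])
qed

lemma mm_slp_imp_computes_product:
  assumes "mm_slp p q r l"
  shows "\<exists>cs. computes_product cs p q r \<and> length cs \<le> Suc l"
proof -
  have "mm_in p q r \<subseteq> set (input_funs p q r @ [\<lambda>_. 0])"
    unfolding insert_set_input_funs[symmetric] by auto
  from slp_imp_sym_run[OF assms[unfolded mm_slp_def] this] obtain cs where cs: "length cs \<le> l"
    "(\<lambda>(i, j). mm_entry q i j) ` ({..<p} \<times> {..<r}) \<subseteq> set (sym_run cs (input_funs p q r @ [\<lambda>_. 0]))" by blast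
  have run: "sym_run (AConst 0 # cs) (input_funs p q r) = sym_run cs (input_funs p q r @ [\<lambda>_. 0])" by simp
  have "\<exists>k. (\<lambda>e. lookup0 (map (\<lambda>f. f e) (sym_run (AConst 0 # cs) (input_funs p q r))) k) = mm_entry q i j"
    if "i < p" "j < r" for i j
  proof -
    have "mm_entry q i j \<in> set (sym_run cs (input_funs p q r @ [\<lambda>_. 0]))" using cs(2) that by auto
    then obtain k where "k < length (sym_run cs (input_funs p q r @ [\<lambda>_. 0]))"
      "sym_run cs (input_funs p q r @ [\<lambda>_. 0]) ! k = mm_entry q i j" unfolding in_set_conv_nth by blast
    then show ?thesis unfolding run lookup0_map by (intro exI[of _ k]) simp
  qed
  then have "computes_product (AConst 0 # cs) p q r" unfolding computes_product_iff by metis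
  then show ?thesis using cs(1) by (intro exI[of _ "AConst 0 # cs"]) simp
qed

lemma mm_slp_mm_cost: "mm_slp p q r (mm_cost p q r)"
proof -
  have "\<exists>l cs. computes_product cs p q r \<and> length cs = l"
    using mm_slp_imp_computes_product[OF mm_slp_naive] by blast
  then have "\<exists>cs. computes_product cs p q r \<and> length cs = mm_cost p q r"
    unfolding mm_cost_def by (rule LeastI_ex)
  then obtain cs where "computes_product cs p q r" "length cs = mm_cost p q r" by blast
  from computes_product_imp_mm_slp[OF this(1)] this(2) show ?thesis by simp
qed

lemma mm_cost_le:
  assumes "mm_slp p q r l"
  shows "mm_cost p q r \<le> Suc l"
proof -
  obtain cs where "computes_product cs p q r" "length cs \<le> Suc l"
    using mm_slp_imp_computes_product[OF assms] by blast
  moreover have "mm_cost p q r \<le> length cs"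
    unfolding mm_cost_def by (rule Least_le) (use \<open>computes_product cs p q r\<close> in blast)
  ultimately show ?thesis by simp
qed

section \<open>Changing the format of a product, and counting its outputs\<close>

lemma mm_slp_restrict:
  assumes "mm_slp p q r l" "p' \<le> p" "q' \<le> q" "r' \<le> r"
  shows "mm_slp p' q' r' l"
proof -
  \<comment> \<open>Pads the smaller matrices with zeros; a padded entry is the free zero function
    of \<open>mm_in\<close>.\<close>
  define \<phi> :: "mat_env \<Rightarrow> mat_env" where
    "\<phi> e = ((\<lambda>i k. if i < p' \<and> k < q' then fst e i k else 0), (\<lambda>k j. if k < q' \<and> j < r' then snd e k j else 0))" for e
  show ?thesis unfolding mm_slp_def
  proof (rule slp_subst[OF assms(1)[unfolded mm_slp_def], of \<phi>])
    fix f assume "f \<in> mm_in p q r"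
    then show "f \<circ> \<phi> \<in> mm_in p' q' r'"
    proof (cases rule: mm_in_cases)
      case 1
      then show ?thesis by (simp add: comp_def mm_in_intros)
    next
      case (2 i k)
      then show ?thesis by (cases "i < p' \<and> k < q'") (auto simp: comp_def \<phi>_def intro: mm_in_intros)
    next
      case (3 k j)
      then show ?thesis by (cases "k < q' \<and> j < r'") (auto simp: comp_def \<phi>_def intro: mm_in_intros)
    qed
  next
    fix g assume "g \<in> (\<lambda>(i, j). mm_entry q' i j) ` ({..<p'} \<times> {..<r'})"
    then obtain i j where ij: "i < p'" "j < r'" "g = mm_entry q' i j" by auto
    have "mm_entry q i j (\<phi> e) = (\<Sum>k<q. if k < q' then fst e i k * snd e k j else 0)" for e
      using ij by (auto simp: mm_entry_def \<phi>_def intro!: sum.cong)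
    also have "(\<Sum>k<q. if k < q' then fst e i k * snd e k j else 0) = g e" for e
      using assms ij by (simp add: sum.If_cases mm_entry_def Int_absorb1 lessThan_def[symmetric])
    finally have "g = mm_entry q i j \<circ> \<phi>" by (auto simp: comp_def)
    with ij assms show "\<exists>f\<in>(\<lambda>(i, j). mm_entry q i j) ` ({..<p} \<times> {..<r}). g = f \<circ> \<phi>"
      by (intro bexI[of _ "mm_entry q i j"]) auto
  qed
qed

lemma mm_slp_transpose:
  assumes "mm_slp p q r l"
  shows "mm_slp r q p l"
proof -
  define \<phi> :: "mat_env \<Rightarrow> mat_env" where "\<phi> e = ((\<lambda>i k. snd e k i), (\<lambda>k j. fst e j k))" for e
  show ?thesis unfolding mm_slp_def
  proof (rule slp_subst[OF assms(1)[unfolded mm_slp_def], of \<phi>])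
    fix f assume "f \<in> mm_in p q r"
    then show "f \<circ> \<phi> \<in> mm_in r q p"
      by (cases rule: mm_in_cases) (auto simp: comp_def \<phi>_def intro: mm_in_intros)
  next
    fix g assume "g \<in> (\<lambda>(i, j). mm_entry q i j) ` ({..<r} \<times> {..<p})"
    then obtain i j where ij: "i < r" "j < p" "g = mm_entry q i j" by auto
    then have "g = mm_entry q j i \<circ> \<phi>" by (auto simp: comp_def mm_entry_def \<phi>_def mult.commute)
    with ij show "\<exists>f\<in>(\<lambda>(i, j). mm_entry q i j) ` ({..<p} \<times> {..<r}). g = f \<circ> \<phi>"
      by (intro bexI[of _ "mm_entry q j i"]) auto
  qed
qed

text \<open>Cut the second factor into \<open>m\<close> blocks of \<open>r\<close> columns and
  multiply block by block; the substitution shifts the column index to the start of block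
  \<open>c\<close>.\<close>

lemma mm_slp_split:
  assumes "mm_slp p q r l"
  shows "mm_slp p q (r * m) (m * l)"
proof -
  have "slp (mm_in p q (r * m)) l ((\<lambda>(i, j). mm_entry q i (c * r + j)) ` ({..<p} \<times> {..<r}))" if c: "c < m" for c
  proof -
    have less: "c * r + j < r * m" if "j < r" for j
    proof -
      have "c * r + j < Suc c * r" using that by simp
      also have "\<dots> \<le> m * r" using c by (intro mult_right_mono) auto
      finally show ?thesis by (simp add: mult.commute)
    qed
    define \<phi> :: "mat_env \<Rightarrow> mat_env" where "\<phi> e = (fst e, (\<lambda>k j. snd e k (c * r + j)))" for e
    show ?thesis
    proof (rule slp_subst[OF assms(1)[unfolded mm_slp_def], of \<phi>])
      fix f assume "f \<in> mm_in p q r"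
      then show "f \<circ> \<phi> \<in> mm_in p q (r * m)"
        by (cases rule: mm_in_cases) (auto simp: comp_def \<phi>_def less intro: mm_in_intros)
    next
      fix g assume "g \<in> (\<lambda>(i, j). mm_entry q i (c * r + j)) ` ({..<p} \<times> {..<r})"
      then obtain i j where ij: "i < p" "j < r" "g = mm_entry q i (c * r + j)" by auto
      then have "g = mm_entry q i j \<circ> \<phi>" by (auto simp: comp_def mm_entry_def \<phi>_def)
      with ij show "\<exists>f\<in>(\<lambda>(i, j). mm_entry q i j) ` ({..<p} \<times> {..<r}). g = f \<circ> \<phi>"
        by (intro bexI[of _ "mm_entry q i j"]) auto
    qed
  qed
  then have "slp (mm_in p q (r * m)) (card {..<m} * l)
      (\<Union>c<m. (\<lambda>(i, j). mm_entry q i (c * r + j)) ` ({..<p} \<times> {..<r}))"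
    by (intro slp_UN) auto
  moreover have "mm_entry q i j \<in> (\<Union>c<m. (\<lambda>(i, j). mm_entry q i (c * r + j)) ` ({..<p} \<times> {..<r}))"
    if ij: "i < p" "j < r * m" for i j
  proof -
    from ij have "r > 0" by (cases r) auto
    with ij have "j div r < m" "j mod r < r" by (auto simp: less_mult_imp_div_less mult.commute)
    moreover have "mm_entry q i j = mm_entry q i (j div r * r + j mod r)" by simp
    ultimately show ?thesis
      using ij(1) by (intro UN_I[of "j div r"] image_eqI[of _ _ "(i, j mod r)"]) auto
  qed
  then have "(\<lambda>(i, j). mm_entry q i j) ` ({..<p} \<times> {..<r * m})
      \<subseteq> (\<Union>c<m. (\<lambda>(i, j). mm_entry q i (c * r + j)) ` ({..<p} \<times> {..<r}))" by auto
  ultimately show ?thesis unfolding mm_slp_def card_lessThan by (rule slp_mono[OF _ subset_refl _ order_refl])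
qed

text \<open>The entries of the product are pairwise distinct functions and none of them is an input,
  so each needs an instruction of its own.\<close>

lemma mm_slp_ge:
  assumes "mm_slp p q r l" "0 < q"
  shows "p * r \<le> l"
proof -
  let ?out = "\<lambda>(i, j). mm_entry q i j"
  \<comment> \<open>A single one at \<open>(i, 0)\<close> in the first factor and at
    \<open>(0, j)\<close> in the second: the product is the matrix unit at
    \<open>(i, j)\<close>.\<close>
  define \<delta> :: "nat \<times> nat \<Rightarrow> mat_env" where
    "\<delta> = (\<lambda>(i, j). ((\<lambda>i' k. of_bool (i' = i \<and> k = 0)), (\<lambda>k j'. of_bool (j' = j \<and> k = 0))))"
  have \<delta>: "mm_entry q i' j' (\<delta> (i, j)) = of_bool (i' = i \<and> j' = j)" for i' j' i j
  proof -
    have "mm_entry q i' j' (\<delta> (i, j)) = (\<Sum>k<q. if k = 0 then of_bool (i' = i \<and> j' = j) else 0)"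
      by (auto simp: mm_entry_def \<delta>_def intro!: sum.cong)
    then show ?thesis using assms(2) by (simp add: sum.delta)
  qed
  have inj: "inj_on ?out ({..<p} \<times> {..<r})"
  proof (rule inj_onI; clarify)
    fix i j i' j' assume "mm_entry q i j = mm_entry q i' j'"
    then have "mm_entry q i j (\<delta> (i, j)) = mm_entry q i' j' (\<delta> (i, j))" by simp
    then show "i = i' \<and> j = j'" by (simp add: \<delta> split: if_splits)
  qed
  have "mm_entry q i j \<notin> mm_in p q r" for i j
  proof
    assume "mm_entry q i j \<in> mm_in p q r"
    then show False
    proof (cases rule: mm_in_cases)
      case 1
      from fun_cong[OF this, of "\<delta> (i, j)"] show False by (simp add: \<delta>)
    next
      case (2 i' k)
      from fun_cong[OF 2(3), of "((\<lambda>_ _. 1), (\<lambda>_ _. 0))"] show False by (simp add: mm_entry_def)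
    next
      case (3 k j')
      from fun_cong[OF 3(3), of "((\<lambda>_ _. 0), (\<lambda>_ _. 1))"] show False by (simp add: mm_entry_def)
    qed
  qed
  then have "?out ` ({..<p} \<times> {..<r}) - mm_in p q r = ?out ` ({..<p} \<times> {..<r})" by auto
  with slp_card[OF assms(1)[unfolded mm_slp_def]] show ?thesis
    by (simp add: card_image[OF inj] card_cartesian_product)
qed


section \<open>Gradients and the symmetry of the cost\<close>

lemma sum_fun_upd_add:
  fixes b :: "'i \<Rightarrow> 'e \<Rightarrow> complex"
  assumes "finite X" "f \<in> X"
  shows "(\<Sum>y\<in>X. (b(f := \<lambda>e. b f e + v e)) y e * d y) = (\<Sum>y\<in>X. b y e * d y) + v e * d f"
proof -
  have "(\<Sum>y\<in>X. (b(f := \<lambda>e. b f e + v e)) y e * d y)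
      = (\<Sum>y\<in>X. b y e * d y + (if y = f then v e * d f else 0))"
    by (intro sum.cong) (auto simp: algebra_simps)
  also have "\<dots> = (\<Sum>y\<in>X. b y e * d y) + v e * d f"
    using assms by (simp add: sum.distrib)
  finally show ?thesis .
qed

text \<open>
  Reverse mode differentiation, after Baur and Strassen. Walking backwards through the program, the
  coefficients \<open>b y\<close> express the derivative of the result in terms of the derivatives of the
  functions \<open>y\<close> available so far.
\<close>

lemma baur_strassen:
  fixes path :: "'x \<Rightarrow> 'e2 \<Rightarrow> complex \<Rightarrow> 'e"
  assumes path: "\<And>x e. path x e 0 = \<phi> e"
    and "slp X l Y" "F \<in> Y" "finite X" "\<And>z. z \<in> {0, 1, -1} \<Longrightarrow> (\<lambda>_. z) \<in> X"
    and "\<And>f x e. f \<in> X \<Longrightarrow> ((\<lambda>t. f (path x e t)) has_field_derivative D f x e) (at 0)"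
  shows "\<exists>b. slp ((\<lambda>f. f \<circ> \<phi>) ` X) (6 * l) (b ` X) \<and>
    (\<forall>x e. ((\<lambda>t. F (path x e t)) has_field_derivative (\<Sum>y\<in>X. b y e * D y x e)) (at 0))"
  using assms(2-)
proof (induction arbitrary: D rule: slp.induct)
  case (base Y X l)
  \<comment> \<open>\<open>F\<close> is itself among the available functions, so the coefficients
    are the indicator of \<open>F\<close>.\<close>
  let ?b = "\<lambda>y. if y = F then (\<lambda>_. 1) else (\<lambda>_. 0)"
  have "(\<lambda>f. f \<circ> \<phi>) ` X \<supseteq> ?b ` X"
    using base.prems(3)[of 0] base.prems(3)[of 1] by (force simp: comp_def image_iff)
  moreover have "(\<Sum>y\<in>X. ?b y e * D y x e) = D F x e" for x e
  proof -
    have "(\<Sum>y\<in>X. ?b y e * D y x e) = (\<Sum>y\<in>X. if y = F then D y x e else 0)" by (intro sum.cong) auto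
    then show ?thesis using base by (auto simp: sum.delta)
  qed
  moreover have "F \<in> X" using base by blast
  ultimately show ?case using base.prems(4)[of F]
    by (intro exI[of _ ?b] conjI slp.base) (auto simp only:)
next
  case (step X h l Y)
  let ?P = "\<lambda>f. f \<circ> \<phi>"
  note D = step.prems(4)
  have const: "?P (\<lambda>_. z) \<in> ?P ` X" if "z \<in> {0, 1, -1}" for z
    using step.prems(3)[OF that] by blast
  show ?case
  \<comment> \<open>If \<open>h\<close> was available before, the sets agree and the induction
    hypothesis applies with \<open>D\<close> itself. Otherwise \<open>D'\<close> may assign
    \<open>h\<close> a derivative without disturbing those of \<open>X\<close>.\<close>
  proof (cases "h \<in> X")
    case True
    then have X: "insert h X = X" by blast
    from step.IH[of D] step.prems obtain b where "slp (?P ` X) (6 * l) (b ` X)"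
      "\<forall>x e. ((\<lambda>t. F (path x e t)) has_field_derivative (\<Sum>y\<in>X. b y e * D y x e)) (at 0)"
      unfolding X by blast
    moreover from this(1) have "slp (?P ` X) (6 * Suc l) (b ` X)" by (rule slp_mono) auto
    ultimately show ?thesis by blast
  next
    case False
    \<comment> \<open>The differential of an instruction combines those of at most two operands; the
      coefficients are 0, 1, -1 or values of operands at the base point, all of which are
      available.\<close>
    have "\<exists>f\<in>X. \<exists>g\<in>X. \<exists>u\<in>?P ` X. \<exists>v\<in>?P ` X. \<forall>x e.
       ((\<lambda>t. h (path x e t)) has_field_derivative u e * D f x e + v e * D g x e) (at 0)"
      using step.hyps(1) unfolding slp_step_def
    proof (elim disjE exE bexE)
      fix z assume h: "h = (\<lambda>_. z)"
      show ?thesis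
        using step.prems(3)[of 0] const[of 0] unfolding h
        by (intro bexI[of _ "\<lambda>_. 0"] bexI[of _ "\<lambda>_. 0 :: complex"]) (auto simp: comp_def)
    next
      fix f g assume fg: "f \<in> X" "g \<in> X" and h: "h = (\<lambda>e. f e + g e)"
      have "((\<lambda>t. h (path x e t)) has_field_derivative 1 * D f x e + 1 * D g x e) (at 0)" for x e
        unfolding h using D[OF fg(1)] D[OF fg(2)] by (auto intro!: derivative_eq_intros)
      then show ?thesis using fg const[of 1]
        by (intro bexI[of _ f] bexI[of _ g] bexI[of _ "\<lambda>_. 1 :: complex"]) (auto simp: comp_def)
    next
      fix f g assume fg: "f \<in> X" "g \<in> X" and h: "h = (\<lambda>e. f e - g e)"
      have "((\<lambda>t. h (path x e t)) has_field_derivative 1 * D f x e + -1 * D g x e) (at 0)" for x e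
        unfolding h using D[OF fg(1)] D[OF fg(2)] by (auto intro!: derivative_eq_intros)
      then show ?thesis using fg const[of 1] const[of "-1"]
        by (intro bexI[of _ f] bexI[of _ g] bexI[of _ "\<lambda>_. 1 :: complex"] bexI[of _ "\<lambda>_. -1 :: complex"])
          (auto simp: comp_def)
    next
      fix f g assume fg: "f \<in> X" "g \<in> X" and h: "h = (\<lambda>e. f e * g e)"
      have "((\<lambda>t. h (path x e t)) has_field_derivative ?P g e * D f x e + ?P f e * D g x e) (at 0)" for x e
        unfolding h using DERIV_mult[OF D[OF fg(1), of x e] D[OF fg(2), of x e]]
        by (simp add: path mult.commute add.commute)
      then show ?thesis using fg by blast
    qed
    then obtain f g u v where fg: "f \<in> X" "g \<in> X" and uv: "u \<in> ?P ` X" "v \<in> ?P ` X"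
      and der: "\<And>x e. ((\<lambda>t. h (path x e t)) has_field_derivative u e * D f x e + v e * D g x e) (at 0)"
      by blast
    define D' where "D' = D(h := \<lambda>x e. u e * D f x e + v e * D g x e)"
    have "\<exists>b. slp (?P ` insert h X) (6 * l) (b ` insert h X) \<and>
        (\<forall>x e. ((\<lambda>t. F (path x e t)) has_field_derivative (\<Sum>y\<in>insert h X. b y e * D' y x e)) (at 0))"
    proof (rule step.IH)
      fix f x e assume "f \<in> insert h X"
      then show "((\<lambda>t. f (path x e t)) has_field_derivative D' f x e) (at 0)"
        using D der by (auto simp: D'_def)
    qed (use step.prems in auto)
    then obtain b where b: "slp (?P ` insert h X) (6 * l) (b ` insert h X)"
      "\<And>x e. ((\<lambda>t. F (path x e t)) has_field_derivative (\<Sum>y\<in>insert h X. b y e * D' y x e)) (at 0)" by blast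
    \<comment> \<open>Chain rule: the coefficient of \<open>h\<close> is passed on to its operands.
      The updates are nested so that both contributions arrive if \<open>f = g\<close>. One
      instruction recomputes \<open>h\<close> at the base point and four more form the products and
      sums, within the six allowed per step.\<close>
    define wu where "wu = (\<lambda>e. b h e * u e)"
    define wv where "wv = (\<lambda>e. b h e * v e)"
    define b1 where "b1 = b(f := \<lambda>e. b f e + wu e)"
    define b2 where "b2 = b1(g := \<lambda>e. b1 g e + wv e)"
    let ?Z = "?P ` X \<union> (?P ` X \<union> b ` insert h X)"
    have "slp (?P ` X) (Suc (6 * l)) (b ` insert h X)"
      using slp.step[OF slp_step_comp[OF step.hyps(1)]] b(1) by (simp only: image_insert)
    from slp_keep[OF this] have 1: "slp (?P ` X) (Suc (6 * l)) (?P ` X \<union> b ` insert h X)" .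
    have "slp_step ?Z wu"
      unfolding wu_def using uv by (intro slp_step_mult) auto
    moreover have "slp_step (insert wu ?Z) wv"
      unfolding wv_def using uv by (intro slp_step_mult) auto
    moreover have "slp_step (insert wv (insert wu ?Z)) (\<lambda>e. b f e + wu e)"
      using fg by (intro slp_step_add) auto
    moreover have "slp_step (insert (\<lambda>e. b f e + wu e) (insert wv (insert wu ?Z))) (\<lambda>e. b1 g e + wv e)"
      using fg by (intro slp_step_add) (auto simp: b1_def)
    moreover have "slp (insert (\<lambda>e. b1 g e + wv e) (insert (\<lambda>e. b f e + wu e) (insert wv (insert wu ?Z)))) 1 (b2 ` X)"
      by (rule slp.base) (auto simp: b2_def b1_def)
    ultimately have "slp ?Z (Suc (Suc (Suc (Suc 1)))) (b2 ` X)" by (blast intro: slp.step)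
    from slp_trans[OF 1 this] have "slp (?P ` X) (6 * Suc l) (b2 ` X)" by (rule slp_mono) auto
    moreover have "(\<Sum>y\<in>insert h X. b y e * D' y x e) = (\<Sum>y\<in>X. b2 y e * D y x e)" for x e
    proof -
      have "(\<Sum>y\<in>X. b2 y e * D y x e) = (\<Sum>y\<in>X. b1 y e * D y x e) + wv e * D g x e"
        unfolding b2_def by (rule sum_fun_upd_add[OF step.prems(2) fg(2)])
      moreover have "(\<Sum>y\<in>X. b1 y e * D y x e) = (\<Sum>y\<in>X. b y e * D y x e) + wu e * D f x e"
        unfolding b1_def by (rule sum_fun_upd_add[OF step.prems(2) fg(1)])
      moreover have "(\<Sum>y\<in>X. b y e * D' y x e) = (\<Sum>y\<in>X. b y e * D y x e)"
        using False by (intro sum.cong) (auto simp: D'_def)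
      ultimately show ?thesis
        using False step.prems(2) by (simp add: D'_def wu_def wv_def algebra_simps)
    qed
    ultimately show ?thesis using b(2) by (intro exI[of _ b2] conjI) (auto simp only:)
  qed
qed

text \<open>
  The trilinear form \<open>\<Sum> C\<^sub>i\<^sub>j A\<^sub>i\<^sub>k B\<^sub>k\<^sub>j\<close> costs little more than the product \<open>A B\<close>, and its
  gradient with respect to \<open>A\<close>, taken at \<open>A = 0\<close>, is the product of \<open>C\<close> and the transpose of \<open>B\<close>.
\<close>

lemma mm_slp_rotate:
  assumes "mm_slp p q r l"
  shows "mm_slp p r q (6 * (l + p * (2 * r + 1)) + 2)"
proof -
  define Ks where "Ks = (\<lambda>z. (\<lambda>_ :: mat_env \<times> (nat \<Rightarrow> nat \<Rightarrow> complex). z :: complex)) ` {0, 1, -1}"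
  define As where "As = (\<lambda>(i, k). \<lambda>e :: mat_env \<times> (nat \<Rightarrow> nat \<Rightarrow> complex). fst (fst e) i k) ` ({..<p} \<times> {..<q})"
  define Bs where "Bs = (\<lambda>(k, j). \<lambda>e :: mat_env \<times> (nat \<Rightarrow> nat \<Rightarrow> complex). snd (fst e) k j) ` ({..<q} \<times> {..<r})"
  define Cs where "Cs = (\<lambda>(i, j). \<lambda>e :: mat_env \<times> (nat \<Rightarrow> nat \<Rightarrow> complex). snd e i j) ` ({..<p} \<times> {..<r})"
  define X where "X = Ks \<union> As \<union> Bs \<union> Cs"
  define out where "out = (\<lambda>(i, j). \<lambda>e :: mat_env \<times> (nat \<Rightarrow> nat \<Rightarrow> complex). mm_entry q i j (fst e)) ` ({..<p} \<times> {..<r})"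
  define F where "F = (\<lambda>e :: mat_env \<times> (nat \<Rightarrow> nat \<Rightarrow> complex). \<Sum>i<p. \<Sum>j<r. snd e i j * mm_entry q i j (fst e))"
  \<comment> \<open>In the environment \<open>e\<close> of the new product, \<open>fst e\<close>
    serves as \<open>C\<close> and the transpose of \<open>snd e\<close> as \<open>B\<close>. The
    base point \<open>\<phi> e\<close> has \<open>A = 0\<close>, and \<open>path x e t\<close> moves
    only entry \<open>x\<close> of \<open>A\<close>, to \<open>t\<close>.\<close>
  define \<phi> :: "mat_env \<Rightarrow> mat_env \<times> (nat \<Rightarrow> nat \<Rightarrow> complex)" where
    "\<phi> e = (((\<lambda>_ _. 0), (\<lambda>k j. snd e j k)), fst e)" for e
  define path where "path x e t = (((\<lambda>i k. if (i, k) = x then t else 0), (\<lambda>k j. snd e j k)), fst e)"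
    for x :: "nat \<times> nat" and e :: mat_env and t :: complex
  have fin: "finite X" by (auto simp: X_def Ks_def As_def Bs_def Cs_def)
  have "slp X l out"
  proof (rule slp_subst[OF assms[unfolded mm_slp_def], of fst])
    fix f assume "f \<in> mm_in p q r"
    then show "f \<circ> fst \<in> X"
      by (cases rule: mm_in_cases) (auto simp: X_def Ks_def As_def Bs_def comp_def)
  qed (auto simp: out_def comp_def)
  moreover have "slp (X \<union> out) (p * Suc (r * Suc 1)) {F}"
    unfolding F_def
  proof (intro slp_sum)
    show "(\<lambda>_. 0) \<in> X \<union> out" by (auto simp: X_def Ks_def)
    then show "(\<lambda>_. 0) \<in> X \<union> out" .
    fix i j assume "i < p" "j < r"
    then show "slp (X \<union> out) 1 {\<lambda>e. snd e i j * mm_entry q i j (fst e)}"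
      by (intro slp_mult) (auto simp: X_def Cs_def out_def)
  qed
  ultimately have slpF: "slp X (l + p * Suc (r * Suc 1)) {F}" by (rule slp_trans)
  define D where "D y x e = (if \<exists>i k. y = (\<lambda>e. fst (fst e) i k) \<and> x = (i, k) \<and> y \<in> As then 1 else 0 :: complex)"
    for y :: "mat_env \<times> (nat \<Rightarrow> nat \<Rightarrow> complex) \<Rightarrow> complex" and x and e :: mat_env
  \<comment> \<open>Inputs are known only as functions, so the position that one reads must be
    recovered from it.\<close>
  have entry_inject: "i = i' \<and> k = k'"
    if "(\<lambda>e :: mat_env \<times> (nat \<Rightarrow> nat \<Rightarrow> complex). fst (fst e) i k) = (\<lambda>e. fst (fst e) i' k')" for i k i' k'
    using fun_cong[OF that, of "(((\<lambda>a b. of_bool (a = i \<and> b = k)), (\<lambda>_ _. 0)), (\<lambda>_ _. 0))"]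
    by (simp split: if_splits)
  have der: "((\<lambda>t. f (path x e t)) has_field_derivative D f x e) (at 0)" if "f \<in> X" for f x e
  proof (cases "f \<in> As")
    case True
    then obtain i k where f: "f = (\<lambda>e. fst (fst e) i k)" by (auto simp: As_def)
    with True have "D f x e = of_bool (x = (i, k))" by (auto simp: D_def dest: entry_inject)
    then show ?thesis by (cases "x = (i, k)") (auto simp: f path_def)
  next
    case False
    with that show ?thesis by (auto simp: D_def X_def Ks_def Bs_def Cs_def path_def)
  qed
  have "\<exists>b. slp ((\<lambda>f. f \<circ> \<phi>) ` X) (6 * (l + p * Suc (r * Suc 1))) (b ` X) \<and>
      (\<forall>x e. ((\<lambda>t. F (path x e t)) has_field_derivative (\<Sum>y\<in>X. b y e * D y x e)) (at 0))"
  proof (rule baur_strassen[OF _ slpF])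
    show "path x e 0 = \<phi> e" for x e by (auto simp: path_def \<phi>_def fun_eq_iff)
    show "(\<lambda>_. z) \<in> X" if "z \<in> {0, 1, -1}" for z using that by (auto simp: X_def Ks_def)
  qed (use fin der in auto)
  then obtain b where b: "slp ((\<lambda>f. f \<circ> \<phi>) ` X) (6 * (l + p * Suc (r * Suc 1))) (b ` X)"
    and grad: "\<And>x e. ((\<lambda>t. F (path x e t)) has_field_derivative (\<Sum>y\<in>X. b y e * D y x e)) (at 0)"
    by blast
  have mem: "mm_entry r i k \<in> b ` X" if ik: "i < p" "k < q" for i k
  proof -
    let ?a = "\<lambda>e :: mat_env \<times> (nat \<Rightarrow> nat \<Rightarrow> complex). fst (fst e) i k"
    have a: "?a \<in> X" using ik by (auto simp: X_def As_def)
    have "mm_entry r i k e = b ?a e" for e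
    proof -
      \<comment> \<open>\<open>F\<close> is linear in \<open>A\<close>, so along the path it is
        \<open>t\<close> times the entry sought and no limit has to be computed.\<close>
      have "F (path (i, k) e t) = t * mm_entry r i k e" for t
      proof -
        have "mm_entry q i' j (fst (path (i, k) e t)) = (if i' = i then t * snd e j k else 0)" for i' j
        proof -
          have "mm_entry q i' j (fst (path (i, k) e t))
              = (\<Sum>k'<q. if k' = k then (if i' = i then t * snd e j k else 0) else 0)"
            unfolding mm_entry_def by (intro sum.cong) (auto simp: path_def)
          then show ?thesis using ik by simp
        qed
        then have "F (path (i, k) e t)
            = (\<Sum>i'<p. if i' = i then (\<Sum>j<r. fst e i j * (t * snd e j k)) else 0)"
          unfolding F_def by (intro sum.cong) (auto simp: path_def)
        then show ?thesis using ik by (simp add: mm_entry_def sum_distrib_left mult_ac)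
      qed
      then have "((\<lambda>t. F (path (i, k) e t)) has_field_derivative mm_entry r i k e) (at 0)"
        by (auto intro!: derivative_eq_intros)
      with grad[of "(i, k)" e] have "mm_entry r i k e = (\<Sum>y\<in>X. b y e * D y (i, k) e)"
        by (rule DERIV_unique[symmetric])
      also have "\<dots> = (\<Sum>y\<in>X. if y = ?a then b y e else 0)"
        using ik by (intro sum.cong) (auto simp: D_def As_def)
      also have "\<dots> = b ?a e" using fin a by (simp add: sum.delta)
      finally show ?thesis .
    qed
    then have "mm_entry r i k = b ?a" by blast
    with a show ?thesis by blast
  qed
  then have "slp ((\<lambda>f. f \<circ> \<phi>) ` X) (6 * (l + p * Suc (r * Suc 1))) ((\<lambda>(i, k). mm_entry r i k) ` ({..<p} \<times> {..<q}))"
    by (intro slp_mono[OF b subset_refl _ order_refl]) auto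
  moreover have "(\<lambda>f. f \<circ> \<phi>) ` X \<subseteq> insert (\<lambda>_. -1) (insert (\<lambda>_. 1) (mm_in p r q))"
    by (auto simp: X_def Ks_def As_def Bs_def Cs_def \<phi>_def comp_def intro: mm_in_intros)
  ultimately have "slp (insert (\<lambda>_. -1) (insert (\<lambda>_. 1) (mm_in p r q))) (6 * (l + p * Suc (r * Suc 1)))
      ((\<lambda>(i, k). mm_entry r i k) ` ({..<p} \<times> {..<q}))"
    by (rule slp_mono) auto
  \<comment> \<open>The constants 1 and -1 demanded by \<open>baur_strassen\<close> are produced
    here and account for the \<open>+ 2\<close>.\<close>
  then have "slp (mm_in p r q) (Suc (Suc (6 * (l + p * Suc (r * Suc 1)))))
      ((\<lambda>(i, k). mm_entry r i k) ` ({..<p} \<times> {..<q}))"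
    by (intro slp.step[OF slp_step_const])
  then show ?thesis unfolding mm_slp_def by (rule slp_mono) auto
qed

text \<open>By \<open>mm_slp_ge\<close> the old cost bounds \<open>p * r\<close>, hence also
  \<open>p\<close> and 1, so the overhead is absorbed: 6 + 12 + 6 + 3 = 27.\<close>

lemma mm_cost_rotate:
  assumes "0 < p" "0 < q" "0 < r"
  shows "mm_cost p r q \<le> 27 * mm_cost p q r"
proof -
  let ?l = "mm_cost p q r"
  have "p * r \<le> ?l" using mm_slp_ge[OF mm_slp_mm_cost \<open>0 < q\<close>] .
  moreover have "p \<le> p * r" "1 \<le> p * r" using assms by (simp_all add: Suc_le_eq)
  then have "p \<le> ?l" "1 \<le> ?l" using calculation by linarith+
  ultimately have "6 * (?l + p * (2 * r + 1)) + 2 + 1 \<le> 27 * ?l" by (simp add: algebra_simps)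
  then show ?thesis using mm_cost_le[OF mm_slp_rotate[OF mm_slp_mm_cost[of p q r]]] by simp
qed


section \<open>Properties of the exponent\<close>

lemma npow_le: "real (npow n a) \<le> real n powr a"
  by (simp add: npow_def)

lemma npow_ge_1: "1 \<le> n \<Longrightarrow> 0 \<le> a \<Longrightarrow> 1 \<le> npow n a"
  by (simp add: npow_def le_nat_iff le_floor_iff ge_one_powr_ge_zero)

text \<open>Rounding down loses at most a factor 2, which no exponent notices.\<close>

lemma npow_ge_half:
  assumes "1 \<le> n" "0 \<le> a"
  shows "real n powr a \<le> 2 * real (npow n a)"
proof (cases "real n powr a < 2")
  case True
  have "1 \<le> real (npow n a)" using npow_ge_1[OF assms] by simp
  with True show ?thesis by linarith
next
  case False
  have "real n powr a - 1 \<le> real (npow n a)"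
    unfolding npow_def using real_of_int_floor_gt_diff_one[of "real n powr a"] by (simp add: less_imp_le)
  with False show ?thesis by linarith
qed

lemma npow_mono: "1 \<le> n \<Longrightarrow> a \<le> b \<Longrightarrow> npow n a \<le> npow n b"
  unfolding npow_def by (intro nat_mono floor_mono powr_mono) auto

definition omega_cost :: "real \<Rightarrow> real \<Rightarrow> real \<Rightarrow> nat \<Rightarrow> real" where
  "omega_cost a b c n = real (mm_cost (npow n a) (npow n b) (npow n c))"

lemma omega_eq: "omega a b c = Inf {\<beta>. omega_cost a b c \<in> O(\<lambda>n. real n powr \<beta>)}"
  unfolding omega_def omega_cost_def ..

lemma bigo_real_leI:
  fixes f g :: "nat \<Rightarrow> real"
  assumes "\<And>n. 1 \<le> n \<Longrightarrow> 0 \<le> f n" "\<And>n. 1 \<le> n \<Longrightarrow> f n \<le> K * g n" "\<And>n. 0 \<le> g n"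
  shows "f \<in> O(g)"
proof (rule bigoI[of _ K])
  show "\<forall>\<^sub>F n in at_top. norm (f n) \<le> K * norm (g n)"
    using eventually_ge_at_top[of 1] by eventually_elim (use assms in auto)
qed

text \<open>The number of output entries alone forces this. It also bounds the set under the
  \<open>Inf\<close> in \<open>omega\<close> from below.\<close>

lemma omega_cost_bigo_imp_ge:
  assumes "0 \<le> a" "0 \<le> b" "0 \<le> c" "omega_cost a b c \<in> O(\<lambda>n. real n powr \<beta>)"
  shows "a + c \<le> \<beta>"
proof -
  have "(\<lambda>n. real n powr (a + c)) \<in> O(omega_cost a b c)"
  proof (rule bigo_real_leI[of _ 4])
    fix n :: nat assume n: "1 \<le> n"
    have "real n powr (a + c) \<le> (2 * real (npow n a)) * (2 * real (npow n c))"
      unfolding powr_add using npow_ge_half n assms by (intro mult_mono) auto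
    also have "\<dots> = 4 * real (npow n a * npow n c)" by simp
    also have "\<dots> \<le> 4 * omega_cost a b c n"
      unfolding omega_cost_def using mm_slp_ge[OF mm_slp_mm_cost] npow_ge_1[OF n assms(2)]
      by (intro mult_left_mono of_nat_mono) auto
    finally show "real n powr (a + c) \<le> 4 * omega_cost a b c n" .
  qed (auto simp: omega_cost_def)
  from landau_o.big_trans[OF this assms(4)] show ?thesis
    by (subst (asm) powr_bigo_iff) (auto simp: filterlim_real_sequentially)
qed

lemma mm_cost_pos: "0 < p \<Longrightarrow> 0 < q \<Longrightarrow> 0 < r \<Longrightarrow> 1 \<le> mm_cost p q r"
  using mm_slp_ge[OF mm_slp_mm_cost, of q p r] by (cases "mm_cost p q r") auto

lemma omega_cost_bigo:
  assumes "0 \<le> a" "0 \<le> b" "0 \<le> c"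
  shows "omega_cost a b c \<in> O(\<lambda>n. real n powr (a + b + c))"
proof (rule bigo_real_leI[of _ 3])
  fix n :: nat assume n: "1 \<le> n"
  let ?p = "npow n a" and ?q = "npow n b" and ?r = "npow n c"
  have "mm_cost ?p ?q ?r \<le> Suc (?p * ?r * (?q * 2))"
    by (rule mm_cost_le[OF mm_slp_naive])
  also have "\<dots> \<le> 3 * (?p * ?q * ?r)"
    using npow_ge_1[OF n assms(1)] npow_ge_1[OF n assms(2)] npow_ge_1[OF n assms(3)] by (simp add: Suc_le_eq)
  finally have "omega_cost a b c n \<le> 3 * (real ?p * real ?q * real ?r)"
    unfolding omega_cost_def by (simp flip: of_nat_mult)
  also have "\<dots> \<le> 3 * (real n powr a * real n powr b * real n powr c)"
    by (intro mult_left_mono mult_mono npow_le) auto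
  finally show "omega_cost a b c n \<le> 3 * real n powr (a + b + c)" by (simp add: powr_add)
qed (auto simp: omega_cost_def)

lemma omega_bdd_below:
  assumes "0 \<le> a" "0 \<le> b" "0 \<le> c"
  shows "bdd_below {\<beta>. omega_cost a b c \<in> O(\<lambda>n. real n powr \<beta>)}"
  using omega_cost_bigo_imp_ge[OF assms] by (intro bdd_belowI[of _ "a + c"]) auto

lemma omega_ge: "0 \<le> a \<Longrightarrow> 0 \<le> b \<Longrightarrow> 0 \<le> c \<Longrightarrow> a + c \<le> omega a b c"
  unfolding omega_eq using omega_cost_bigo[of a b c] omega_cost_bigo_imp_ge[of a b c]
  by (intro cInf_greatest) auto

lemma omega_le: "0 \<le> a \<Longrightarrow> 0 \<le> b \<Longrightarrow> 0 \<le> c \<Longrightarrow> omega a b c \<le> a + b + c"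
  unfolding omega_eq using omega_cost_bigo omega_bdd_below by (intro cInf_lower) auto

text \<open>The common passage from costs to exponents: \<open>K\<close> disappears in the
  \<open>O\<close> class and a factor \<open>n powr d\<close> becomes the summand
  \<open>d\<close>.\<close>

lemma omega_le_add:
  assumes nonneg: "0 \<le> a" "0 \<le> b" "0 \<le> c" "0 \<le> a'" "0 \<le> b'" "0 \<le> c'"
    and le: "\<And>n. 1 \<le> n \<Longrightarrow> omega_cost a' b' c' n \<le> K * (real n powr d * omega_cost a b c n)"
  shows "omega a' b' c' \<le> omega a b c + d"
proof -
  have "omega a' b' c' - d \<le> omega a b c" unfolding omega_eq[of a b c]
  proof (rule cInf_greatest)
    show "{\<beta>. omega_cost a b c \<in> O(\<lambda>n. real n powr \<beta>)} \<noteq> {}" using omega_cost_bigo[OF nonneg(1-3)] by auto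
    fix \<beta> assume "\<beta> \<in> {\<beta>. omega_cost a b c \<in> O(\<lambda>n. real n powr \<beta>)}"
    then have "(\<lambda>n. real n powr d * omega_cost a b c n) \<in> O(\<lambda>n. real n powr d * real n powr \<beta>)"
      by (intro landau_o.big.mult) auto
    moreover have "omega_cost a' b' c' \<in> O(\<lambda>n. real n powr d * omega_cost a b c n)"
      using le by (intro bigo_real_leI[of _ K]) (auto simp: omega_cost_def)
    ultimately have "omega_cost a' b' c' \<in> O(\<lambda>n. real n powr (d + \<beta>))"
      by (simp add: powr_add landau_o.big_trans)
    then have "omega a' b' c' \<le> d + \<beta>"
      unfolding omega_eq using omega_bdd_below[OF nonneg(4-6)] by (intro cInf_lower) auto
    then show "omega a' b' c' - d \<le> \<beta>" by simp
  qed
  then show ?thesis by simp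
qed

lemma omega_le_nat:
  assumes nonneg: "0 \<le> a" "0 \<le> b" "0 \<le> c" "0 \<le> a'" "0 \<le> b'" "0 \<le> c'"
    and le: "\<And>n. 1 \<le> n \<Longrightarrow> mm_cost (npow n a') (npow n b') (npow n c') \<le> K * mm_cost (npow n a) (npow n b) (npow n c)"
  shows "omega a' b' c' \<le> omega a b c"
proof -
  have "omega_cost a' b' c' n \<le> real K * (real n powr 0 * omega_cost a b c n)" if "1 \<le> n" for n
    using of_nat_mono[OF le[OF that], where 'a = real] that by (simp add: omega_cost_def)
  from omega_le_add[OF nonneg this] show ?thesis by simp
qed

lemma omega_reverse:
  assumes "0 \<le> a" "0 \<le> b" "0 \<le> c"
  shows "omega a b c = omega c b a"
proof -
  have "omega c b a \<le> omega a b c" if nonneg: "0 \<le> a" "0 \<le> b" "0 \<le> c" for a b c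
  proof (rule omega_le_nat[where K = 2])
    fix n :: nat assume n: "1 \<le> n"
    let ?p = "npow n a" and ?q = "npow n b" and ?r = "npow n c"
    have "mm_cost ?r ?q ?p \<le> Suc (mm_cost ?p ?q ?r)"
      by (rule mm_cost_le[OF mm_slp_transpose[OF mm_slp_mm_cost]])
    moreover have "1 \<le> mm_cost ?p ?q ?r" using mm_cost_pos npow_ge_1[OF n] nonneg by (simp add: Suc_le_eq)
    ultimately show "mm_cost ?r ?q ?p \<le> 2 * mm_cost ?p ?q ?r" by simp
  qed (use nonneg in auto)
  with assms show ?thesis by (intro antisym) auto
qed

text \<open>Together with \<open>omega_reverse\<close> this generates all permutations of the
  arguments.\<close>

lemma omega_swap:
  assumes "0 \<le> a" "0 \<le> b" "0 \<le> c"
  shows "omega a b c = omega a c b"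
proof -
  have "omega a c b \<le> omega a b c" if nonneg: "0 \<le> a" "0 \<le> b" "0 \<le> c" for b c
    by (rule omega_le_nat[where K = 27])
      (use nonneg npow_ge_1 in \<open>auto intro!: mm_cost_rotate simp: Suc_le_eq\<close>)
  with assms show ?thesis by (intro antisym) auto
qed

lemma omega_mono:
  assumes "0 \<le> a" "0 \<le> b" "0 \<le> c" "c \<le> c'"
  shows "omega a b c \<le> omega a b c'"
proof (rule omega_le_nat[where K = 2])
  fix n :: nat assume n: "1 \<le> n"
  let ?p = "npow n a" and ?q = "npow n b"
  have "mm_cost ?p ?q (npow n c) \<le> Suc (mm_cost ?p ?q (npow n c'))"
    using npow_mono[OF n assms(4)] by (intro mm_cost_le mm_slp_restrict[OF mm_slp_mm_cost]) auto
  moreover have "1 \<le> mm_cost ?p ?q (npow n c')"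
    using mm_cost_pos npow_ge_1[OF n] assms by (simp add: Suc_le_eq)
  ultimately show "mm_cost ?p ?q (npow n c) \<le> 2 * mm_cost ?p ?q (npow n c')" by simp
qed (use assms in auto)

text \<open>The longer dimension is covered by blocks of size \<open>npow n c\<close>. Their number
  is at most \<open>2 * n powr d\<close> by rounding plus one for the remainder, hence at most
  \<open>3 * n powr d\<close>; another factor 2 pays for the \<open>Suc\<close> of
  \<open>mm_cost_le\<close>.\<close>

lemma omega_add_le:
  assumes "0 \<le> a" "0 \<le> b" "0 \<le> c" "0 \<le> d"
  shows "omega a b (c + d) \<le> omega a b c + d"
proof (rule omega_le_add[where K = 6])
  fix n :: nat assume n: "1 \<le> n"
  let ?p = "npow n a" and ?q = "npow n b" and ?r = "npow n c" and ?r' = "npow n (c + d)"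
  let ?m = "?r' div ?r + 1"
  have pos: "1 \<le> ?p" "1 \<le> ?q" "1 \<le> ?r" using npow_ge_1[OF n] assms by auto
  have "?r' \<le> ?r * ?m" using pos(3) dividend_less_times_div[of ?r ?r'] by simp
  then have "mm_cost ?p ?q ?r' \<le> Suc (?m * mm_cost ?p ?q ?r)"
    by (intro mm_cost_le mm_slp_restrict[OF mm_slp_split[OF mm_slp_mm_cost]]) auto
  also have "\<dots> \<le> 2 * (?m * mm_cost ?p ?q ?r)"
    using mm_cost_pos[of ?p ?q ?r] pos by (simp add: Suc_le_eq)
  finally have "omega_cost a b (c + d) n \<le> 2 * (real ?m * omega_cost a b c n)"
    unfolding omega_cost_def by (simp flip: of_nat_mult of_nat_Suc)
  also have "real ?m \<le> 3 * real n powr d"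
  proof -
    have "real (?r' div ?r) \<le> real ?r' / real ?r" by (rule of_nat_div_le_of_nat)
    also have "\<dots> \<le> real n powr (c + d) / (real n powr c / 2)"
      using npow_le[of n "c + d"] npow_ge_half[OF n assms(3)] n by (intro frac_le) auto
    also have "\<dots> = 2 * real n powr d" using n by (simp add: powr_add)
    finally show ?thesis using ge_one_powr_ge_zero[of "real n" d] n assms(4) by simp
  qed
  then have "2 * (real ?m * omega_cost a b c n) \<le> 2 * (3 * real n powr d * omega_cost a b c n)"
    by (intro mult_left_mono mult_right_mono) (auto simp: omega_cost_def)
  finally show "omega_cost a b (c + d) n \<le> 6 * (real n powr d * omega_cost a b c n)" by simp
qed (use assms in auto)


section \<open>The balanced point\<close>

lemma continuous_on_nonexpansive:
  fixes f :: "real \<Rightarrow> real"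
  assumes "\<And>x y. x \<in> S \<Longrightarrow> y \<in> S \<Longrightarrow> x \<le> y \<Longrightarrow> \<bar>f x - f y\<bar> \<le> y - x"
  shows "continuous_on S f"
  unfolding continuous_on_def
proof (intro ballI tendstoI)
  fix x e assume "x \<in> S" "(0::real) < e"
  have "\<bar>f y - f x\<bar> \<le> \<bar>y - x\<bar>" if "y \<in> S" for y
    using assms[OF that \<open>x \<in> S\<close>] assms[OF \<open>x \<in> S\<close> that] by (cases "x \<le> y") auto
  with \<open>0 < e\<close> show "\<forall>\<^sub>F y in at x within S. dist (f y) (f x) < e"
    unfolding eventually_at dist_real_def by (intro exI[of _ e]) (auto intro: le_less_trans)
qed

text \<open>
  For every \<open>a\<close> the equation \<open>a + b = W a b - b\<close> has a solution \<open>b\<close>, which is unique and depends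
  continuously on \<open>a\<close> because \<open>W\<close> is monotone and nonexpansive; a second application of the
  intermediate value theorem, along this curve, balances the third term.
\<close>

lemma balanced_point:
  fixes W :: "real \<Rightarrow> real \<Rightarrow> real"
  assumes sym: "\<And>a b. a \<in> {0..1} \<Longrightarrow> b \<in> {0..1} \<Longrightarrow> W a b = W b a"
    and mono: "\<And>a b b'. a \<in> {0..1} \<Longrightarrow> b \<in> {0..1} \<Longrightarrow> b' \<in> {0..1} \<Longrightarrow> b \<le> b' \<Longrightarrow> W a b \<le> W a b'"
    and lip: "\<And>a b b'. a \<in> {0..1} \<Longrightarrow> b \<in> {0..1} \<Longrightarrow> b' \<in> {0..1} \<Longrightarrow> b \<le> b' \<Longrightarrow> W a b' \<le> W a b + (b' - b)"
    and ge: "\<And>a b. a \<in> {0..1} \<Longrightarrow> b \<in> {0..1} \<Longrightarrow> 1 + b \<le> W a b"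
    and le: "\<And>a b. a \<in> {0..1} \<Longrightarrow> b \<in> {0..1} \<Longrightarrow> W a b \<le> 1 + a + b"
  shows "\<exists>a\<in>{0..1}. \<exists>b\<in>{0..1}. a + b = W a b - b \<and> a + b = W 1 a - a"
proof -
  \<comment> \<open>Here the symmetry enters: it carries both properties over from the second
    argument to the first.\<close>
  have mono': "W a b \<le> W a' b" if "a \<in> {0..1}" "a' \<in> {0..1}" "b \<in> {0..1}" "a \<le> a'" for a a' b
    using mono[of b a a'] sym[of a b] sym[of a' b] that by auto
  have lip': "W a' b \<le> W a b + (a' - a)" if "a \<in> {0..1}" "a' \<in> {0..1}" "b \<in> {0..1}" "a \<le> a'" for a a' b
    using lip[of b a a'] sym[of a b] sym[of a' b] that by auto
  have cont: "continuous_on {0..1} (W a)" if "a \<in> {0..1}" for a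
  proof (rule continuous_on_nonexpansive)
    fix x y :: real assume "x \<in> {0..1}" "y \<in> {0..1}" "x \<le> y"
    from mono[OF that this] lip[OF that this] show "\<bar>W a x - W a y\<bar> \<le> y - x" by linarith
  qed
  have "\<exists>b\<in>{0..1}. a + b = W a b - b" if a: "a \<in> {0..1}" for a
  proof -
    have "\<exists>b\<ge>0. b \<le> 1 \<and> a + 2 * b - W a b = 0"
    proof (rule IVT')
      show "a + 2 * 0 - W a 0 \<le> 0" using ge[OF a, of 0] a by auto
      show "0 \<le> a + 2 * 1 - W a 1" using le[OF a, of 1] a by auto
      show "continuous_on {0..1} (\<lambda>b. a + 2 * b - W a b)" by (intro continuous_intros cont a)
    qed auto
    then show ?thesis by force
  qed
  then obtain B where B: "\<And>a. a \<in> {0..1} \<Longrightarrow> B a \<in> {0..1}"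
    and eq: "\<And>a. a \<in> {0..1} \<Longrightarrow> a + B a = W a (B a) - B a" by metis
  have "continuous_on {0..1} B"
  proof (rule continuous_on_nonexpansive)
    fix a a' :: real assume a: "a \<in> {0..1}" "a' \<in> {0..1}" "a \<le> a'"
    note BB = B[OF a(1)] B[OF a(2)]
    have 1: "W a (B a) \<le> W a' (B a)" "W a' (B a) \<le> W a (B a) + (a' - a)"
      using mono' lip' a BB(1) by auto
    \<comment> \<open>On the curve \<open>a + 2 * B a = W a (B a)\<close>. If \<open>B\<close>
      increased, its growth would count twice on the left but at most once on the right, while the
      growth of \<open>a\<close> counts once on the left and at most once on the right.\<close>
    have "B a' \<le> B a"
    proof (rule ccontr)
      assume "\<not> B a' \<le> B a"
      then have "W a' (B a') \<le> W a' (B a) + (B a' - B a)" using lip a BB by auto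
      with 1 eq[OF a(1)] eq[OF a(2)] \<open>\<not> B a' \<le> B a\<close> show False by linarith
    qed
    moreover from this have "W a' (B a) \<le> W a' (B a') + (B a - B a')" using lip a BB by auto
    ultimately show "\<bar>B a - B a'\<bar> \<le> a' - a" using 1 eq[OF a(1)] eq[OF a(2)] by linarith
  qed
  have "\<exists>a\<ge>0. a \<le> 1 \<and> 2 * a + B a - W 1 a = 0"
  proof (rule IVT')
    show "2 * 0 + B 0 - W 1 0 \<le> 0" using ge[of 1 0] B[of 0] by auto
    \<comment> \<open>At the right end the third term is compared with the second, which is balanced
      on the curve.\<close>
    have "W 1 1 \<le> W 1 (B 1) + (1 - B 1)" using lip[of 1 "B 1" 1] B[of 1] by auto
    then show "0 \<le> 2 * 1 + B 1 - W 1 1" using eq[of 1] by simp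
    show "continuous_on {0..1} (\<lambda>a. 2 * a + B a - W 1 a)"
      by (intro continuous_intros cont \<open>continuous_on {0..1} B\<close>) simp
  qed auto
  then obtain a where a: "a \<in> {0..1}" "2 * a + B a - W 1 a = 0" by auto
  show ?thesis
    by (rule bexI[OF _ a(1)], rule bexI[OF _ B[OF a(1)]]) (use eq[OF a(1)] a(2) in linarith)
qed

text \<open>The conjecture covers the open square only. Contracting towards its centre moves a
  balanced point inside, and nonexpansiveness of \<open>W\<close> controls what this does to the
  three terms.\<close>

lemma nearly_balanced_interior_point:
  fixes W :: "real \<Rightarrow> real \<Rightarrow> real"
  assumes sym: "\<And>a b. a \<in> {0..1} \<Longrightarrow> b \<in> {0..1} \<Longrightarrow> W a b = W b a"
    and mono: "\<And>a b b'. a \<in> {0..1} \<Longrightarrow> b \<in> {0..1} \<Longrightarrow> b' \<in> {0..1} \<Longrightarrow> b \<le> b' \<Longrightarrow> W a b \<le> W a b'"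
    and lip: "\<And>a b b'. a \<in> {0..1} \<Longrightarrow> b \<in> {0..1} \<Longrightarrow> b' \<in> {0..1} \<Longrightarrow> b \<le> b' \<Longrightarrow> W a b' \<le> W a b + (b' - b)"
    and ge: "\<And>a b. a \<in> {0..1} \<Longrightarrow> b \<in> {0..1} \<Longrightarrow> 1 + b \<le> W a b"
    and le: "\<And>a b. a \<in> {0..1} \<Longrightarrow> b \<in> {0..1} \<Longrightarrow> W a b \<le> 1 + a + b"
    and "0 < \<epsilon>"
  shows "\<exists>a\<in>{0<..<1}. \<exists>b\<in>{0<..<1}. \<exists>v.
    \<bar>a + b - v\<bar> \<le> \<epsilon> \<and> \<bar>W a b - b - v\<bar> \<le> \<epsilon> \<and> \<bar>W 1 a - a - v\<bar> \<le> \<epsilon>"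
proof -
  obtain a b where ab: "a \<in> {0..1}" "b \<in> {0..1}" and eq: "a + b = W a b - b" "a + b = W 1 a - a"
    using balanced_point[of W, OF sym mono lip ge le] by blast
  have close: "\<bar>W x y - W x y'\<bar> \<le> \<bar>y - y'\<bar>" if "x \<in> {0..1}" "y \<in> {0..1}" "y' \<in> {0..1}" for x y y'
    using mono[OF that] lip[OF that] mono[OF that(1,3,2)] lip[OF that(1,3,2)] by (cases "y \<le> y'") auto
  \<comment> \<open>The worst case is the second term: \<open>2 * \<delta>\<close> through the
    arguments of \<open>W\<close> and \<delta> through the subtracted one.\<close>
  define \<delta> where "\<delta> = min 1 (\<epsilon> / 3)"
  have \<delta>: "0 < \<delta>" "\<delta> \<le> 1" "3 * \<delta> \<le> \<epsilon>" using \<open>0 < \<epsilon>\<close> by (auto simp: \<delta>_def)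
  define s where "s x = (1 - \<delta>) * x + \<delta> / 2" for x
  have s: "s x \<in> {0<..<1}" "\<bar>s x - x\<bar> \<le> \<delta>" if "x \<in> {0..1}" for x
  proof -
    have "0 \<le> (1 - \<delta>) * x" "(1 - \<delta>) * x \<le> 1 - \<delta>"
      using that \<delta> by (auto intro: mult_left_le)
    then show "s x \<in> {0<..<1}" using \<delta> unfolding s_def by auto
    have "\<delta> * x \<le> \<delta>" "0 \<le> \<delta> * x" using that \<delta> by (auto intro: mult_left_le)
    then show "\<bar>s x - x\<bar> \<le> \<delta>" by (simp add: s_def algebra_simps abs_le_iff)
  qed
  have in01: "s a \<in> {0..1}" "s b \<in> {0..1}" using s(1)[OF ab(1)] s(1)[OF ab(2)] by auto
  have "\<bar>W (s a) (s b) - W (s a) b\<bar> \<le> \<delta>" using close[OF in01(1,2) ab(2)] s(2)[OF ab(2)] by linarith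
  moreover have "\<bar>W (s a) b - W a b\<bar> \<le> \<delta>"
    using close[OF ab(2) in01(1) ab(1)] s(2)[OF ab(1)] sym[OF in01(1) ab(2)] sym[OF ab] by linarith
  moreover have "\<bar>W 1 (s a) - W 1 a\<bar> \<le> \<delta>" using close[OF _ in01(1) ab(1), of 1] s(2)[OF ab(1)] by auto
  ultimately have "\<bar>s a + s b - (a + b)\<bar> \<le> \<epsilon>" "\<bar>W (s a) (s b) - s b - (a + b)\<bar> \<le> \<epsilon>"
      "\<bar>W 1 (s a) - s a - (a + b)\<bar> \<le> \<epsilon>"
    using eq s(2)[OF ab(1)] s(2)[OF ab(2)] \<delta> unfolding abs_le_iff by linarith+
  then show ?thesis
    by (intro bexI[OF _ s(1)[OF ab(1)]] bexI[OF _ s(1)[OF ab(2)]] exI[of _ "a + b"] conjI)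
qed


section \<open>Simulation on the word RAM\<close>

definition halts :: "nat \<Rightarrow> nat list \<Rightarrow> prog \<Rightarrow> ram_state \<Rightarrow> nat \<Rightarrow> (ram_state \<Rightarrow> bool) \<Rightarrow> bool" where
  "halts W inp p s T Q \<longleftrightarrow> (\<exists>t s'. exec W inp p s t s' \<and> t \<le> T \<and> Q s')"

lemma halts_within_eq: "halts_within c n = halts (word_bound c n)"
  by (intro ext) (simp add: halts_within_def halts_def)

lemma halts_mono:
  "halts W inp p s T Q \<Longrightarrow> T \<le> T' \<Longrightarrow> (\<And>s'. Q s' \<Longrightarrow> Q' s') \<Longrightarrow> halts W inp p s T' Q'"
  unfolding halts_def by (meson order_trans)

lemma halts_SetConst: "v < W \<Longrightarrow> 1 \<le> T \<Longrightarrow> Q (R(x := v), M) \<Longrightarrow> halts W inp (SetConst x v) (R, M) T Q"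
  unfolding halts_def by (meson exec.SetConst)

lemma halts_Arith:
  "binop_val f (R y) (R z) < W \<Longrightarrow> 1 \<le> T \<Longrightarrow> Q (R(x := binop_val f (R y) (R z)), M)
    \<Longrightarrow> halts W inp (Arith x f y z) (R, M) T Q"
  unfolding halts_def by (meson exec.Arith)

lemma halts_Input:
  "R y < length inp \<Longrightarrow> inp ! R y < W \<Longrightarrow> 1 \<le> T \<Longrightarrow> Q (R(x := inp ! R y), M)
    \<Longrightarrow> halts W inp (Input x y) (R, M) T Q"
  unfolding halts_def by (meson exec.Input)

lemma halts_Load: "1 \<le> T \<Longrightarrow> Q (R(x := M (R y)), M) \<Longrightarrow> halts W inp (Load x y) (R, M) T Q"
  unfolding halts_def by (meson exec.Load)

lemma halts_Store: "1 \<le> T \<Longrightarrow> Q (R, M(R x := R y)) \<Longrightarrow> halts W inp (Store x y) (R, M) T Q"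
  unfolding halts_def by (meson exec.Store)

lemma halts_Seq:
  assumes "halts W inp p s T1 (\<lambda>s'. halts W inp q s' T2 Q)" "T1 + T2 \<le> T"
  shows "halts W inp (Seq p q) s T Q"
  using assms unfolding halts_def by (meson add_mono exec.Seq order_trans)

lemma halts_Seq_step:
  assumes "1 \<le> T" "halts W inp p s 1 (\<lambda>s'. halts W inp q s' (T - 1) Q)"
  shows "halts W inp (Seq p q) s T Q"
  using assms by (intro halts_Seq) auto

lemmas halts_steps = halts_Seq_step halts_SetConst halts_Arith halts_Input halts_Load halts_Store

text \<open>\<open>Arith\<close> takes no immediate operands, so the register \<open>u\<close> holds
  the increment 1.\<close>

definition for_loop :: "nat \<Rightarrow> nat \<Rightarrow> nat \<Rightarrow> nat \<Rightarrow> prog \<Rightarrow> prog" where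
  "for_loop i b f u p =
     Seq (SetConst i 0) (Seq (SetConst u 1) (Seq (Arith f Less i b)
       (WhileNZ f (Seq p (Seq (Arith i Plus i u) (Arith f Less i b))))))"

text \<open>Each round costs the body plus branch, increment and comparison; the 4 is three
  initialisations and the last, failing test. The body must establish the invariant for arbitrary
  \<open>i\<close> and \<open>f\<close>, since the loop overwrites both afterwards.\<close>

lemma halts_for_loop:
  assumes distinct: "distinct [i, b, f, u]" and "N < W" "1 < W" "R b = N"
    and init: "Inv 0 (R(i := 0, u := 1, f := of_bool (0 < N)), M)"
    and body: "\<And>k R M. k < N \<Longrightarrow> R i = k \<Longrightarrow> R b = N \<Longrightarrow> R u = 1 \<Longrightarrow> Inv k (R, M) \<Longrightarrow>
       halts W inp p (R, M) T (\<lambda>(R', M'). R' i = k \<and> R' b = N \<and> R' u = 1 \<and>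
         (\<forall>x y. Inv (Suc k) (R'(i := x, f := y), M')))"
  shows "halts W inp (for_loop i b f u p) (R, M) (4 + N * (T + 3)) (Inv N)"
proof -
  let ?w = "WhileNZ f (Seq p (Seq (Arith i Plus i u) (Arith f Less i b)))"
  have loop: "halts W inp ?w (R, M) (1 + (N - k) * (T + 3)) (Inv N)"
    if "k \<le> N" "R i = k" "R b = N" "R u = 1" "R f = of_bool (k < N)" "Inv k (R, M)" for k R M
    using that
  proof (induction "N - k" arbitrary: k R M)
    case 0
    then have "exec W inp ?w (R, M) 1 (R, M)" by (intro exec.WhileFalse) auto
    with 0 show ?case unfolding halts_def by (intro exI[of _ 1] exI[of _ "(R, M)"]) auto
  next
    case (Suc d)
    then have k: "k < N" by auto
    from body[OF k] Suc.prems obtain t R' M' where ex: "exec W inp p (R, M) t (R', M')"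
      and t: "t \<le> T" and R': "R' i = k" "R' b = N" "R' u = 1"
      and inv: "\<And>x y. Inv (Suc k) (R'(i := x, f := y), M')"
      unfolding halts_def by fastforce
    let ?R = "R'(i := Suc k, f := of_bool (Suc k < N))"
    have "halts W inp (Seq (Arith i Plus i u) (Arith f Less i b)) (R', M') 2 (\<lambda>s. s = (?R, M'))"
      using R' k \<open>N < W\<close> \<open>1 < W\<close> distinct by (intro halts_steps) auto
    then obtain t2 where t2: "t2 \<le> 2"
      "exec W inp (Seq (Arith i Plus i u) (Arith f Less i b)) (R', M') t2 (?R, M')"
      unfolding halts_def by blast
    from ex t2(2) have b: "exec W inp (Seq p (Seq (Arith i Plus i u) (Arith f Less i b))) (R, M)
        (t + t2) (?R, M')" by (rule exec.Seq)
    have "halts W inp ?w (?R, M') (1 + (N - Suc k) * (T + 3)) (Inv N)"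
      using Suc.hyps(2) k R' inv distinct by (intro Suc.hyps(1)) auto
    then obtain t' s' where e: "exec W inp ?w (?R, M') t' s'" "t' \<le> 1 + (N - Suc k) * (T + 3)" "Inv N s'"
      unfolding halts_def by auto
    have "exec W inp ?w (R, M) (Suc (t + t2 + t')) s'"
      using Suc.prems k by (intro exec.WhileTrue[OF _ b e(1)]) auto
    moreover have "N - k = Suc (N - Suc k)" using k by auto
    then have "Suc (t + t2 + t') \<le> 1 + (N - k) * (T + 3)" using t t2(1) e(2) by simp
    ultimately show ?case using e(3) unfolding halts_def by blast
  qed
  have loop0: "halts W inp ?w (R(i := 0, u := 1, f := of_bool (0 < N)), M) (1 + N * (T + 3)) (Inv N)"
    using loop[of 0 "R(i := 0, u := 1, f := of_bool (0 < N))" M] distinct \<open>R b = N\<close> init by auto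
  show ?thesis unfolding for_loop_def
    using \<open>N < W\<close> \<open>1 < W\<close> \<open>R b = N\<close> distinct loop0
    by (intro halts_steps) (auto elim!: halts_mono)
qed

section \<open>Running a program with its input in memory\<close>

fun regs :: "prog \<Rightarrow> nat set" where
  "regs Skip = {}"
| "regs (SetConst x v) = {x}"
| "regs (Arith x f y z) = {x, y, z}"
| "regs (Input x y) = {x, y}"
| "regs (Load x y) = {x, y}"
| "regs (Store x y) = {x, y}"
| "regs (Seq p q) = regs p \<union> regs q"
| "regs (IfNZ x p q) = insert x (regs p \<union> regs q)"
| "regs (WhileNZ x p) = insert x (regs p)"

lemma finite_regs [simp]: "finite (regs p)"
  by (induction p) auto

text \<open>
  A simulated program owns the odd memory cells; the even cells hold its input. Registers from
  \<open>m\<close> on are not used by it, and the first two of them serve for address computations.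
\<close>

fun sim :: "nat \<Rightarrow> prog \<Rightarrow> prog" where
  "sim m (Input x y) = Seq (SetConst m 2) (Seq (Arith m Times m y) (Load x m))"
| "sim m (Load x y) = Seq (SetConst m 2) (Seq (Arith m Times m y)
     (Seq (SetConst (Suc m) 1) (Seq (Arith m Plus m (Suc m)) (Load x m))))"
| "sim m (Store x y) = Seq (SetConst m 2) (Seq (Arith m Times m x)
     (Seq (SetConst (Suc m) 1) (Seq (Arith m Plus m (Suc m)) (Store m y))))"
| "sim m (Seq p q) = Seq (sim m p) (sim m q)"
| "sim m (IfNZ x p q) = IfNZ x (sim m p) (sim m q)"
| "sim m (WhileNZ x p) = WhileNZ x (sim m p)"
| "sim m p = p"

text \<open>Addresses are doubled by the simulation, and \<open>Load\<close> and
  \<open>Store\<close> do not check their addresses; this invariant keeps the doubled ones within a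
  word.\<close>

definition state_below :: "nat \<Rightarrow> ram_state \<Rightarrow> bool" where
  "state_below W s \<longleftrightarrow> (\<forall>r. fst s r < W) \<and> (\<forall>a. snd s a < W)"

lemma exec_state_below: "exec W inp p s t s' \<Longrightarrow> state_below W s \<Longrightarrow> state_below W s'"
  by (induction rule: exec.induct) (auto simp: state_below_def)

definition represents :: "nat \<Rightarrow> ram_state \<Rightarrow> ram_state \<Rightarrow> bool" where
  "represents m s S \<longleftrightarrow> (\<forall>r<m. fst S r = fst s r) \<and> (\<forall>a. snd S (Suc (2 * a)) = snd s a)"

definition holds_input :: "nat list \<Rightarrow> ram_state \<Rightarrow> bool" where
  "holds_input inp S \<longleftrightarrow> (\<forall>k<length inp. snd S (2 * k) = inp ! k)"

text \<open>What makes simulated calls composable: the caller's registers from \<open>m + 2\<close>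
  on and the input cells survive.\<close>

definition frame :: "nat \<Rightarrow> ram_state \<Rightarrow> ram_state \<Rightarrow> bool" where
  "frame m S S' \<longleftrightarrow> (\<forall>r\<ge>m+2. fst S' r = fst S r) \<and> (\<forall>k. snd S' (2 * k) = snd S (2 * k))"

lemma frame_trans: "frame m S S' \<Longrightarrow> frame m S' S'' \<Longrightarrow> frame m S S''"
  by (simp add: frame_def)

lemma frame_holds_input: "frame m S S' \<Longrightarrow> holds_input inp S \<Longrightarrow> holds_input inp S'"
  by (simp add: frame_def holds_input_def)

lemma even_neq_Suc_even: "2 * k \<noteq> Suc (2 * (l::nat))" "Suc (2 * l) \<noteq> 2 * k"
  by presburger+

text \<open>The factor 5 is the length of a simulated \<open>Load\<close> or \<open>Store\<close>.
  The actual input \<open>inp'\<close> is arbitrary, because simulated reads go to memory.\<close>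

lemma sim_correct:
  assumes "exec W inp p s t s'" "regs p \<subseteq> {..<m}" "state_below W s"
    and W': "2 * W \<le> W'" "2 < W'"
    and "represents m s S" "holds_input inp S"
  shows "halts W' inp' (sim m p) S (5 * t) (\<lambda>S'. represents m s' S' \<and> frame m S S')"
  using assms(1-3,6-)
proof (induction arbitrary: S rule: exec.induct)
  case (Skip s)
  then show ?case using exec.Skip[of W' inp' S] unfolding halts_def
    by (intro exI[of _ 1] exI[of _ S]) (simp add: frame_def)
next
  case (SetConst v x R M)
  then show ?case using W'
    by (cases S) (auto intro!: halts_steps simp: represents_def frame_def)
next
  case (Arith v f R y z x M)
  then show ?case using W'
    by (cases S) (auto intro!: halts_steps simp: represents_def frame_def)
next
  case (Input R y v x M)
  have "R y < W" using Input by (auto simp: state_below_def)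
  with Input W' show ?case
    by (cases S) (auto intro!: halts_steps simp: represents_def frame_def holds_input_def)
next
  case (Load x y R M)
  have "R y < W" using Load by (auto simp: state_below_def)
  with Load W' show ?case
    by (cases S) (auto intro!: halts_steps simp: represents_def frame_def)
next
  case (Store x y R M)
  have "R x < W" using Store by (auto simp: state_below_def)
  with Store W' show ?case
    by (cases S) (auto intro!: halts_steps simp: represents_def frame_def even_neq_Suc_even)
next
  case (Seq p s t s' q t' s'')
  have b: "state_below W s'" using Seq exec_state_below by blast
  have "halts W' inp' (sim m p) S (5 * t) (\<lambda>S'. represents m s' S' \<and> frame m S S')"
    using Seq by auto
  then have "halts W' inp' (sim m p) S (5 * t)
      (\<lambda>S'. halts W' inp' (sim m q) S' (5 * t') (\<lambda>S'. represents m s'' S' \<and> frame m S S'))"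
    by (rule halts_mono) (use Seq b in \<open>auto intro!: halts_mono[OF Seq.IH(2)] intro: frame_holds_input frame_trans\<close>)
  then show ?case by (auto intro: halts_Seq)
next
  case (IfTrue s x p t s' q)
  then have "halts W' inp' (sim m p) S (5 * t) (\<lambda>S'. represents m s' S' \<and> frame m S S')" by auto
  then obtain t1 S1 where "exec W' inp' (sim m p) S t1 S1" "t1 \<le> 5 * t" "represents m s' S1" "frame m S S1"
    unfolding halts_def by auto
  moreover have "fst S x \<noteq> 0" using IfTrue by (auto simp: represents_def)
  ultimately show ?case using exec.IfTrue[of S x W' inp' "sim m p" t1 S1] unfolding halts_def
    by (intro exI[of _ "Suc t1"] exI[of _ S1]) simp
next
  case (IfFalse s x q t s' p)
  then have "halts W' inp' (sim m q) S (5 * t) (\<lambda>S'. represents m s' S' \<and> frame m S S')" by auto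
  then obtain t1 S1 where "exec W' inp' (sim m q) S t1 S1" "t1 \<le> 5 * t" "represents m s' S1" "frame m S S1"
    unfolding halts_def by auto
  moreover have "fst S x = 0" using IfFalse by (auto simp: represents_def)
  ultimately show ?case using exec.IfFalse[of S x W' inp' "sim m q" t1 S1] unfolding halts_def
    by (intro exI[of _ "Suc t1"] exI[of _ S1]) simp
next
  case (WhileTrue s x p t s' t' s'')
  have b: "state_below W s'" using WhileTrue exec_state_below by blast
  have "halts W' inp' (sim m p) S (5 * t) (\<lambda>S'. represents m s' S' \<and> frame m S S')"
    using WhileTrue by auto
  then obtain t1 S1 where 1: "exec W' inp' (sim m p) S t1 S1" "t1 \<le> 5 * t" "represents m s' S1" "frame m S S1"
    unfolding halts_def by auto
  have "halts W' inp' (sim m (WhileNZ x p)) S1 (5 * t') (\<lambda>S'. represents m s'' S' \<and> frame m S1 S')"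
    using WhileTrue.prems b 1 by (intro WhileTrue.IH) (auto intro: frame_holds_input)
  then obtain t2 S2 where 2: "exec W' inp' (WhileNZ x (sim m p)) S1 t2 S2" "t2 \<le> 5 * t'"
      "represents m s'' S2" "frame m S1 S2"
    unfolding halts_def by auto
  have "fst S x \<noteq> 0" using WhileTrue by (auto simp: represents_def)
  from exec.WhileTrue[OF this 1(1) 2(1)] 1 2 show ?case unfolding halts_def
    by (intro exI[of _ "Suc (t1 + t2)"] exI[of _ S2]) (auto intro: frame_trans)
next
  case (WhileFalse s x p)
  then have "fst S x = 0" by (auto simp: represents_def)
  then have "exec W' inp' (WhileNZ x (sim m p)) S 1 S" by (rule exec.WhileFalse)
  with WhileFalse show ?case unfolding halts_def
    by (intro exI[of _ 1] exI[of _ S]) (simp add: frame_def)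
qed


section \<open>The reduction\<close>

fun seqs :: "prog list \<Rightarrow> prog" where
  "seqs [] = Skip"
| "seqs [p] = p"
| "seqs (p # q # ps) = Seq p (seqs (q # ps))"

lemma npow_one: "npow n 1 = n"
  by (simp add: npow_def)

lemma npow_bounds:
  assumes "0 < n" "\<tau> \<in> {0<..<1}"
  shows "0 < npow n \<tau>" "npow n \<tau> \<le> n"
  using npow_ge_1[of n \<tau>] npow_mono[of n \<tau> 1] assms by (auto simp: npow_one)

lemma dim_bmult [simp]: "dim_row (A \<odot> B) = dim_row A" "dim_col (A \<odot> B) = dim_col B"
  by (simp_all add: bmult_def)

lemma index_bmult:
  "i < dim_row A \<Longrightarrow> j < dim_col B \<Longrightarrow> (A \<odot> B) $$ (i, j) \<longleftrightarrow> (\<exists>k<dim_col A. A $$ (i, k) \<and> B $$ (k, j))"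
  by (simp add: bmult_def)

lemma row_major_less:
  assumes "i < n" "j < (k::nat)"
  shows "i * k + j < n * k"
proof -
  have "i * k + j < Suc i * k" using assms by simp
  also have "\<dots> \<le> n * k" using assms by (intro mult_right_mono) auto
  finally show ?thesis .
qed

section \<open>Calls to the data structure\<close>

locale product5_reduction =
  fixes c m :: nat and pI pU pQ :: prog and TI TU TQ :: "nat \<Rightarrow> nat"
  assumes dynamic: "dynamic_product5 c pI pU pQ TI TU TQ"
    and regs: "regs pI \<subseteq> {..<m}" "regs pU \<subseteq> {..<m}" "regs pQ \<subseteq> {..<m}" "0 < m"
begin

definition W :: "nat \<Rightarrow> nat" where "W = word_bound (c + 6)"

text \<open>Six extra factors \<open>n + 2\<close> leave room for doubled words. For the addresses,
  four of them, each at least 3, supply the constant 81 and the other two the square.\<close>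

lemma W_ge:
  assumes "0 < n"
  shows "2 * word_bound c n \<le> W n" "81 * (n * n) + 324 \<le> W n"
proof -
  have W: "W n = word_bound c n * (n + 2) ^ 6" by (simp add: W_def word_bound_def power_add)
  have "(2::nat) ^ 6 \<le> (n + 2) ^ 6" by (intro power_mono) auto
  then show "2 * word_bound c n \<le> W n" unfolding W by (simp add: mult.commute)
  have "(3::nat) ^ 4 * (n + 2)\<^sup>2 \<le> (n + 2) ^ 4 * (n + 2)\<^sup>2"
    using assms by (intro mult_right_mono power_mono) auto
  also have "\<dots> = 1 * (n + 2) ^ 6" by (simp flip: power_add)
  also have "\<dots> \<le> W n" unfolding W by (intro mult_right_mono) (auto simp: word_bound_def Suc_le_eq)
  finally show "81 * (n * n) + 324 \<le> W n" by (simp add: power2_eq_square algebra_simps)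
qed

lemma le_square: "n \<le> n * (n::nat)"
  by (cases n) auto

lemma less_W:
  assumes "0 < n" "a \<le> 80 * (n * n) + 300"
  shows "a < W n"
  using W_ge(2)[OF assms(1)] assms(2) by linarith

lemma index_less_W: "0 < n \<Longrightarrow> a \<le> n \<Longrightarrow> a < W n"
  using less_W[of n a] le_square[of n] by simp

text \<open>The even cells are left open, because every update or query overwrites those it
  reads.\<close>

definition ds_state :: "nat \<Rightarrow> bool mat list \<Rightarrow> ram_state \<Rightarrow> bool" where
  "ds_state n As S \<longleftrightarrow> (\<exists>s. reachable c n pI pU pQ As s \<and> state_below (word_bound c n) s \<and> represents m s S)"

lemma ds_stateI:
  "reachable c n pI pU pQ As s \<Longrightarrow> state_below (word_bound c n) s \<Longrightarrow> represents m s S \<Longrightarrow> ds_state n As S"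
  unfolding ds_state_def by blast

text \<open>
  Register conventions: \<open>m + 2\<close>, \<open>m + 3\<close>, \<open>m + 4\<close> hold \<open>n\<close>, \<open>t1\<close>, \<open>t2\<close> in all phases; \<open>m + 5\<close> to
  \<open>m + 8\<close> are counter, bound, flag and the constant 1 of loops.
\<close>

definition call_update :: "nat \<Rightarrow> nat \<Rightarrow> nat \<Rightarrow> prog" where
  "call_update k i j = seqs [SetConst m 0, Store m k, SetConst m 2, Store m i, SetConst m 4, Store m j,
     SetConst m 6, Store m (m + 8), sim m pU]"

text \<open>The loop constant 1 in register \<open>m + 8\<close> doubles as the new value of the
  entry.\<close>

lemma halts_call_update:
  assumes n: "0 < n" and ds: "ds_state n As (R, M)"
    and r: "R rk < 5" "R ri < n" "R rj < n" "R (m + 8) = 1" "m < rk" "m < ri" "m < rj"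
  shows "halts (W n) inp (call_update rk ri rj) (R, M) (8 + 5 * TU n)
    (\<lambda>(R', M'). ds_state n (set_entry As (R rk) (R ri) (R rj) True) (R', M') \<and> (\<forall>r\<ge>m+2. R' r = R r))"
proof -
  let ?As = "set_entry As (R rk) (R ri) (R rj) True"
  obtain s where s: "reachable c n pI pU pQ As s" "state_below (word_bound c n) s" "represents m s (R, M)"
    using ds unfolding ds_state_def by blast
  have "halts (word_bound c n) [R rk, R ri, R rj, of_bool True] pU s (TU n) (\<lambda>_. True)"
    using dynamic n s(1) r unfolding dynamic_product5_def halts_within_eq by blast
  then obtain t s' where s': "exec (word_bound c n) [R rk, R ri, R rj, of_bool True] pU s t s'" "t \<le> TU n"
    unfolding halts_def by blast
  have reach: "reachable c n pI pU pQ ?As s'"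
    by (rule reachable.update[OF s(1) r(1-3) s'(1)])
  let ?S = "(R(m := 6), M(0 := R rk, 2 := R ri, 4 := R rj, 6 := 1))"
  have "represents m s ?S" using s(3) by (auto simp: represents_def; presburger)
  moreover have "holds_input [R rk, R ri, R rj, of_bool True] ?S"
    by (auto simp: holds_input_def less_Suc_eq nth_Cons')
  ultimately have "halts (W n) inp (sim m pU) ?S (5 * t) (\<lambda>S'. represents m s' S' \<and> frame m ?S S')"
    using W_ge[OF n] by (intro sim_correct[OF s'(1) regs(2) s(2)]) auto
  then have "halts (W n) inp (sim m pU) ?S (5 * TU n) (\<lambda>(R', M'). ds_state n ?As (R', M') \<and> (\<forall>r\<ge>m+2. R' r = R r))"
    by (rule halts_mono)
      (use s' reach exec_state_below[OF s'(1) s(2)] in \<open>auto simp: frame_def intro: ds_stateI\<close>)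
  then have "halts (W n) inp (sim m pU) ((R(m := 0, m := 2, m := 4, m := 6)), M(0 := R rk, 2 := R ri, 4 := R rj, 6 := 1)) (5 * TU n) (\<lambda>(R', M'). ds_state n ?As (R', M') \<and> (\<forall>r\<ge>m+2. R' r = R r))"
    by simp
  then show ?thesis unfolding call_update_def seqs.simps
    using r W_ge[OF n] by (intro halts_Seq_step halts_SetConst halts_Store) simp_all
qed

text \<open>\<open>swap\<close> separates the selection of columns, with ones at
  \<open>(inp ! k, k)\<close>, from that of rows, with ones at \<open>(k, inp ! k)\<close>.\<close>

definition update_loop :: "nat \<Rightarrow> nat \<Rightarrow> bool \<Rightarrow> prog" where
  "update_loop q b swap = for_loop (m + 5) b (m + 7) (m + 8) (seqs [SetConst (m + 9) q, Input (m + 10) (m + 5),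
     call_update (m + 9) (if swap then m + 10 else m + 5) (if swap then m + 5 else m + 10)])"

definition set_entries :: "nat \<Rightarrow> (nat \<Rightarrow> nat \<times> nat) \<Rightarrow> nat \<Rightarrow> bool mat list \<Rightarrow> bool mat list" where
  "set_entries q pos N As = foldl (\<lambda>As k. set_entry As q (fst (pos k)) (snd (pos k)) True) As [0..<N]"

lemma halts_update_loop:
  fixes swap :: bool and inp :: "nat list"
  assumes n: "0 < n" and ds: "ds_state n As (R, M)" and "q < 5"
    and b: "b \<in> {m + 3, m + 4}" "R b = N" and inp: "length inp = N" "set inp \<subseteq> {..<n}" "N \<le> n"
  defines "pos \<equiv> \<lambda>k. if swap then (inp ! k, k) else (k, inp ! k)"
  shows "halts (W n) inp (update_loop q b swap) (R, M) (4 + N * (13 + 5 * TU n))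
    (\<lambda>(R', M'). ds_state n (set_entries q pos N As) (R', M') \<and>
       R' (m + 2) = R (m + 2) \<and> R' (m + 3) = R (m + 3) \<and> R' (m + 4) = R (m + 4))"
proof -
  define Inv where "Inv k S \<longleftrightarrow> ds_state n (set_entries q pos k As) S \<and>
       fst S (m + 2) = R (m + 2) \<and> fst S (m + 3) = R (m + 3) \<and> fst S (m + 4) = R (m + 4)" for k S
  have nW: "N < W n" using index_less_W[OF n inp(3)] .
  have ds_upd: "ds_state n As' (R'(i := x, j := y), M')" if "ds_state n As' (R', M')" "m \<le> i" "m \<le> j" for As' R' M' i j x y
    using that by (auto simp: ds_state_def represents_def)
  have "halts (W n) inp (update_loop q b swap) (R, M) (4 + N * ((10 + 5 * TU n) + 3)) (Inv N)"
    unfolding update_loop_def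
  proof (rule halts_for_loop)
    show "distinct [m + 5, b, m + 7, m + 8]" using b by auto
    show "1 < W n" using W_ge[OF n] by simp
    show "Inv 0 (R(m + 5 := 0, m + 8 := 1, m + 7 := of_bool (0 < N)), M)"
      using ds by (auto simp: Inv_def set_entries_def ds_state_def represents_def)
  next
    fix k R' M' assume k: "k < N" and R': "R' (m + 5) = k" "R' b = N" "R' (m + 8) = 1" and inv: "Inv k (R', M')"
    let ?R = "R'(m + 9 := q, m + 10 := inp ! k)"
    let ?i = "if swap then m + 10 else m + 5" and ?j = "if swap then m + 5 else m + 10"
    have inpk: "inp ! k < n" using inp k by (auto simp: subset_iff)
    have "ds_state n (set_entries q pos k As) (?R, M')"
      using inv by (intro ds_upd) (auto simp: Inv_def)
    then have "halts (W n) inp (call_update (m + 9) ?i ?j) (?R, M') (8 + 5 * TU n)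
      (\<lambda>(R'', M''). ds_state n (set_entry (set_entries q pos k As) (?R (m + 9)) (?R ?i) (?R ?j) True) (R'', M'')
         \<and> (\<forall>r\<ge>m+2. R'' r = ?R r))"
      using n R' k inp(3) inpk \<open>q < 5\<close> by (intro halts_call_update) auto
    moreover have "set_entry (set_entries q pos k As) (?R (m + 9)) (?R ?i) (?R ?j) True = set_entries q pos (Suc k) As"
      using R' by (simp add: set_entries_def pos_def)
    ultimately have "halts (W n) inp (call_update (m + 9) ?i ?j) (?R, M') (8 + 5 * TU n)
      (\<lambda>(R'', M''). R'' (m + 5) = k \<and> R'' b = N \<and> R'' (m + 8) = 1 \<and>
         (\<forall>x y. Inv (Suc k) (R''(m + 5 := x, m + 7 := y), M'')))"
      by (elim halts_mono) (use R' b inv in \<open>auto simp: Inv_def intro!: ds_upd\<close>)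
    then show "halts (W n) inp (seqs [SetConst (m + 9) q, Input (m + 10) (m + 5), call_update (m + 9) ?i ?j])
      (R', M') (10 + 5 * TU n)
      (\<lambda>(R'', M''). R'' (m + 5) = k \<and> R'' b = N \<and> R'' (m + 8) = 1 \<and>
         (\<forall>x y. Inv (Suc k) (R''(m + 5 := x, m + 7 := y), M'')))"
      unfolding seqs.simps using R' k inp inpk W_ge[OF n] index_less_W[OF n] \<open>q < 5\<close>
      by (intro halts_Seq_step halts_SetConst halts_Input) simp_all
  qed (use nW b in auto)
  then show ?thesis by (rule halts_mono) (auto simp: Inv_def)
qed

definition call_query :: prog where
  "call_query = seqs [SetConst (m + 9) 0, Input (m + 10) (m + 9), SetConst m 0, Store m (m + 10),
     SetConst (m + 9) 1, Input (m + 10) (m + 9), SetConst m 2, Store m (m + 10), sim m pQ]"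

lemma halts_call_query:
  assumes n: "0 < n" and ds: "ds_state n As (R, M)" and ij: "i < n" "j < n"
  shows "halts (W n) [i, j] call_query (R, M) (8 + 5 * TQ n) (\<lambda>S. answer S = of_bool (product5 As $$ (i, j)))"
proof -
  obtain s where s: "reachable c n pI pU pQ As s" "state_below (word_bound c n) s" "represents m s (R, M)"
    using ds unfolding ds_state_def by blast
  have "halts (word_bound c n) [i, j] pQ s (TQ n) (\<lambda>s'. answer s' = of_bool (product5 As $$ (i, j)))"
    using dynamic n s(1) ij unfolding dynamic_product5_def halts_within_eq by blast
  then obtain t s' where s': "exec (word_bound c n) [i, j] pQ s t s'" "t \<le> TQ n"
    "answer s' = of_bool (product5 As $$ (i, j))"
    unfolding halts_def by blast
  let ?S = "(R(m + 9 := 0, m + 10 := i, m := 0, m + 9 := 1, m + 10 := j, m := 2), M(0 := i, 2 := j))"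
  have "represents m s ?S" using s(3) by (auto simp: represents_def; presburger)
  moreover have "holds_input [i, j] ?S"
    by (auto simp: holds_input_def less_Suc_eq nth_Cons')
  ultimately have "halts (W n) [i, j] (sim m pQ) ?S (5 * t) (\<lambda>S'. represents m s' S' \<and> frame m ?S S')"
    using W_ge[OF n] by (intro sim_correct[OF s'(1) regs(3) s(2)]) auto
  then have "halts (W n) [i, j] (sim m pQ) ?S (5 * TQ n) (\<lambda>S. answer S = of_bool (product5 As $$ (i, j)))"
    by (rule halts_mono) (use s' regs(4) in \<open>auto simp: represents_def answer_def\<close>)
  then show ?thesis unfolding call_query_def seqs.simps
    using ij W_ge[OF n] index_less_W[OF n]
    by (intro halts_Seq_step halts_SetConst halts_Input halts_Store) simp_all
qed


text \<open>Copies a \<open>b / w \<times> w\<close> matrix from the input position in register \<open>m + 12\<close> into the even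
  cells, as the upper left block of the \<open>n \<times> n\<close> matrix at the position in register \<open>m + 11\<close>.\<close>

definition copy_loop :: prog where
  "copy_loop = for_loop (m + 5) (m + 6) (m + 7) (m + 8) (seqs [
     Arith (m + 14) Div (m + 5) (m + 13), Arith (m + 14) Times (m + 14) (m + 2),
     Arith (m + 15) Mod (m + 5) (m + 13), Arith (m + 14) Plus (m + 14) (m + 15),
     Arith (m + 14) Plus (m + 14) (m + 11), Arith (m + 14) Plus (m + 14) (m + 14),
     Arith (m + 15) Plus (m + 5) (m + 12), Input (m + 15) (m + 15), Store (m + 14) (m + 15)])"

lemma halts_copy_loop:
  assumes n: "0 < n" and R: "R (m + 2) = n" "R (m + 6) = N" "R (m + 11) = D" "R (m + 12) = S" "R (m + 13) = w"
    and N: "N = ht * w" "ht \<le> n" "0 < w" "w \<le> n"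
    and inp: "S + N \<le> length inp" "\<And>k. k < N \<Longrightarrow> inp ! (S + k) < W n"
    and bounds: "D \<le> 10 * (n * n) + 10" "S \<le> 10 * (n * n) + 10"
  shows "halts (W n) inp copy_loop (R, M) (4 + N * 12) (\<lambda>(R', M').
    (\<forall>r. r \<notin> {m + 5, m + 7, m + 8, m + 14, m + 15} \<longrightarrow> R' r = R r) \<and>
    (\<forall>i<n. \<forall>j<n. M' (2 * (D + i * n + j)) =
       (if i < ht \<and> j < w then inp ! (S + i * w + j) else M (2 * (D + i * n + j)))) \<and>
    (\<forall>a. a < 2 * D \<or> 2 * (D + n * n) \<le> a \<or> odd a \<longrightarrow> M' a = M a))"
proof -
  define dst where "dst k = D + k div w * n + k mod w" for k
  define Inv where "Inv k S' \<longleftrightarrow> (\<forall>r. r \<notin> {m + 5, m + 7, m + 8, m + 14, m + 15} \<longrightarrow> fst S' r = R r) \<and>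
    (\<forall>l<k. snd S' (2 * dst l) = inp ! (S + l)) \<and> (\<forall>a. (\<forall>l<k. a \<noteq> 2 * dst l) \<longrightarrow> snd S' a = M a)" for k S'
  have mod_less: "k mod w < n" for k using N mod_less_divisor[of w k] by linarith
  \<comment> \<open>No later round overwrites a cell written before. Column indices stay below the
    stride \<open>n\<close>, so a target determines its row and column.\<close>
  have dst_inj: "l = k" if "dst l = dst k" for l k
  proof -
    have "l div w * n + l mod w = k div w * n + k mod w" using that by (simp add: dst_def)
    then have "(l div w * n + l mod w) div n = (k div w * n + k mod w) div n"
      "(l div w * n + l mod w) mod n = (k div w * n + k mod w) mod n" by simp_all
    then have "l div w = k div w" "l mod w = k mod w" using mod_less n by simp_all
    then show "l = k" by (metis div_mult_mod_eq)
  qed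
  have div_less: "k div w < n" if "k < N" for k
    using that N by (simp add: less_mult_imp_div_less order_less_le_trans[of _ ht])
  have dst_less: "k div w * n + k mod w < n * n" if "k < N" for k
    using row_major_less[OF div_less[OF that] mod_less] .
  have Nn: "N \<le> n * n" unfolding N(1) using N by (intro mult_mono) auto
  have "halts (W n) inp copy_loop (R, M) (4 + N * (9 + 3)) (Inv N)"
    unfolding copy_loop_def
  proof (rule halts_for_loop)
    show "N < W n" using less_W[OF n] Nn by simp
    show "Inv 0 (R(m + 5 := 0, m + 8 := 1, m + 7 := of_bool (0 < N)), M)" by (simp add: Inv_def)
  next
    fix k R' M' assume k: "k < N" and R': "R' (m + 5) = k" "R' (m + 6) = N" "R' (m + 8) = 1" and inv: "Inv k (R', M')"
    have regs: "R' (m + 2) = n" "R' (m + 11) = D" "R' (m + 12) = S" "R' (m + 13) = w"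
      using inv R by (auto simp: Inv_def)
    have b: "k div w < W n" "k mod w < W n"
      using div_less[OF k] mod_less[of k] index_less_W[OF n] by simp_all
    have b': "k div w * n < W n" "k div w * n + k mod w < W n" "k div w * n + k mod w + D < W n"
      "k div w * n + k mod w + D + (k div w * n + k mod w + D) < W n" "k + S < W n"
      using dst_less[OF k] bounds k Nn by - (rule less_W[OF n], linarith)+
    have b'': "inp ! (k + S) < W n" using inp(2)[OF k] by (simp add: add.commute)
    have eq: "k div w * n + k mod w + D + (k div w * n + k mod w + D) = 2 * dst k" by (simp add: dst_def)
    let ?body = "seqs [
     Arith (m + 14) Div (m + 5) (m + 13), Arith (m + 14) Times (m + 14) (m + 2),
     Arith (m + 15) Mod (m + 5) (m + 13), Arith (m + 14) Plus (m + 14) (m + 15),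
     Arith (m + 14) Plus (m + 14) (m + 11), Arith (m + 14) Plus (m + 14) (m + 14),
     Arith (m + 15) Plus (m + 5) (m + 12), Input (m + 15) (m + 15), Store (m + 14) (m + 15)]"
    have kS: "k + S < length inp" using inp(1) k by simp
    have "halts (W n) inp ?body (R', M') 9 (\<lambda>(R'', M''). (\<forall>r. r \<notin> {m + 14, m + 15} \<longrightarrow> R'' r = R' r) \<and>
        M'' = M'(k div w * n + k mod w + D + (k div w * n + k mod w + D) := inp ! (k + S)))"
      unfolding seqs.simps
      by (intro halts_Seq_step halts_Arith halts_Input halts_Store)
        (simp_all only: R' regs b b' b'' kS fun_upd_apply binop_val.simps prod.case insert_iff empty_iff
          add_left_cancel numeral_eq_iff num.simps if_True if_False simp_thms, simp_all)
    then show "halts (W n) inp ?body (R', M') 9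
     (\<lambda>(R'', M''). R'' (m + 5) = k \<and> R'' (m + 6) = N \<and> R'' (m + 8) = 1 \<and>
         (\<forall>x y. Inv (Suc k) (R''(m + 5 := x, m + 7 := y), M'')))"
      unfolding eq
    proof (rule halts_mono[OF _ order_refl]; clarify)
      fix R'' assume R'': "\<forall>r. r \<notin> {m + 14, m + 15} \<longrightarrow> R'' r = R' r"
      have "(M'(2 * dst k := inp ! (k + S))) (2 * dst l) = inp ! (S + l)" if "l < Suc k" for l
        using inv that dst_inj[of l k] by (cases "l = k") (auto simp: Inv_def add.commute)
      with R'' R' inv show "R'' (m + 5) = k \<and> R'' (m + 6) = N \<and> R'' (m + 8) = 1 \<and>
         (\<forall>x y. Inv (Suc k) (R''(m + 5 := x, m + 7 := y), M'(2 * dst k := inp ! (k + S))))"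
        by (auto simp: Inv_def)
    qed
  qed (use R W_ge[OF n] in auto)
  then have "halts (W n) inp copy_loop (R, M) (4 + N * 12) (Inv N)" by simp
  then show ?thesis
  proof (rule halts_mono[OF _ order_refl]; clarify)
    fix R' M' assume inv: "Inv N (R', M')"
    have "M' (2 * (D + i * n + j)) = (if i < ht \<and> j < w then inp ! (S + i * w + j) else M (2 * (D + i * n + j)))"
      if ij: "i < n" "j < n" for i j
    proof (cases "i < ht \<and> j < w")
      case True
      then have "i * w + j < N"
        unfolding N(1) using mult_right_mono[of "Suc i" ht w] by auto
      moreover have "dst (i * w + j) = D + i * n + j" using True N by (simp add: dst_def)
      ultimately show ?thesis using inv True by (auto simp: Inv_def add.assoc dest!: spec[of _ "i * w + j"])
    next
      case False
      have "2 * (D + i * n + j) \<noteq> 2 * dst l" if l: "l < N" for l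
      proof
        assume "2 * (D + i * n + j) = 2 * dst l"
        moreover have "2 * x = 2 * y \<Longrightarrow> x = y" for x y :: nat by simp
        ultimately have "D + i * n + j = dst l" by blast
        then have "i * n + j = l div w * n + l mod w" by (simp add: dst_def)
        then have "(i * n + j) div n = (l div w * n + l mod w) div n" "(i * n + j) mod n = (l div w * n + l mod w) mod n"
          by simp_all
        then have "i = l div w" "j = l mod w" using ij mod_less[of l] n by simp_all
        with False N l show False by (simp add: less_mult_imp_div_less)
      qed
      then have "M' (2 * (D + i * n + j)) = M (2 * (D + i * n + j))"
        using inv unfolding Inv_def snd_conv by blast
      then show ?thesis unfolding if_not_P[OF False] .
    qed
    moreover have "M' a = M a" if "a < 2 * D \<or> 2 * (D + n * n) \<le> a \<or> odd a" for a
    proof -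
      have "a \<noteq> 2 * dst l" if l: "l < N" for l
        using \<open>a < 2 * D \<or> 2 * (D + n * n) \<le> a \<or> odd a\<close> dst_less[OF l] by (auto simp: dst_def)
      with inv show ?thesis by (auto simp: Inv_def)
    qed
    ultimately show "(\<forall>r. r \<notin> {m + 5, m + 7, m + 8, m + 14, m + 15} \<longrightarrow> R' r = R r) \<and>
    (\<forall>i<n. \<forall>j<n. M' (2 * (D + i * n + j)) =
       (if i < ht \<and> j < w then inp ! (S + i * w + j) else M (2 * (D + i * n + j)))) \<and>
    (\<forall>a. a < 2 * D \<or> 2 * (D + n * n) \<le> a \<or> odd a \<longrightarrow> M' a = M a)"
      using inv by (simp add: Inv_def)
  qed
qed

text \<open>Cell \<open>2 * p\<close> stands for position \<open>p\<close> of the input of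
  \<open>pI\<close>: first \<open>n\<close>, then five row-major blocks. \<open>K\<close> collects
  the blocks copied so far; the others are still zero.\<close>

definition encoded :: "nat \<Rightarrow> bool mat list \<Rightarrow> nat set \<Rightarrow> (nat \<Rightarrow> nat) \<Rightarrow> bool" where
  "encoded n As K M \<longleftrightarrow> (\<forall>a. odd a \<longrightarrow> M a = 0) \<and> M 0 = n \<and>
     (\<forall>q<5. \<forall>i<n. \<forall>j<n. M (2 * (1 + q * (n * n) + i * n + j)) = (if q \<in> K then of_bool (As ! q $$ (i, j)) else 0))"

lemma encoded_insert:
  assumes enc: "encoded n As K M" and q: "q < 5" "q \<notin> K" and D: "D = 1 + q * (n * n)"
    and block: "\<And>i j. i < n \<Longrightarrow> j < n \<Longrightarrow> M' (2 * (D + i * n + j)) =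
       (if i < h \<and> j < w then inp ! (S + i * w + j) else M (2 * (D + i * n + j)))"
    and other: "\<And>a. a < 2 * D \<or> 2 * (D + n * n) \<le> a \<or> odd a \<Longrightarrow> M' a = M a"
    and entry: "\<And>i j. i < n \<Longrightarrow> j < n \<Longrightarrow>
       of_bool (As ! q $$ (i, j)) = (if i < h \<and> j < w then inp ! (S + i * w + j) else 0)"
  shows "encoded n As (insert q K) M'"
  unfolding encoded_def
proof (intro conjI allI impI)
  show "M' a = 0" if "odd a" for a using other[of a] enc that by (auto simp: encoded_def)
  show "M' 0 = n" using other[of 0] enc D by (auto simp: encoded_def)
  fix q' i j :: nat assume q': "q' < 5" and ij: "i < n" "j < n"
  let ?a = "2 * (1 + q' * (n * n) + i * n + j)"
  have M: "M ?a = (if q' \<in> K then of_bool (As ! q' $$ (i, j)) else 0)"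
    using enc q' ij by (auto simp: encoded_def)
  show "M' ?a = (if q' \<in> insert q K then of_bool (As ! q' $$ (i, j)) else 0)"
  proof (cases "q' = q")
    case True
    then show ?thesis using block[OF ij] entry[OF ij] M q by (auto simp: D)
  next
    case False
    have "?a < 2 * D \<or> 2 * (D + n * n) \<le> ?a"
    proof (cases "q' < q")
      case True
      then have "Suc q' * (n * n) \<le> q * (n * n)" by (intro mult_right_mono) auto
      then show ?thesis using row_major_less[OF ij] by (auto simp: D)
    next
      case False
      then have "Suc q * (n * n) \<le> q' * (n * n)" using \<open>q' \<noteq> q\<close> by (intro mult_right_mono) auto
      then show ?thesis by (auto simp: D)
    qed
    then have "M' ?a = M ?a" by (intro other) blast
    with False M show ?thesis by simp
  qed
qed

text \<open>The selection matrices, blocks 1 and 3, are never copied: untouched memory already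
  encodes zero matrices.\<close>

lemma encoded_holds_input:
  assumes n: "0 < n" and enc: "encoded n As {0, 2, 4} M" and As: "As \<in> five_matrices n"
    and zero: "\<And>i j. i < n \<Longrightarrow> j < n \<Longrightarrow> \<not> As ! 1 $$ (i, j) \<and> \<not> As ! 3 $$ (i, j)"
  shows "holds_input ([n] @ concat (map bits As)) (R, M)"
proof -
  have len: "length As = 5" "\<And>q. q < 5 \<Longrightarrow> As ! q \<in> carrier_mat n n"
    using As by (auto simp: five_matrices_def subset_iff)
  have lb: "length xs = n * n" if "xs \<in> set (map bits As)" for xs
  proof -
    from that obtain A where "A \<in> set As" "xs = bits A" by auto
    then show ?thesis using As length_entries[of A n n] by (auto simp: bits_def five_matrices_def)
  qed
  have "M (2 * k) = ([n] @ concat (map bits As)) ! k" if k: "k < length ([n] @ concat (map bits As))" for k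
  proof (cases k)
    case 0
    then show ?thesis using enc by (simp add: encoded_def)
  next
    case (Suc a)
    have "length (concat (map bits As)) = 5 * (n * n)"
      using length_concat_uniform[of "map bits As" "n * n", OF lb] len(1) by simp
    with k Suc have a: "a < 5 * (n * n)" by simp
    define q r where "q = a div (n * n)" and "r = a mod (n * n)"
    have qr: "q < 5" "r < n * n" using a n unfolding q_def r_def by (simp_all add: less_mult_imp_div_less)
    have a_eq: "a = q * (n * n) + r" unfolding q_def r_def by (rule div_mult_mod_eq[symmetric])
    define i j where "i = r div n" and "j = r mod n"
    have ij: "i < n" "j < n" "r = i * n + j"
      using qr(2) n by (auto simp: i_def j_def less_mult_imp_div_less)
    have "concat (map bits As) ! a = bits (As ! q) ! r"
      unfolding a_eq using concat_nth_uniform[of "map bits As" "n * n" q r, OF lb] qr len(1) by simp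
    also have "\<dots> = of_bool (As ! q $$ (i, j))"
      unfolding bits_def ij(3) using nth_entries[OF len(2)[OF qr(1)] ij(1,2)] length_entries[OF len(2)[OF qr(1)]]
        row_major_less[OF ij(1,2)] by simp
    also have "\<dots> = M (2 * (1 + q * (n * n) + i * n + j))"
    proof -
      have "q \<in> {0, 2, 4} \<or> q = 1 \<or> q = 3" using qr(1) by auto
      then show ?thesis using enc qr(1) ij(1,2) zero[OF ij(1,2)] unfolding encoded_def by auto
    qed
    finally show ?thesis by (simp add: Suc a_eq ij(3) add.assoc)
  qed
  then show ?thesis by (simp add: holds_input_def)
qed

text \<open>Register \<open>m + 9\<close> ends as 0, so that adding it is a register move. The
  source starts at 3, behind the sizes, and the target at 1, behind \<open>n\<close>.\<close>

definition load_sizes :: prog where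
  "load_sizes = seqs [SetConst (m + 9) 0, Input (m + 2) (m + 9), SetConst (m + 9) 1, Input (m + 3) (m + 9),
     SetConst (m + 9) 2, Input (m + 4) (m + 9), SetConst (m + 9) 0, Store (m + 9) (m + 2),
     SetConst (m + 11) 1, SetConst (m + 12) 3, Arith (m + 13) Plus (m + 3) (m + 9), Arith (m + 6) Times (m + 2) (m + 3)]"

text \<open>The source advances by the block just read, before its length is replaced; the target
  advances by two full blocks and so skips a selection matrix.\<close>

definition prepare_N :: prog where
  "prepare_N = seqs [Arith (m + 12) Plus (m + 12) (m + 6), Arith (m + 6) Times (m + 2) (m + 2),
     Arith (m + 11) Plus (m + 11) (m + 6), Arith (m + 11) Plus (m + 11) (m + 6), Arith (m + 13) Plus (m + 2) (m + 9)]"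

definition prepare_V :: prog where
  "prepare_V = seqs [Arith (m + 12) Plus (m + 12) (m + 6), Arith (m + 11) Plus (m + 11) (m + 6),
     Arith (m + 11) Plus (m + 11) (m + 6), Arith (m + 6) Times (m + 4) (m + 2)]"

definition preprocess :: prog where
  "preprocess = seqs [load_sizes, copy_loop, prepare_N, copy_loop, prepare_V, copy_loop, sim m pI]"

definition initial_matrices :: "nat \<Rightarrow> bool mat \<Rightarrow> bool mat \<Rightarrow> bool mat \<Rightarrow> bool mat list" where
  "initial_matrices n U N V =
     [mat n n (\<lambda>(i, j). j < dim_col U \<and> U $$ (i, j)), mat n n (\<lambda>_. False), N, mat n n (\<lambda>_. False),
      mat n n (\<lambda>(i, j). i < dim_row V \<and> V $$ (i, j))]"

lemma halts_SeqI:
  "halts w inp p s T1 P \<Longrightarrow> (\<And>s'. P s' \<Longrightarrow> halts w inp q s' T2 Q) \<Longrightarrow> T1 + T2 \<le> T \<Longrightarrow> halts w inp (Seq p q) s T Q"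
  by (rule halts_Seq[of _ _ _ _ T1 _ T2]) (auto elim: halts_mono)

lemma halts_preprocess:
  assumes n: "0 < n" and t: "0 < t1" "t1 \<le> n" "t2 \<le> n"
    and U: "U \<in> carrier_mat n t1" and N: "N \<in> carrier_mat n n" and V: "V \<in> carrier_mat t2 n"
  shows "halts (W n) ([n, t1, t2] @ bits U @ bits N @ bits V) preprocess init_state (40 + 36 * (n * n) + 5 * TI n)
    (\<lambda>S. ds_state n (initial_matrices n U N V) S \<and> fst S (m + 2) = n \<and> fst S (m + 3) = t1 \<and> fst S (m + 4) = t2)"
proof -
  let ?inp = "[n, t1, t2] @ bits U @ bits N @ bits V" and ?As = "initial_matrices n U N V"
  have len: "length (bits U) = n * t1" "length (bits N) = n * n" "length (bits V) = t2 * n"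
    using U N V by (auto simp: bits_def length_entries)
  have t1n: "n * t1 \<le> n * n" and t2n: "t2 * n \<le> n * n" using t by (auto intro: mult_mono)
  have inp_U: "?inp ! (3 + i * t1 + j) = of_bool (U $$ (i, j))" if "i < n" "j < t1" for i j
    using nth_entries[OF U that] row_major_less[OF that] length_entries[OF U]
    by (simp add: bits_def nth_append add.assoc)
  have inp_N: "?inp ! (3 + n * t1 + i * n + j) = of_bool (N $$ (i, j))" if "i < n" "j < n" for i j
    using nth_entries[OF N that] row_major_less[OF that] length_entries[OF N] length_entries[OF U]
    by (simp add: bits_def nth_append add.assoc)
  have inp_V: "?inp ! (3 + n * t1 + n * n + i * n + j) = of_bool (V $$ (i, j))" if "i < t2" "j < n" for i j
    using nth_entries[OF V that] row_major_less[OF that] length_entries[OF N] length_entries[OF U] length_entries[OF V]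
    by (simp add: bits_def nth_append add.assoc)
  have "x \<le> n" if "x \<in> set ?inp" for x using that n t by (auto simp: bits_def)
  then have inp_W: "?inp ! k < W n" if "k < length ?inp" for k
    using that nth_mem[OF that] index_less_W[OF n] by blast
  \<comment> \<open>Registers below \<open>m\<close> stay zero, and by \<open>encoded\<close> so do
    the odd cells; hence the simulated \<open>pI\<close> starts in
    \<open>init_state\<close>.\<close>
  define base where "base R \<longleftrightarrow> R (m + 2) = n \<and> R (m + 3) = t1 \<and> R (m + 4) = t2 \<and> R (m + 9) = 0 \<and> (\<forall>r<m. R r = 0)" for R
  define P where "P K D S w N' = (\<lambda>(R, M). base R \<and> R (m + 11) = D \<and> R (m + 12) = S \<and> R (m + 13) = w \<and> R (m + 6) = N' \<and>
      encoded n ?As K M)" for K D S w N'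
  have Wn: "n < W n" "t1 < W n" "t2 < W n" using index_less_W[OF n] t by auto
  have WQ: "n * t1 < W n" "n * n < W n" "t2 * n < W n" "3 + n * t1 < W n" "3 + n * t1 + n * n < W n"
    "1 + n * n < W n" "1 + n * n + n * n < W n" "1 + 2 * (n * n) + n * n < W n" "1 + 2 * (n * n) + n * n + n * n < W n"
    using t1n t2n by - (rule less_W[OF n], linarith)+
  have A: "halts (W n) ?inp load_sizes init_state 12 (P {} 1 3 t1 (n * t1))"
    unfolding load_sizes_def seqs.simps init_state_def using W_ge[OF n] Wn WQ
    by (intro halts_Seq_step halts_SetConst halts_Input halts_Store halts_Arith)
      (simp_all add: P_def base_def encoded_def)
  have B: "halts (W n) ?inp copy_loop (R, M) (4 + N' * 12) (P (insert q K) D S w N')"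
    if "P K D S w N' (R, M)" "N' = h * w" "h \<le> n" "0 < w" "w \<le> n" "S + N' \<le> length ?inp"
      "D = 1 + q * (n * n)" "q < 5" "q \<notin> K" "S \<le> 10 * (n * n) + 10"
      "\<And>i j. i < n \<Longrightarrow> j < n \<Longrightarrow>
         of_bool (?As ! q $$ (i, j)) = (if i < h \<and> j < w then ?inp ! (S + i * w + j) else 0)"
    for R M q K D S w N' h
  proof (rule halts_mono[OF halts_copy_loop[where R = R and M = M and N = N' and D = D and S = S and w = w and ht = h] order_refl])
    have "q * (n * n) \<le> 5 * (n * n)" using that(8) by (intro mult_right_mono) auto
    then show "D \<le> 10 * (n * n) + 10" using that(7) by linarith
  next
    fix S' assume "case S' of (R', M') \<Rightarrow>
      (\<forall>r. r \<notin> {m + 5, m + 7, m + 8, m + 14, m + 15} \<longrightarrow> R' r = R r) \<and>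
      (\<forall>i<n. \<forall>j<n. M' (2 * (D + i * n + j)) =
         (if i < h \<and> j < w then ?inp ! (S + i * w + j) else M (2 * (D + i * n + j)))) \<and>
      (\<forall>a. a < 2 * D \<or> 2 * (D + n * n) \<le> a \<or> odd a \<longrightarrow> M' a = M a)"
    then obtain R' M' where S': "S' = (R', M')" and R': "\<forall>r. r \<notin> {m + 5, m + 7, m + 8, m + 14, m + 15} \<longrightarrow> R' r = R r"
      and M': "\<And>i j. i < n \<Longrightarrow> j < n \<Longrightarrow> M' (2 * (D + i * n + j)) =
         (if i < h \<and> j < w then ?inp ! (S + i * w + j) else M (2 * (D + i * n + j)))"
        "\<And>a. a < 2 * D \<or> 2 * (D + n * n) \<le> a \<or> odd a \<Longrightarrow> M' a = M a"
      by (cases S') auto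
    have "encoded n ?As (insert q K) M'"
      using that(1) by (intro encoded_insert[OF _ that(8,9,7) M' that(11)]) (auto simp: P_def)
    then show "P (insert q K) D S w N' S'" using that(1) R' by (auto simp: P_def base_def S')
  qed (use that n inp_W in \<open>auto simp: P_def base_def\<close>)
  have C: "halts (W n) ?inp prepare_N S' 5 (P K (1 + 2 * (n * n)) (3 + n * t1) n (n * n))"
    if "P K 1 3 t1 (n * t1) S'" for S' K
  proof (cases S')
    case (Pair R M)
    show ?thesis unfolding Pair prepare_N_def seqs.simps using that Wn WQ
      by (intro halts_Seq_step halts_Arith) (simp_all add: P_def base_def Pair)
  qed
  have D: "halts (W n) ?inp prepare_V S' 4 (P K (1 + 4 * (n * n)) (3 + n * t1 + n * n) n (t2 * n))"
    if "P K (1 + 2 * (n * n)) (3 + n * t1) n (n * n) S'" for S' K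
  proof (cases S')
    case (Pair R M)
    show ?thesis unfolding Pair prepare_V_def seqs.simps using that Wn WQ
      by (intro halts_Seq_step halts_Arith) (simp_all add: P_def base_def Pair)
  qed
  have E: "halts (W n) ?inp (sim m pI) S' (5 * TI n)
      (\<lambda>S. ds_state n ?As S \<and> fst S (m + 2) = n \<and> fst S (m + 3) = t1 \<and> fst S (m + 4) = t2)"
    if "P {0, 2, 4} D S w N' S'" for D S w N' S'
  proof -
    obtain R M where S': "S' = (R, M)" by (cases S')
    have As: "?As \<in> five_matrices n" using N by (auto simp: five_matrices_def initial_matrices_def)
    then have "halts (word_bound c n) ([n] @ concat (map bits ?As)) pI init_state (TI n) (\<lambda>_. True)"
      using dynamic n unfolding dynamic_product5_def halts_within_eq by blast
    then obtain t s where s: "exec (word_bound c n) ([n] @ concat (map bits ?As)) pI init_state t s" "t \<le> TI n"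
      unfolding halts_def by blast
    have below: "state_below (word_bound c n) init_state" by (simp add: state_below_def init_state_def word_bound_def)
    have "represents m init_state S'"
      using that by (auto simp: P_def base_def S' represents_def init_state_def encoded_def)
    moreover have "holds_input ([n] @ concat (map bits ?As)) S'"
      unfolding S' using that by (intro encoded_holds_input[OF n _ As]) (auto simp: P_def S' initial_matrices_def)
    ultimately have "halts (W n) ?inp (sim m pI) S' (5 * t) (\<lambda>S''. represents m s S'' \<and> frame m S' S'')"
      using W_ge[OF n] by (intro sim_correct[OF s(1) regs(1) below]) auto
    then show ?thesis
      by (rule halts_mono)
        (use s that reachable.init[OF As s(1)] exec_state_below[OF s(1) below] in
          \<open>auto simp: frame_def P_def base_def S' intro: ds_stateI\<close>)
  qed
  have S_le: "3 + n * t1 \<le> 10 * (n * n) + 10" "3 + n * t1 + n * n \<le> 10 * (n * n) + 10"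
    using t1n by linarith+
  have B1: "halts (W n) ?inp copy_loop S' (4 + (n * n) * 12) (P {0} 1 3 t1 (n * t1))"
    if "P {} 1 3 t1 (n * t1) S'" for S'
  proof (cases S')
    case (Pair R M)
    have "halts (W n) ?inp copy_loop (R, M) (4 + (n * t1) * 12) (P (insert 0 {}) 1 3 t1 (n * t1))"
      using that t U inp_U len unfolding Pair
      by (intro B[where h = n]) (auto simp: initial_matrices_def)
    then show ?thesis unfolding Pair by (rule halts_mono) (use t1n in auto)
  qed
  have B2: "halts (W n) ?inp copy_loop S' (4 + (n * n) * 12) (P {0, 2} (1 + 2 * (n * n)) (3 + n * t1) n (n * n))"
    if "P {0} (1 + 2 * (n * n)) (3 + n * t1) n (n * n) S'" for S'
  proof (cases S')
    case (Pair R M)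
    have "halts (W n) ?inp copy_loop (R, M) (4 + (n * n) * 12) (P (insert 2 {0}) (1 + 2 * (n * n)) (3 + n * t1) n (n * n))"
      using that t n inp_N len S_le(1) unfolding Pair
      by (intro B[where h = n]) (auto simp: initial_matrices_def)
    then show ?thesis unfolding Pair by (rule halts_mono) (auto simp: insert_commute)
  qed
  have B3: "halts (W n) ?inp copy_loop S' (4 + (n * n) * 12) (P {0, 2, 4} (1 + 4 * (n * n)) (3 + n * t1 + n * n) n (t2 * n))"
    if "P {0, 2} (1 + 4 * (n * n)) (3 + n * t1 + n * n) n (t2 * n) S'" for S'
  proof (cases S')
    case (Pair R M)
    have "halts (W n) ?inp copy_loop (R, M) (4 + (t2 * n) * 12)
        (P (insert 4 {0, 2}) (1 + 4 * (n * n)) (3 + n * t1 + n * n) n (t2 * n))"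
      using that t n inp_V len S_le(2) V unfolding Pair
      by (intro B[where h = t2]) (auto simp: initial_matrices_def)
    then show ?thesis unfolding Pair by (rule halts_mono) (use t2n in \<open>auto simp: insert_commute\<close>)
  qed
  let ?C = "4 + (n * n) * 12"
  have "halts (W n) ?inp preprocess init_state (12 + (?C + (5 + (?C + (4 + (?C + 5 * TI n))))))
    (\<lambda>S. ds_state n ?As S \<and> fst S (m + 2) = n \<and> fst S (m + 3) = t1 \<and> fst S (m + 4) = t2)"
    unfolding preprocess_def seqs.simps
    by (rule halts_SeqI[OF A], rule halts_SeqI[OF B1], assumption, rule halts_SeqI[OF C], assumption,
        rule halts_SeqI[OF B2], assumption, rule halts_SeqI[OF D], assumption,
        rule halts_SeqI[OF B3], assumption, rule E, assumption) (rule order_refl)+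
  then show ?thesis by (rule halts_mono) auto
qed

section \<open>The product after the updates\<close>

lemma set_entries_eq:
  assumes "q < length As" "As ! q \<in> carrier_mat n n"
  shows "set_entries q pos k As = As[q := mat n n (\<lambda>ij. As ! q $$ ij \<or> (\<exists>l<k. ij = pos l))]"
proof (induction k)
  case 0
  have "mat n n (\<lambda>ij. As ! q $$ ij) = As ! q" using assms(2) by auto
  then show ?case by (simp add: set_entries_def)
next
  case (Suc k)
  have "set_entries q pos (Suc k) As = set_entry (set_entries q pos k As) q (fst (pos k)) (snd (pos k)) True"
    by (simp add: set_entries_def)
  also have "\<dots> = As[q := mat n n (\<lambda>ij. As ! q $$ ij \<or> (\<exists>l<Suc k. ij = pos l))]"
  proof -
    have "update_mat (mat n n (\<lambda>ij. As ! q $$ ij \<or> (\<exists>l<k. ij = pos l))) (pos k) True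
        = mat n n (\<lambda>ij. As ! q $$ ij \<or> (\<exists>l<Suc k. ij = pos l))"
      by (rule eq_matI) (simp_all add: update_mat_def less_Suc_eq conj_disj_distribR ex_disj_distrib disj_assoc)
    then show ?thesis using assms(1) unfolding Suc by (simp add: set_entry_def)
  qed
  finally show ?case .
qed

text \<open>Row \<open>s < t1\<close> of the first selection matrix is the unit vector at
  \<open>I ! s\<close> and column \<open>r < t2\<close> of the second is the one at
  \<open>J ! r\<close>; all other rows and columns vanish, as does the padding of \<open>U\<close>
  and \<open>V\<close>.\<close>

lemma product5_final_matrices:
  assumes t: "t1 \<le> n" "t2 \<le> n"
    and U: "U \<in> carrier_mat n t1" and N: "N \<in> carrier_mat n n" and V: "V \<in> carrier_mat t2 n"
    and I: "I \<in> index_vectors n t1" and J: "J \<in> index_vectors n t2" and ij: "i < n" "j < n"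
  shows "product5 (set_entries 3 (\<lambda>k. (J ! k, k)) t2 (set_entries 1 (\<lambda>k. (k, I ! k)) t1 (initial_matrices n U N V))) $$ (i, j)
    \<longleftrightarrow> (U \<odot> submat N I J \<odot> V) $$ (i, j)"
proof -
  have In: "\<And>s. s < t1 \<Longrightarrow> I ! s < n" "length I = t1" and Jn: "\<And>r. r < t2 \<Longrightarrow> J ! r < n" "length J = t2"
    using I J by (auto simp: index_vectors_def subset_iff)
  let ?As = "initial_matrices n U N V"
  let ?S = "mat n n (\<lambda>ij. \<exists>l<t1. ij = (l, I ! l))" and ?R = "mat n n (\<lambda>ij. \<exists>l<t2. ij = (J ! l, l))"
  have *: "mat n n (\<lambda>ij. mat n n (\<lambda>_. False) $$ ij \<or> P ij) = mat n n P" for P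
    by (intro cong_mat) auto
  have "set_entries 1 (\<lambda>k. (k, I ! k)) t1 ?As = ?As[1 := ?S]"
    by (subst set_entries_eq[where n = n]) (simp_all add: initial_matrices_def *)
  then have eq: "set_entries 3 (\<lambda>k. (J ! k, k)) t2 (set_entries 1 (\<lambda>k. (k, I ! k)) t1 ?As) = ?As[1 := ?S, 3 := ?R]"
    by (subst set_entries_eq[where n = n]) (simp_all add: initial_matrices_def * eval_nat_numeral)
  let ?A = "mat n n (\<lambda>(i, j). j < t1 \<and> U $$ (i, j))" and ?B = "mat n n (\<lambda>(i, j). i < t2 \<and> V $$ (i, j))"
  have p5: "product5 (?As[1 := ?S, 3 := ?R]) = ?A \<odot> ?S \<odot> N \<odot> ?R \<odot> ?B"
    using U V by (simp add: product5_def initial_matrices_def eval_nat_numeral)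
  have 1: "(?A \<odot> ?S) $$ (i, r) \<longleftrightarrow> (\<exists>s<t1. U $$ (i, s) \<and> r = I ! s)" if "r < n" for r
  proof -
    have "(?A \<odot> ?S) $$ (i, r) \<longleftrightarrow> (\<exists>s<n. ?A $$ (i, s) \<and> ?S $$ (s, r))" using ij that by (subst index_bmult) auto
    also have "\<dots> \<longleftrightarrow> (\<exists>s<n. (s < t1 \<and> U $$ (i, s)) \<and> (\<exists>l<t1. (s, r) = (l, I ! l)))"
      using ij that by (simp cong: conj_cong)
    also have "\<dots> \<longleftrightarrow> (\<exists>s<t1. U $$ (i, s) \<and> r = I ! s)" using order_less_le_trans[OF _ t(1)] by blast
    finally show ?thesis .
  qed
  have 2: "(?A \<odot> ?S \<odot> N) $$ (i, c) \<longleftrightarrow> (\<exists>s<t1. U $$ (i, s) \<and> N $$ (I ! s, c))" if "c < n" for c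
  proof -
    have "(?A \<odot> ?S \<odot> N) $$ (i, c) \<longleftrightarrow> (\<exists>r<n. (?A \<odot> ?S) $$ (i, r) \<and> N $$ (r, c))"
      using ij that N by (subst index_bmult) auto
    also have "\<dots> \<longleftrightarrow> (\<exists>s<t1. U $$ (i, s) \<and> N $$ (I ! s, c))" using 1 In(1) by blast
    finally show ?thesis .
  qed
  have 3: "(?A \<odot> ?S \<odot> N \<odot> ?R) $$ (i, r) \<longleftrightarrow> r < t2 \<and> (\<exists>s<t1. U $$ (i, s) \<and> N $$ (I ! s, J ! r))" if "r < n" for r
  proof -
    have "(?A \<odot> ?S \<odot> N \<odot> ?R) $$ (i, r) \<longleftrightarrow> (\<exists>c<n. (?A \<odot> ?S \<odot> N) $$ (i, c) \<and> ?R $$ (c, r))"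
      using ij that N by (subst index_bmult) auto
    also have "\<dots> \<longleftrightarrow> (\<exists>c<n. (\<exists>s<t1. U $$ (i, s) \<and> N $$ (I ! s, c)) \<and> (\<exists>l<t2. (c, r) = (J ! l, l)))"
      using 2 that by (simp cong: conj_cong)
    also have "\<dots> \<longleftrightarrow> r < t2 \<and> (\<exists>s<t1. U $$ (i, s) \<and> N $$ (I ! s, J ! r))" using Jn(1) by blast
    finally show ?thesis .
  qed
  have "(?A \<odot> ?S \<odot> N \<odot> ?R \<odot> ?B) $$ (i, j) \<longleftrightarrow> (\<exists>r<n. (?A \<odot> ?S \<odot> N \<odot> ?R) $$ (i, r) \<and> ?B $$ (r, j))"
    using ij by (subst index_bmult) auto
  also have "\<dots> \<longleftrightarrow> (\<exists>r<t2. (\<exists>s<t1. U $$ (i, s) \<and> N $$ (I ! s, J ! r)) \<and> V $$ (r, j))"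
  proof -
    have "(\<exists>r<n. (?A \<odot> ?S \<odot> N \<odot> ?R) $$ (i, r) \<and> ?B $$ (r, j)) \<longleftrightarrow>
       (\<exists>r<n. (r < t2 \<and> (\<exists>s<t1. U $$ (i, s) \<and> N $$ (I ! s, J ! r))) \<and> (r < t2 \<and> V $$ (r, j)))"
      using 3 ij by (simp cong: conj_cong)
    then show ?thesis using order_less_le_trans[OF _ t(2)] by blast
  qed
  also have "\<dots> \<longleftrightarrow> (\<exists>r<t2. (U \<odot> submat N I J) $$ (i, r) \<and> V $$ (r, j))"
  proof -
    have "(U \<odot> submat N I J) $$ (i, r) \<longleftrightarrow> (\<exists>s<t1. U $$ (i, s) \<and> N $$ (I ! s, J ! r))" if "r < t2" for r
    proof -
      have "(U \<odot> submat N I J) $$ (i, r) \<longleftrightarrow> (\<exists>s<t1. U $$ (i, s) \<and> submat N I J $$ (s, r))"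
        using U ij that Jn by (subst index_bmult) (auto simp: submat_def)
      then show ?thesis using that In(2) Jn(2) by (auto simp: submat_def)
    qed
    then show ?thesis by blast
  qed
  also have "\<dots> \<longleftrightarrow> (U \<odot> submat N I J \<odot> V) $$ (i, j)"
    using U V ij Jn by (subst index_bmult) (auto simp: submat_def)
  finally show ?thesis unfolding eq p5 .
qed

text \<open>The postcondition of each phase contains the runs of the next one, so the phases are
  verified backwards.\<close>

lemma solves_hinted_uMv:
  assumes \<tau>: "\<tau>1 \<in> {0<..<1}" "\<tau>2 \<in> {0<..<1}"
  shows "solves_hinted_uMv \<tau>1 \<tau>2 (c + 6) preprocess (update_loop 1 (m + 3) False) (update_loop 3 (m + 4) True) call_query
    (\<lambda>n. 40 + 36 * (n * n) + 5 * TI n) (\<lambda>n. 4 + npow n \<tau>1 * (13 + 5 * TU n))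
    (\<lambda>n. 4 + npow n \<tau>2 * (13 + 5 * TU n)) (\<lambda>n. 8 + 5 * TQ n)"
  unfolding solves_hinted_uMv_def Let_def halts_within_eq W_def[symmetric]
proof (intro allI impI ballI)
  fix n :: nat and U N V :: "bool mat"
  assume n: "0 < n" and U: "U \<in> carrier_mat n (npow n \<tau>1)" and N: "N \<in> carrier_mat n n" and V: "V \<in> carrier_mat (npow n \<tau>2) n"
  let ?t1 = "npow n \<tau>1" and ?t2 = "npow n \<tau>2" and ?As = "initial_matrices n U N V"
  note t = npow_bounds[OF n \<tau>(1)] npow_bounds[OF n \<tau>(2)]
  have 4: "halts (W n) [i, j] call_query s3 (8 + 5 * TQ n)
      (\<lambda>s4. answer s4 = of_bool ((U \<odot> submat N I J \<odot> V) $$ (i, j)))"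
    if I: "I \<in> index_vectors n ?t1" and J: "J \<in> index_vectors n ?t2" and ij: "i < n" "j < n"
      and s3: "ds_state n (set_entries 3 (\<lambda>k. (J ! k, k)) ?t2 (set_entries 1 (\<lambda>k. (k, I ! k)) ?t1 ?As)) s3"
    for I J i j s3
  proof -
    obtain R M where s: "s3 = (R, M)" by (cases s3)
    show ?thesis using halts_call_query[OF n s3[unfolded s] ij]
      unfolding product5_final_matrices[OF t(2,4) U N V I J ij] s .
  qed
  have 3: "halts (W n) J (update_loop 3 (m + 4) True) s2 (4 + ?t2 * (13 + 5 * TU n)) (\<lambda>s3. \<forall>i<n. \<forall>j<n.
      halts (W n) [i, j] call_query s3 (8 + 5 * TQ n) (\<lambda>s4. answer s4 = of_bool ((U \<odot> submat N I J \<odot> V) $$ (i, j))))"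
    if I: "I \<in> index_vectors n ?t1" and J: "J \<in> index_vectors n ?t2"
      and s2: "ds_state n (set_entries 1 (\<lambda>k. (k, I ! k)) ?t1 ?As) s2" "fst s2 (m + 4) = ?t2" for I J s2
  proof -
    obtain R M where s: "s2 = (R, M)" by (cases s2)
    have "halts (W n) J (update_loop 3 (m + 4) True) (R, M) (4 + ?t2 * (13 + 5 * TU n))
      (\<lambda>(R', M'). ds_state n (set_entries 3 (\<lambda>k. if True then (J ! k, k) else (k, J ! k)) ?t2 (set_entries 1 (\<lambda>k. (k, I ! k)) ?t1 ?As)) (R', M') \<and>
       R' (m + 2) = R (m + 2) \<and> R' (m + 3) = R (m + 3) \<and> R' (m + 4) = R (m + 4))"
      using n s2 J t by (intro halts_update_loop) (auto simp: s index_vectors_def)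
    then show ?thesis unfolding s
    proof (rule halts_mono[OF _ order_refl], intro allI impI, goal_cases)
      case (1 s3 i j)
      then show ?case by (intro 4[OF I J]) (cases s3; simp)+
    qed
  qed
  have 2: "halts (W n) I (update_loop 1 (m + 3) False) s1 (4 + ?t1 * (13 + 5 * TU n)) (\<lambda>s2. \<forall>J\<in>index_vectors n ?t2.
      halts (W n) J (update_loop 3 (m + 4) True) s2 (4 + ?t2 * (13 + 5 * TU n)) (\<lambda>s3. \<forall>i<n. \<forall>j<n.
      halts (W n) [i, j] call_query s3 (8 + 5 * TQ n) (\<lambda>s4. answer s4 = of_bool ((U \<odot> submat N I J \<odot> V) $$ (i, j)))))"
    if I: "I \<in> index_vectors n ?t1" and s1: "ds_state n ?As s1" "fst s1 (m + 3) = ?t1" "fst s1 (m + 4) = ?t2" for I s1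
  proof -
    obtain R M where s: "s1 = (R, M)" by (cases s1)
    have "halts (W n) I (update_loop 1 (m + 3) False) (R, M) (4 + ?t1 * (13 + 5 * TU n))
      (\<lambda>(R', M'). ds_state n (set_entries 1 (\<lambda>k. if False then (I ! k, k) else (k, I ! k)) ?t1 ?As) (R', M') \<and>
       R' (m + 2) = R (m + 2) \<and> R' (m + 3) = R (m + 3) \<and> R' (m + 4) = R (m + 4))"
      using n s1 I t by (intro halts_update_loop) (auto simp: s index_vectors_def)
    then show ?thesis unfolding s
    proof (rule halts_mono[OF _ order_refl], intro ballI, goal_cases)
      case (1 s2 J)
      then show ?case using s1(3) by (intro 3[OF I]) (cases s2; simp add: s)+
    qed
  qed
  show "halts (W n) ([n, ?t1, ?t2] @ bits U @ bits N @ bits V) preprocess init_state (40 + 36 * (n * n) + 5 * TI n)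
    (\<lambda>s1. \<forall>I\<in>index_vectors n ?t1. halts (W n) I (update_loop 1 (m + 3) False) s1 (4 + ?t1 * (13 + 5 * TU n))
      (\<lambda>s2. \<forall>J\<in>index_vectors n ?t2.
      halts (W n) J (update_loop 3 (m + 4) True) s2 (4 + ?t2 * (13 + 5 * TU n)) (\<lambda>s3. \<forall>i<n. \<forall>j<n.
      halts (W n) [i, j] call_query s3 (8 + 5 * TQ n) (\<lambda>s4. answer s4 = of_bool ((U \<odot> submat N I J \<odot> V) $$ (i, j))))))"
    using halts_preprocess[OF n t(1,2,4) U N V]
  proof (rule halts_mono[OF _ order_refl], intro ballI, goal_cases)
    case (1 s1 I)
    then show ?case by (intro 2) auto
  qed
qed

end

section \<open>From running times to the lower bound\<close>

lemma exec_time_pos: "exec W inp p s t s' \<Longrightarrow> 1 \<le> t"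
  by (induction rule: exec.induct) auto

text \<open>Lets the additive overhead of the reduction be absorbed into multiples of
  \<open>TU\<close> and \<open>TQ\<close>.\<close>

lemma dynamic_product5_times_pos:
  assumes "dynamic_product5 c pI pU pQ TI TU TQ" "0 < n"
  shows "1 \<le> TU n" "1 \<le> TQ n"
proof -
  let ?As = "replicate 5 (mat n n (\<lambda>_. False))"
  have As: "?As \<in> five_matrices n" by (auto simp: five_matrices_def)
  have "halts_within c n ([n] @ concat (map bits ?As)) pI init_state (TI n) (\<lambda>_. True)"
    using assms As unfolding dynamic_product5_def by blast
  then obtain t s where "exec (word_bound c n) ([n] @ concat (map bits ?As)) pI init_state t s"
    unfolding halts_within_def by blast
  then have r: "reachable c n pI pU pQ ?As s" by (rule reachable.init[OF As])
  have "0 < (5::nat)" by simp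
  then have "halts_within c n [0, 0, 0, of_bool True] pU s (TU n) (\<lambda>_. True)"
    using assms r unfolding dynamic_product5_def by blast
  then obtain t s' where "exec (word_bound c n) [0, 0, 0, of_bool True] pU s t s'" "t \<le> TU n"
    unfolding halts_within_def by blast
  with exec_time_pos[OF this(1)] show "1 \<le> TU n" by simp
  have "halts_within c n [0, 0] pQ s (TQ n) (\<lambda>s'. answer s' = of_bool (product5 ?As $$ (0, 0)))"
    using assms r unfolding dynamic_product5_def by blast
  then obtain t s' where "exec (word_bound c n) [0, 0] pQ s t s'" "t \<le> TQ n"
    unfolding halts_within_def by blast
  with exec_time_pos[OF this(1)] show "1 \<le> TQ n" by simp
qed

lemma polynomially_bounded_preprocessing:
  assumes "polynomially_bounded T"
  shows "polynomially_bounded (\<lambda>n. 40 + 36 * (n * n) + 5 * T n)"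
proof -
  obtain k where "(\<lambda>n. real (T n)) \<in> O(\<lambda>n. real n ^ k)"
    using assms unfolding polynomially_bounded_def by blast
  then obtain C where C: "C > 0" "\<forall>\<^sub>F n in at_top. real (T n) \<le> C * real n ^ k" by (elim landau_o.bigE) auto
  have "(\<lambda>n. real (40 + 36 * (n * n) + 5 * T n)) \<in> O(\<lambda>n. real n ^ (k + 2))"
  proof (rule bigoI[of _ "76 + 5 * C"])
    show "\<forall>\<^sub>F n in at_top. norm (real (40 + 36 * (n * n) + 5 * T n)) \<le> (76 + 5 * C) * norm (real n ^ (k + 2))"
      using C(2) eventually_ge_at_top[of 1]
    proof eventually_elim
      case (elim n)
      then have n: "1 \<le> real n" by simp
      have "1 \<le> real n ^ (k + 2)" "real n ^ 2 \<le> real n ^ (k + 2)" "real n ^ k \<le> real n ^ (k + 2)"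
        using n by (intro one_le_power power_increasing; simp)+
      moreover from this(3) have "C * real n ^ k \<le> C * real n ^ (k + 2)" using C(1) by (intro mult_left_mono) auto
      moreover have "real (40 + 36 * (n * n) + 5 * T n) = 40 + 36 * real n ^ 2 + 5 * real (T n)"
        by (simp add: power2_eq_square)
      moreover have "(76 + 5 * C) * norm (real n ^ (k + 2)) = 76 * real n ^ (k + 2) + 5 * (C * real n ^ (k + 2))"
        by (simp add: algebra_simps)
      ultimately show ?case using elim(1) by simp
    qed
  qed
  then show ?thesis unfolding polynomially_bounded_def by blast
qed

text \<open>Divides the time of a phase by its \<open>n powr \<tau>\<close> operations. The 22 = 4 +
  13 + 5 collects the constants of an update phase.\<close>

lemma powr_le_of_mult_powr_le:
  fixes n :: nat
  assumes "1 \<le> n" "x \<le> w - \<tau>" "0 < C" "C * real n powr (w - \<epsilon>) \<le> 22 * (real n powr \<tau> * y)"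
  shows "C / 22 * real n powr (x - \<epsilon>) \<le> y"
proof -
  have "real n powr (x - \<epsilon>) * real n powr \<tau> \<le> real n powr (w - \<epsilon>)"
    unfolding powr_add[symmetric] using assms(1,2) by (intro powr_mono) auto
  then have "C * (real n powr (x - \<epsilon>) * real n powr \<tau>) \<le> C * real n powr (w - \<epsilon>)"
    using assms(3) by (intro mult_left_mono) auto
  with assms(4) have "real n powr \<tau> * (C * real n powr (x - \<epsilon>)) \<le> real n powr \<tau> * (22 * y)"
    by (simp add: mult_ac)
  then have "C * real n powr (x - \<epsilon>) \<le> 22 * y" using assms(1) by (subst (asm) mult_le_cancel_left_pos) auto
  then show ?thesis by simp
qed

lemma product5_lower_bound_at:
  assumes conj: hinted_uMv_conjecture
    and dyn: "dynamic_product5 c pI pU pQ TI TU TQ" and poly: "polynomially_bounded TI"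
    and \<tau>: "\<tau>1 \<in> {0<..<1}" "\<tau>2 \<in> {0<..<1}" and "0 < \<epsilon>"
    and x: "x \<le> omega 1 \<tau>1 1 - \<tau>1" "x \<le> omega \<tau>2 \<tau>1 1 - \<tau>2" "x \<le> \<tau>1 + \<tau>2"
  shows "(\<lambda>n. real (max (TU n) (TQ n))) \<in> \<Omega>(\<lambda>n. real n powr (x - \<epsilon>))"
proof -
  \<comment> \<open>\<open>insert 0\<close> keeps the set nonempty. Since \<open>m\<close> is
    positive, register 0 belongs to the simulated program, and its answer is the answer of the
    reduction.\<close>
  define m where "m = Suc (Max (insert 0 (regs pI \<union> regs pU \<union> regs pQ)))"
  have "r < m" if "r \<in> regs pI \<union> regs pU \<union> regs pQ" for r
    unfolding m_def less_Suc_eq_le using that by (intro Max_ge) auto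
  then interpret product5_reduction c m pI pU pQ TI TU TQ
    using dyn by unfold_locales (auto simp: m_def)
  let ?M = "\<lambda>n. max (TU n) (TQ n)"
  from conj[unfolded hinted_uMv_conjecture_def, rule_format, OF \<tau> \<open>0 < \<epsilon>\<close>, OF conjI,
      OF solves_hinted_uMv[OF \<tau>] polynomially_bounded_preprocessing[OF poly]]
  obtain C where C: "C > 0" "\<forall>\<^sub>F n in at_top.
      C * real n powr (omega 1 \<tau>1 1 - \<epsilon>) \<le> real (4 + npow n \<tau>1 * (13 + 5 * TU n)) \<or>
      C * real n powr (omega \<tau>2 \<tau>1 1 - \<epsilon>) \<le> real (4 + npow n \<tau>2 * (13 + 5 * TU n)) \<or>
      C * real n powr (\<tau>1 + \<tau>2 - \<epsilon>) \<le> real (8 + 5 * TQ n)" by blast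
  have upd: "real (4 + npow n \<tau> * (13 + 5 * TU n)) \<le> 22 * (real n powr \<tau> * real (?M n))"
    if n: "1 \<le> n" and \<tau>: "\<tau> \<in> {0<..<1}" for n \<tau>
  proof -
    have pos: "1 \<le> npow n \<tau>" "1 \<le> TU n"
      using npow_bounds(1)[of n \<tau>] dynamic_product5_times_pos(1)[OF dyn, of n] n \<tau> by auto
    then have "1 \<le> npow n \<tau> * TU n" "npow n \<tau> \<le> npow n \<tau> * TU n" by auto
    moreover have "4 + npow n \<tau> * (13 + 5 * TU n) = 4 + 13 * npow n \<tau> + 5 * (npow n \<tau> * TU n)"
      by (simp add: algebra_simps)
    ultimately have "4 + npow n \<tau> * (13 + 5 * TU n) \<le> 22 * (npow n \<tau> * TU n)" by linarith
    then have "real (4 + npow n \<tau> * (13 + 5 * TU n)) \<le> real (22 * (npow n \<tau> * TU n))"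
      by (rule of_nat_mono)
    also have "\<dots> = 22 * (real (npow n \<tau>) * real (TU n))" by simp
    also have "\<dots> \<le> 22 * (real n powr \<tau> * real (?M n))"
      by (intro mult_left_mono mult_mono npow_le) auto
    finally show ?thesis .
  qed
  have "\<forall>\<^sub>F n in at_top. C / 22 * norm (real n powr (x - \<epsilon>)) \<le> norm (real (?M n))"
    using C(2) eventually_ge_at_top[of 1]
  proof eventually_elim
    case (elim n)
    have "C / 22 * real n powr (x - \<epsilon>) \<le> real (?M n)"
      using elim(1)
    proof (elim disjE)
      assume "C * real n powr (omega 1 \<tau>1 1 - \<epsilon>) \<le> real (4 + npow n \<tau>1 * (13 + 5 * TU n))"
      then show ?thesis
        using powr_le_of_mult_powr_le[OF elim(2) x(1) C(1)] upd[OF elim(2) \<tau>(1)] order_trans by blast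
    next
      assume "C * real n powr (omega \<tau>2 \<tau>1 1 - \<epsilon>) \<le> real (4 + npow n \<tau>2 * (13 + 5 * TU n))"
      then show ?thesis
        using powr_le_of_mult_powr_le[OF elim(2) x(2) C(1)] upd[OF elim(2) \<tau>(2)] order_trans by blast
    next
      assume *: "C * real n powr (\<tau>1 + \<tau>2 - \<epsilon>) \<le> real (8 + 5 * TQ n)"
      \<comment> \<open>A phase with a single operation is the case of exponent 0.\<close>
      have "real (8 + 5 * TQ n) \<le> 22 * (real n powr 0 * real (?M n))"
        using dynamic_product5_times_pos(2)[OF dyn, of n] elim(2) by simp
      with * show ?thesis
        using powr_le_of_mult_powr_le[of n x "\<tau>1 + \<tau>2" 0 C \<epsilon> "real (?M n)"] elim(2) x(3) C(1) by linarith
    qed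
    then show ?case by simp
  qed
  then show ?thesis using C(1) by (intro landau_omega.bigI[of "C / 22"]) auto
qed

lemma nearly_balanced_omega:
  assumes "0 < \<epsilon>"
  shows "\<exists>a\<in>{0<..<1}. \<exists>b\<in>{0<..<1}. \<exists>v.
    \<bar>a + b - v\<bar> \<le> \<epsilon> \<and> \<bar>omega 1 a b - b - v\<bar> \<le> \<epsilon> \<and> \<bar>omega 1 1 a - a - v\<bar> \<le> \<epsilon>"
proof (rule nearly_balanced_interior_point[OF _ _ _ _ _ assms])
  fix a b b' :: real assume ab: "a \<in> {0..1}" "b \<in> {0..1}" "b' \<in> {0..1}" "b \<le> b'"
  show "omega 1 a b \<le> omega 1 a b'" using ab by (intro omega_mono) auto
  show "omega 1 a b' \<le> omega 1 a b + (b' - b)" using omega_add_le[of 1 a b "b' - b"] ab by simp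
next
  fix a b :: real assume ab: "a \<in> {0..1}" "b \<in> {0..1}"
  then show "omega 1 a b = omega 1 b a" by (intro omega_swap) auto
  show "1 + b \<le> omega 1 a b" using ab by (intro omega_ge) auto
  show "omega 1 a b \<le> 1 + a + b" using ab by (intro omega_le) auto
qed

definition balanced_cost :: "nat \<Rightarrow> real \<Rightarrow> real \<Rightarrow> real" where
  "balanced_cost n \<tau>1 \<tau>2 = real n powr (\<tau>1 + \<tau>2) + real n powr (omega 1 \<tau>1 \<tau>2 - \<tau>2)
     + real n powr (omega 1 1 \<tau>1 - \<tau>1)"

lemma product5_lower_bound:
  assumes conj: hinted_uMv_conjecture
    and dyn: "dynamic_product5 c pI pU pQ TI TU TQ" and poly: "polynomially_bounded TI" and "0 < \<epsilon>"
  shows "(\<lambda>n. real (max (TU n) (TQ n))) \<in> \<Omega>(\<lambda>n.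
    (INF (\<tau>1, \<tau>2) \<in> {0<..<1} \<times> {0<..<1}. balanced_cost n \<tau>1 \<tau>2) * real n powr (-\<epsilon>))"
proof -
  \<comment> \<open>One third each for the terms falling below \<open>v\<close>, for the loss in the
    conjecture and for the terms exceeding \<open>v\<close>.\<close>
  define \<delta> where "\<delta> = \<epsilon> / 3"
  have \<delta>: "0 < \<delta>" "\<epsilon> = 3 * \<delta>" using \<open>0 < \<epsilon>\<close> by (auto simp: \<delta>_def)
  obtain a b v where ab: "a \<in> {0<..<1}" "b \<in> {0<..<1}" and bal: "\<bar>a + b - v\<bar> \<le> \<delta>"
    "\<bar>omega 1 a b - b - v\<bar> \<le> \<delta>" "\<bar>omega 1 1 a - a - v\<bar> \<le> \<delta>"
    using nearly_balanced_omega[OF \<delta>(1)] by blast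
  \<comment> \<open>Turns the exponents of the conjecture into those of the bound.\<close>
  have sym: "omega 1 a 1 = omega 1 1 a" "omega b a 1 = omega 1 a b"
    using ab by (auto intro: omega_swap omega_reverse)
  have "(\<lambda>n. real (max (TU n) (TQ n))) \<in> \<Omega>(\<lambda>n. real n powr (v - \<delta> - \<delta>))"
    using bal by (intro product5_lower_bound_at[OF conj dyn poly ab \<delta>(1)]) (auto simp: sym)
  moreover have "(\<lambda>n. (INF (\<tau>1, \<tau>2) \<in> {0<..<1} \<times> {0<..<1}. balanced_cost n \<tau>1 \<tau>2) * real n powr (-\<epsilon>))
      \<in> O(\<lambda>n. real n powr (v - \<delta> - \<delta>))"
  proof (rule bigo_real_leI[of _ 3])
    fix n :: nat assume n: "1 \<le> n"
    let ?F = "\<lambda>(\<tau>1, \<tau>2). balanced_cost n \<tau>1 \<tau>2" and ?S = "{0<..<1} \<times> {0<..<1} :: (real \<times> real) set"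
    have nonneg: "0 \<le> ?F x" for x by (auto simp: balanced_cost_def split: prod.split)
    then have bdd: "bdd_below (?F ` ?S)" by (intro bdd_belowI[of _ 0]) auto
    have "0 \<le> (INF x\<in>?S. ?F x)" using ab nonneg by (intro cINF_greatest) auto
    then show "0 \<le> (INF x\<in>?S. ?F x) * real n powr (-\<epsilon>)" by simp
    have "(INF x\<in>?S. ?F x) \<le> ?F (a, b)" using ab by (intro cINF_lower[OF bdd]) auto
    also have "\<dots> = real n powr (a + b) + real n powr (omega 1 a b - b) + real n powr (omega 1 1 a - a)"
      by (simp add: balanced_cost_def)
    also have "\<dots> \<le> real n powr (v + \<delta>) + real n powr (v + \<delta>) + real n powr (v + \<delta>)"
    proof -
      have "a + b \<le> v + \<delta>" "omega 1 a b - b \<le> v + \<delta>" "omega 1 1 a - a \<le> v + \<delta>" using bal by linarith+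
      from this[THEN powr_mono, of "real n"] show ?thesis using n by simp
    qed
    finally have "(INF x\<in>?S. ?F x) * real n powr (-\<epsilon>) \<le> (3 * real n powr (v + \<delta>)) * real n powr (-\<epsilon>)"
      by (intro mult_right_mono) auto
    also have "\<dots> = 3 * real n powr (v - \<delta> - \<delta>)"
      by (simp add: \<delta>(2) algebra_simps flip: powr_add)
    finally show "(INF x\<in>?S. ?F x) * real n powr (-\<epsilon>) \<le> 3 * real n powr (v - \<delta> - \<delta>)" .
  qed auto
  ultimately show ?thesis unfolding bigomega_iff_bigo by (rule landau_o.big_trans[rotated])
qed

text \<open>A sum of nonnegative terms is at least its largest one. The argument 1 is included in
  the hypothesis for the sake of \<open>omega 1 1 a\<close>.\<close>

lemma balanced_cost_ge:
  assumes omega: "\<forall>a\<in>{0<..1}. \<forall>b\<in>{0<..1}. omega 1 a b = w 1 a b" and n: "1 \<le> n"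
  shows "real n powr balanced_exponent w \<le> (INF (\<tau>1, \<tau>2) \<in> {0<..<1} \<times> {0<..<1}. balanced_cost n \<tau>1 \<tau>2)"
proof (rule cINF_greatest)
  show "{0<..<1} \<times> {0<..<1} \<noteq> ({} :: (real \<times> real) set)" by simp
  fix x :: "real \<times> real" assume "x \<in> {0<..<1} \<times> {0<..<1}"
  then obtain a b where x: "x = (a, b)" and ab: "a \<in> {0<..<1}" "b \<in> {0<..<1}" by auto
  have eq: "omega 1 a b = w 1 a b" "omega 1 1 a = w 1 1 a" using omega ab by auto
  have "real n powr balanced_exponent w \<le> real n powr max (a + b) (max (w 1 a b - b) (w 1 1 a - a))"
    using n balanced_exponent_le[OF ab, of w] by (intro powr_mono) auto
  also have "\<dots> \<le> balanced_cost n a b"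
    unfolding balanced_cost_def eq max_def by (simp add: add_nonneg_nonneg)
  finally show "real n powr balanced_exponent w \<le> (case x of (\<tau>1, \<tau>2) \<Rightarrow> balanced_cost n \<tau>1 \<tau>2)"
    by (simp add: x)
qed

lemma product5_lower_bound_exponent:
  assumes conj: hinted_uMv_conjecture and omega: "\<forall>a\<in>{0<..1}. \<forall>b\<in>{0<..1}. omega 1 a b = w 1 a b"
    and dyn: "dynamic_product5 c pI pU pQ TI TU TQ" and poly: "polynomially_bounded TI" and "0 < \<epsilon>"
  shows "(\<lambda>n. real (max (TU n) (TQ n))) \<in> \<Omega>(\<lambda>n. real n powr (balanced_exponent w - \<epsilon>))"
proof -
  have "(\<lambda>n. real n powr (balanced_exponent w - \<epsilon>)) \<in> O(\<lambda>n.
    (INF (\<tau>1, \<tau>2) \<in> {0<..<1} \<times> {0<..<1}. balanced_cost n \<tau>1 \<tau>2) * real n powr (-\<epsilon>))"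
  proof (rule bigoI[of _ 1])
    show "\<forall>\<^sub>F n in at_top. norm (real n powr (balanced_exponent w - \<epsilon>)) \<le> 1 * norm
      ((INF (\<tau>1, \<tau>2) \<in> {0<..<1} \<times> {0<..<1}. balanced_cost n \<tau>1 \<tau>2) * real n powr (-\<epsilon>))"
      using eventually_ge_at_top[of 1]
    proof eventually_elim
      case (elim n)
      have "real n powr (balanced_exponent w - \<epsilon>) = real n powr balanced_exponent w * real n powr (-\<epsilon>)"
        by (simp flip: powr_add)
      also have "\<dots> \<le> (INF (\<tau>1, \<tau>2) \<in> {0<..<1} \<times> {0<..<1}. balanced_cost n \<tau>1 \<tau>2) * real n powr (-\<epsilon>)"
        by (intro mult_right_mono balanced_cost_ge[of w n, OF omega elim]) auto
      finally show ?case by simp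
    qed
  qed
  with product5_lower_bound[OF conj dyn poly \<open>0 < \<epsilon>\<close>] show ?thesis
    unfolding bigomega_iff_bigo by (rule landau_o.big_trans[rotated])
qed

theorem theorem5p13:
  assumes "hinted_uMv_conjecture"
  shows
    "(\<forall>\<epsilon>>0. \<forall>c pI pU pQ TI TU TQ.
        dynamic_product5 c pI pU pQ TI TU TQ \<and> polynomially_bounded TI \<longrightarrow>
        (\<lambda>n. real (max (TU n) (TQ n))) \<in> \<Omega>(\<lambda>n.
          (INF (\<tau>1, \<tau>2) \<in> {0<..<1} \<times> {0<..<1}.
             real n powr (\<tau>1 + \<tau>2) + real n powr (omega 1 \<tau>1 \<tau>2 - \<tau>2)
               + real n powr (omega 1 1 \<tau>1 - \<tau>1))
          * real n powr (-\<epsilon>)))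
     \<and> round (1000 * balanced_exponent current_omega) = 1407
     \<and> ((\<forall>a\<in>{0<..1}. \<forall>b\<in>{0<..1}. omega 1 a b = current_omega 1 a b) \<longrightarrow>
        (\<forall>\<epsilon>>0. \<forall>c pI pU pQ TI TU TQ.
           dynamic_product5 c pI pU pQ TI TU TQ \<and> polynomially_bounded TI \<longrightarrow>
           (\<lambda>n. real (max (TU n) (TQ n)))
             \<in> \<Omega>(\<lambda>n. real n powr (balanced_exponent current_omega - \<epsilon>))))"
  using product5_lower_bound[OF assms, unfolded balanced_cost_def] round_balanced_exponent_current_omega
    product5_lower_bound_exponent[OF assms, of current_omega] by blast

end
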